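(* Let $X$ be a Riemannian manifold, $\mu$ a probability measure on $\varGamma_X$, $\{\eta_x\}_{x\in X}$ a family of probability measures on $\mathfrak{X}=\bigsqcup_{n=0}^\infty X^n$ such that $x\mapsto\eta_x(\bar B)$ is measurable for every Borel $\bar B\subset\mathfrak{X}$, and let $\mu_{\mathrm{cl}}$ be the corresponding cluster measure. Assume: (i) there is a locally finite measure $\theta$ on $X$ such that $\mu\in\mathcal{M}^1_\theta(\varGamma_X)$, and $\int_X\eta_x(\mathfrak{X}_B)\,\theta(dx)<\infty$ for every compact $B\subset X$; (ii) for every $x\in X$, $\eta_x$ is absolutely continuous with respect to the Riemannian volume $d\bar y$ on $\mathfrak{X}$, with density $h_x(\bar y)=\eta_x(d\bar y)/d\bar y>0$ for a.a. $\bar y\in\mathfrak{X}$. Then $\mu_{\mathrm{cl}}$ is quasi-invariant with respect to the action of the diffeomorphism group $\mathrm{Diff}_0(X)$ on $\varGamma_X$, that is, $\varphi^*\mu_{\mathrm{cl}}$ is absolutely continuous with respect to $\mu_{\mathrm{cl}}$ for every $\varphi\in\mathrm{Diff}_0(X)$. The corresponding Radon–Nikodym density is $$R^{\varphi}_{\mu_{\mathrm{cl}}}=\frac{d(\varphi^*\mu_{\mathrm{cl}})}{d\mu_{\mathrm{cl}}}=\mathcal{I}_{\mathfrak{q}}^*R^{\hat\varphi}_{\hat\mu}\in L^1(\varGamma_X,\mu_{\mathrm{cl}}),\qquad R^{\hat\varphi}_{\hat\mu}(\hat\gamma)=\prod_{z\in\hat\gamma}\rho_\eta^{\bar\varphi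}(z).$$
   Context: A configuration in a space $S$ is a measure $\gamma=\sum_i\delta_{s_i}$ for a countable family of points; it is proper if $\gamma(B)<\infty$ for compact $B$ and $\gamma(\{s\})\le1$ for all $s$; $\varGamma_S$ is the set of proper configurations with the $\sigma$-algebra generated by the maps $\gamma\mapsto\gamma(B)$. $\langle f,\gamma\rangle=\sum_{s\in\gamma}f(s)$. $\mathfrak{p}(\bar y)=\sum_{y_i\in\bar y}\delta_{y_i}$ for $\bar y\in\mathfrak{X}$; $\mathfrak{X}_B$ is the set of $\bar y\in\mathfrak{X}$ having at least one coordinate in $B$; $\mathcal{Z}=X\times\mathfrak{X}$. Locally finite measure: finite on compact sets. $\mathcal{M}^r_\theta(\varGamma_X)$ ($r\ge1$) is the class of probability measures $\mu$ on $\varGamma_X$ such that $\int|\langle f,\gamma\rangle|^r\mu(d\gamma)<\infty$ for every $f\in\bigcap_{1\le\kappa\le r}L^\kappa(X,\theta)$ (elements of $L^\kappa$ being classes of $\theta$-a.e. equal functions, so that $\langle f,\gamma\rangle$ is required to be $\mu$-a.s. independent of the representative). Cluster measure $\mu_{\mathrm{cl}}$: the distribution of $\sum_{x\in\gamma_c}\gamma_x'$, where $\gamma_c$ has law $\mu$ and, given $\gamma_c$, the $\gamma_x'$ are independent with laws $\eta_x\circ\mathfrak{p}^{-1}$. Under the present assumptions it is supported on $\varGamma_X$. The measure $\hat\mu$ on $\varGamma_{\mathcal{Z}}$ is $\hat\mu(d\hat\gamma)=\bigotimes_{x\in\gamma}\eta_x(d\bar y_x)\,\mu(d\gamma)$,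 $\hat\gamma=\sum_{x\in\gamma}\delta_{(x,\bar y_x)}$. The map $\mathfrak{q}(\hat\gamma)=\sum_{(x,\bar y)\in\hat\gamma}\mathfrak{p}(\bar y)$ satisfies $\mu_{\mathrm{cl}}=\hat\mu\circ\mathfrak{q}^{-1}$. For $G\in L^1(\varGamma_{\mathcal{Z}},\hat\mu)$, $\mathcal{I}_{\mathfrak{q}}^*G\in L^1(\varGamma_X,\mu_{\mathrm{cl}})$ is the element determined by $\int F\,\mathcal{I}_{\mathfrak{q}}^*G\,d\mu_{\mathrm{cl}}=\int F(\mathfrak{q}(\hat\gamma))\,G(\hat\gamma)\,\hat\mu(d\hat\gamma)$ for all $F\in L^\infty(\varGamma_X,\mu_{\mathrm{cl}})$. $\mathrm{Diff}_0(X)$ is the group of diffeomorphisms $\varphi$ of $X$ with compact support (closure of $\{x:\varphi(x)\ne x\}$). It acts on $\varGamma_X$ by $\varphi(\gamma)=\{\varphi(x):x\in\gamma\}$, and $\varphi^*\mu_{\mathrm{cl}}=\mu_{\mathrm{cl}}\circ\varphi^{-1}$. On $\mathfrak{X}$: $\bar\varphi(y_1,\dots,y_n)=(\varphi(y_1),\dots,\varphi(y_n))$; on $\mathcal{Z}$: $\hat\varphi(x,\bar y)=(x,\bar\varphi(\bar y))$. The density $$\rho_\eta^{\bar\varphi}(x,\bar y):=\frac{d(\bar\varphi^*\eta_x)}{d\eta_x}(\bar y)=\frac{h_x(\bar\varphi^{-1}(\bar y))}{h_x(\bar y)}\,J_{\bar\varphi}(\bar\varphi^{-1}(\bar y))^{-1},$$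 set equal to $1$ if $h_x(\bar y)=0$ or $h_x(\bar\varphi^{-1}(\bar y))=0$, where $J_{\bar\varphi}(\bar y)=\prod_{y_i\in\bar y}J_\varphi(y_i)$ and $J_\varphi$ is the (absolute value of the) Jacobian determinant of $\varphi$ with respect to Riemannian volume.
   Formalization: The formula for the Radon–Nikodym density is stated for densities h_x(ȳ) that are jointly Borel in (x,ȳ); for versions altered on x-dependent null sets the product density may be non-measurable. Quasi-invariance itself is stated without this condition. *)

theory Defs
  imports "HOL-Probability.Probability"
begin

section \<open>The space of finite tuples\<close>

text \<open>The disjoint union of all powers of a space is represented by the type of lists over it.
  The topology below is the disjoint-union topology of the product topologies: the basic open
  sets are the boxes, each of which only contains lists of one length.\<close>

instantiation list :: (topological_space) topological_space
begin

definition open_list :: "'a list set \<Rightarrow> bool" where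
  "open_list U \<longleftrightarrow> (\<forall>xs\<in>U. \<exists>Vs. list_all2 (\<lambda>x V. open V \<and> x \<in> V) xs Vs \<and>
      {ys. list_all2 (\<lambda>y V. y \<in> V) ys Vs} \<subseteq> U)"

instance
proof
  have "list_all2 (\<lambda>x V. open V \<and> x \<in> V) xs (map (\<lambda>_. UNIV) xs)" for xs :: "'a list"
    by (simp add: list_all2_conv_all_nth)
  then show "open (UNIV :: 'a list set)"
    unfolding open_list_def by blast
next
  fix S T :: "'a list set"
  assume S: "open S" and T: "open T"
  show "open (S \<inter> T)"
    unfolding open_list_def
  proof
    fix xs assume "xs \<in> S \<inter> T"
    then obtain Vs Ws
      where V: "list_all2 (\<lambda>x V. open V \<and> x \<in> V) xs Vs" "{ys. list_all2 (\<lambda>y V. y \<in> V) ys Vs} \<subseteq> S"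
        and W: "list_all2 (\<lambda>x V. open V \<and> x \<in> V) xs Ws" "{ys. list_all2 (\<lambda>y V. y \<in> V) ys Ws} \<subseteq> T"
      using S T unfolding open_list_def by blast
    let ?Us = "map2 (\<inter>) Vs Ws"
    have len: "length Vs = length xs" "length Ws = length xs"
      using V(1) W(1) by (auto dest: list_all2_lengthD)
    have "list_all2 (\<lambda>x V. open V \<and> x \<in> V) xs ?Us"
      using V(1) W(1) len by (auto simp: list_all2_conv_all_nth)
    moreover have "list_all2 (\<lambda>y V. y \<in> V) ys Vs \<and> list_all2 (\<lambda>y V. y \<in> V) ys Ws"
      if "list_all2 (\<lambda>y V. y \<in> V) ys ?Us" for ys
      using that len by (auto simp: list_all2_conv_all_nth)
    ultimately show "\<exists>Us. list_all2 (\<lambda>x V. open V \<and> x \<in> V) xs Us \<and>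
        {ys. list_all2 (\<lambda>y V. y \<in> V) ys Us} \<subseteq> S \<inter> T"
      using V(2) W(2) by (intro exI[of _ ?Us]) blast
  qed
next
  fix K :: "'a list set set"
  assume "\<forall>S\<in>K. open S"
  then show "open (\<Union>K)"
    unfolding open_list_def by (meson Union_iff Union_upper order_trans)
qed

end

section \<open>Smooth maps and Riemannian manifolds\<close>

primrec Ck_on :: "nat \<Rightarrow> 'a::real_normed_vector set \<Rightarrow> ('a \<Rightarrow> 'b::real_normed_vector) \<Rightarrow> bool" where
  "Ck_on 0 S f \<longleftrightarrow> continuous_on S f"
| "Ck_on (Suc k) S f \<longleftrightarrow>
     (\<forall>x\<in>S. f differentiable (at x)) \<and> (\<forall>v. Ck_on k S (\<lambda>x. frechet_derivative f (at x) v))"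

text \<open>Only used for open subsets of the finite-dimensional spaces.\<close>

definition smooth_on :: "'a::real_normed_vector set \<Rightarrow> ('a \<Rightarrow> 'b::real_normed_vector) \<Rightarrow> bool" where
  "smooth_on S f \<longleftrightarrow> (\<forall>k. Ck_on k S f)"

type_synonym ('x, 'n) chart = "'x set \<times> ('x \<Rightarrow> real ^ 'n)"

definition is_chart :: "('x::topological_space, 'n::finite) chart \<Rightarrow> bool" where
  "is_chart = (\<lambda>(U, c). open U \<and> open (c ` U) \<and> homeomorphism U (c ` U) c (inv_into U c))"

definition smooth_atlas :: "('x::topological_space, 'n::finite) chart set \<Rightarrow> bool" where
  "smooth_atlas A \<longleftrightarrow> (\<Union>C\<in>A. fst C) = UNIV \<and> (\<forall>C\<in>A. is_chart C) \<and>
     (\<forall>(U, c)\<in>A. \<forall>(V, d)\<in>A. smooth_on (c ` (U \<inter> V)) (d \<circ> inv_into U c))"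

text \<open>A metric tensor is given by its Gram matrices: \<open>G (U, c) x\<close> is the matrix of the
  scalar product on the tangent space at \<open>x \<in> U\<close> in the basis of coordinate vector fields of the
  chart \<open>(U, c)\<close>. The last clause is the transformation rule of covariant 2-tensors.\<close>

definition riemannian_metric ::
  "('x::topological_space, 'n::finite) chart set \<Rightarrow> (('x, 'n) chart \<Rightarrow> 'x \<Rightarrow> real ^ 'n ^ 'n) \<Rightarrow> bool" where
  "riemannian_metric A G \<longleftrightarrow>
     (\<forall>(U, c)\<in>A. smooth_on (c ` U) (\<lambda>v. G (U, c) (inv_into U c v)) \<and>
        (\<forall>x\<in>U. transpose (G (U, c) x) = G (U, c) x \<and> (\<forall>v. v \<noteq> 0 \<longrightarrow> 0 < v \<bullet> (G (U, c) x *v v)))) \<and>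
     (\<forall>(U, c)\<in>A. \<forall>(V, d)\<in>A. \<forall>x\<in>U \<inter> V.
        (let D = jacobian (d \<circ> inv_into U c) (at (c x))
         in G (U, c) x = transpose D ** G (V, d) x ** D))"

definition riemannian_manifold ::
  "('x::{t2_space, second_countable_topology}, 'n::finite) chart set \<Rightarrow>
   (('x, 'n) chart \<Rightarrow> 'x \<Rightarrow> real ^ 'n ^ 'n) \<Rightarrow> bool" where
  "riemannian_manifold A G \<longleftrightarrow> smooth_atlas A \<and> riemannian_metric A G"

definition riemannian_volume ::
  "('x::topological_space, 'n::finite) chart set \<Rightarrow> (('x, 'n) chart \<Rightarrow> 'x \<Rightarrow> real ^ 'n ^ 'n) \<Rightarrow> 'x measure" where
  "riemannian_volume A G = (THE M. sets M = sets borel \<and>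
     (\<forall>(U, c)\<in>A. \<forall>B\<in>sets borel. B \<subseteq> U \<longrightarrow>
        emeasure M B =
          (\<integral>\<^sup>+v. ennreal (sqrt (det (G (U, c) (inv_into U c v)))) * indicator (c ` B) v \<partial>lborel)))"

definition smooth_map :: "('x::topological_space, 'n::finite) chart set \<Rightarrow> ('x \<Rightarrow> 'x) \<Rightarrow> bool" where
  "smooth_map A \<phi> \<longleftrightarrow> continuous_on UNIV \<phi> \<and>
     (\<forall>(U, c)\<in>A. \<forall>(V, d)\<in>A. smooth_on (c ` (U \<inter> \<phi> -` V)) (d \<circ> \<phi> \<circ> inv_into U c))"

definition Diff0 :: "('x::topological_space, 'n::finite) chart set \<Rightarrow> ('x \<Rightarrow> 'x) set" where
  "Diff0 A = {\<phi>. bij \<phi> \<and> smooth_map A \<phi> \<and> smooth_map A (inv \<phi>) \<and> compact (closure {x. \<phi> x \<noteq> x})}"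

definition chart_at :: "('x, 'n) chart set \<Rightarrow> 'x \<Rightarrow> ('x, 'n) chart" where
  "chart_at A x = (SOME C. C \<in> A \<and> x \<in> fst C)"

text \<open>The absolute Jacobian determinant with respect to the Riemannian volume, in local
  coordinates; its value does not depend on the charts chosen at \<open>x\<close> and \<open>\<phi> x\<close>.\<close>

definition riemannian_jacobian ::
  "('x::topological_space, 'n::finite) chart set \<Rightarrow> (('x, 'n) chart \<Rightarrow> 'x \<Rightarrow> real ^ 'n ^ 'n) \<Rightarrow>
   ('x \<Rightarrow> 'x) \<Rightarrow> 'x \<Rightarrow> real" where
  "riemannian_jacobian A G \<phi> x =
     (let (U, c) = chart_at A x; (V, d) = chart_at A (\<phi> x)
      in \<bar>det (jacobian (d \<circ> \<phi> \<circ> inv_into U c) (at (c x)))\<bar> *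
         sqrt (det (G (V, d) (\<phi> x))) / sqrt (det (G (U, c) x)))"

section \<open>Configurations\<close>

definition superpose :: "'i set \<Rightarrow> ('i \<Rightarrow> 'a::topological_space measure) \<Rightarrow> 'a measure" where
  "superpose I m = measure_of UNIV (sets borel) (\<lambda>B. \<integral>\<^sup>+i. emeasure (m i) B \<partial>count_space I)"

text \<open>The push-forward of the counting measure on \<open>I\<close> under \<open>s\<close> is the sum of the Dirac measures
  at the points \<open>s i\<close>.\<close>

definition dirac_sum :: "'i set \<Rightarrow> ('i \<Rightarrow> 'a::topological_space) \<Rightarrow> 'a measure" where
  "dirac_sum I s = distr (count_space I) borel s"

definition configurations :: "'a::topological_space measure set" where
  "configurations = {\<gamma>. \<exists>(I :: nat set) s. \<gamma> = dirac_sum I s}"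

definition proper_configurations :: "'a::topological_space measure set" where
  "proper_configurations = {\<gamma>\<in>configurations.
     (\<forall>B. compact B \<longrightarrow> emeasure \<gamma> B < \<infinity>) \<and> (\<forall>s. emeasure \<gamma> {s} \<le> 1)}"

definition evaluation_space :: "'a::topological_space measure set \<Rightarrow> 'a measure measure" where
  "evaluation_space \<Omega> =
     sigma \<Omega> {{\<gamma>\<in>\<Omega>. emeasure \<gamma> B \<in> E} | B E. B \<in> sets borel \<and> E \<in> sets borel}"

text \<open>\<open>gconf_space\<close> allows multiple and accumulation points; \<open>conf_space\<close> is the space of proper
  configurations.\<close>

abbreviation gconf_space :: "'a::topological_space measure measure" where
  "gconf_space \<equiv> evaluation_space configurations"

abbreviation conf_space :: "'a::topological_space measure measure" where
  "conf_space \<equiv> evaluation_space proper_configurations"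

definition points :: "'a measure \<Rightarrow> 'a set" where
  "points \<gamma> = {s. emeasure \<gamma> {s} \<noteq> 0}"

text \<open>The classes of measures for which linear functionals are \<open>r\<close>-integrable. Being integrable,
  \<open>\<langle>f, \<gamma>\<rangle>\<close> has to be almost surely defined, i.e. absolutely convergent; this is required
  explicitly because the Bochner integral of a non-integrable function is 0 by convention.\<close>

definition moment_class :: "real \<Rightarrow> 'a::topological_space measure \<Rightarrow> 'a measure measure set" where
  "moment_class r \<theta> =
     (let L = {f :: 'a \<Rightarrow> real. f \<in> borel_measurable borel \<and>
                 (\<forall>\<kappa>\<in>{1..r}. integrable \<theta> (\<lambda>x. \<bar>f x\<bar> powr \<kappa>))}
      in {\<mu>. sets \<mu> = sets conf_space \<and> prob_space \<mu> \<and>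
            (\<forall>f\<in>L. (AE \<gamma> in \<mu>. integrable \<gamma> f) \<and> integrable \<mu> (\<lambda>\<gamma>. \<bar>\<integral>x. f x \<partial>\<gamma>\<bar> powr r)) \<and>
            (\<forall>f\<in>L. \<forall>g\<in>L. (AE x in \<theta>. f x = g x) \<longrightarrow>
               (AE \<gamma> in \<mu>. (\<integral>x. f x \<partial>\<gamma>) = (\<integral>x. g x \<partial>\<gamma>)))})"

definition locally_finite_measure :: "'a::topological_space measure \<Rightarrow> bool" where
  "locally_finite_measure \<theta> \<longleftrightarrow> sets \<theta> = sets borel \<and> (\<forall>B. compact B \<longrightarrow> emeasure \<theta> B < \<infinity>)"

section \<open>Cluster measures\<close>

definition tuple_conf :: "'a::topological_space list \<Rightarrow> 'a measure" where
  "tuple_conf ys = dirac_sum {..<length ys} (\<lambda>i. ys ! i)"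

definition tuple_volume :: "'a::topological_space measure \<Rightarrow> 'a list measure" where
  "tuple_volume M = superpose UNIV
     (\<lambda>n::nat. distr (\<Pi>\<^sub>M i\<in>{..<n}. M) borel (\<lambda>\<omega>. map \<omega> [0..<n]))"

text \<open>The law of the sum of independent clusters, as a measure on the space of all
  configurations, and its trace on the proper ones (where it is supported under the assumptions
  of the theorem).\<close>

definition gen_cluster_measure ::
  "'a::topological_space measure measure \<Rightarrow> ('a \<Rightarrow> 'a list measure) \<Rightarrow> 'a measure measure" where
  "gen_cluster_measure \<mu> \<eta> = \<mu> \<bind> (\<lambda>\<gamma>.
     distr (\<Pi>\<^sub>M x\<in>points \<gamma>. distr (\<eta> x) gconf_space tuple_conf) gconf_space
       (\<lambda>\<omega>. superpose (points \<gamma>) \<omega>))"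

definition cluster_measure ::
  "'a::topological_space measure measure \<Rightarrow> ('a \<Rightarrow> 'a list measure) \<Rightarrow> 'a measure measure" where
  "cluster_measure \<mu> \<eta> = restrict_space (gen_cluster_measure \<mu> \<eta>) proper_configurations"

definition marked_measure ::
  "'a::topological_space measure measure \<Rightarrow> ('a \<Rightarrow> 'a list measure) \<Rightarrow> ('a \<times> 'a list) measure measure" where
  "marked_measure \<mu> \<eta> = \<mu> \<bind> (\<lambda>\<gamma>.
     distr (\<Pi>\<^sub>M x\<in>points \<gamma>. \<eta> x) conf_space (\<lambda>\<omega>. dirac_sum (points \<gamma>) (\<lambda>x. (x, \<omega> x))))"

definition cluster_map :: "('a::topological_space \<times> 'a list) measure \<Rightarrow> 'a measure" where
  "cluster_map \<gamma>h = superpose (points \<gamma>h) (\<lambda>z. tuple_conf (snd z))"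

text \<open>The operator \<open>\<I>\<^sub>\<qq>\<^sup>*\<close>; the element of \<open>L\<^sup>1\<close> is determined up to equality almost everywhere.
  Test functions \<open>F\<close> matter only on proper configurations, hence the integral over those
  \<open>\<gamma>h\<close> whose image is proper.\<close>

definition Iq_star ::
  "'a::topological_space measure measure \<Rightarrow> ('a \<Rightarrow> 'a list measure) \<Rightarrow>
   (('a \<times> 'a list) measure \<Rightarrow> real) \<Rightarrow> 'a measure \<Rightarrow> real" where
  "Iq_star \<mu> \<eta> G = (SOME g. integrable (cluster_measure \<mu> \<eta>) g \<and>
     (\<forall>F :: 'a measure \<Rightarrow> real. F \<in> borel_measurable (cluster_measure \<mu> \<eta>) \<and>
          bounded (F ` space (cluster_measure \<mu> \<eta>)) \<longrightarrow>
        (\<integral>\<gamma>. F \<gamma> * g \<gamma> \<partial>cluster_measure \<mu> \<eta>) =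
        (LINT \<gamma>h:{\<gamma>h. cluster_map \<gamma>h \<in> proper_configurations}|marked_measure \<mu> \<eta>.
           F (cluster_map \<gamma>h) * G \<gamma>h)))"

definition tuple_jacobian ::
  "('x::topological_space, 'n::finite) chart set \<Rightarrow> (('x, 'n) chart \<Rightarrow> 'x \<Rightarrow> real ^ 'n ^ 'n) \<Rightarrow>
   ('x \<Rightarrow> 'x) \<Rightarrow> 'x list \<Rightarrow> real" where
  "tuple_jacobian A G \<phi> ys = prod_list (map (riemannian_jacobian A G \<phi>) ys)"

definition cluster_density ::
  "('x::topological_space, 'n::finite) chart set \<Rightarrow> (('x, 'n) chart \<Rightarrow> 'x \<Rightarrow> real ^ 'n ^ 'n) \<Rightarrow>
   ('x \<Rightarrow> 'x list \<Rightarrow> real) \<Rightarrow> ('x \<Rightarrow> 'x) \<Rightarrow> 'x \<times> 'x list \<Rightarrow> real" where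
  "cluster_density A G h \<phi> = (\<lambda>(x, ys). let ys' = map (inv \<phi>) ys in
     if h x ys = 0 \<or> h x ys' = 0 then 1
     else h x ys' / h x ys * inverse (tuple_jacobian A G \<phi> ys'))"

text \<open>The factors are 1 except for clusters that meet the compact support of \<open>\<phi>\<close>; almost surely
  there are only finitely many of these. In the exceptional case of infinitely many nontrivial
  factors the product is 1 by convention.\<close>

definition marked_density ::
  "('x::topological_space, 'n::finite) chart set \<Rightarrow> (('x, 'n) chart \<Rightarrow> 'x \<Rightarrow> real ^ 'n ^ 'n) \<Rightarrow>
   ('x \<Rightarrow> 'x list \<Rightarrow> real) \<Rightarrow> ('x \<Rightarrow> 'x) \<Rightarrow> ('x \<times> 'x list) measure \<Rightarrow> real" where
  "marked_density A G h \<phi> \<gamma>h =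
     (\<Prod>z | z \<in> points \<gamma>h \<and> cluster_density A G h \<phi> z \<noteq> 1. cluster_density A G h \<phi> z)"

definition push_law :: "('a::topological_space \<Rightarrow> 'a) \<Rightarrow> 'a measure measure \<Rightarrow> 'a measure measure" where
  "push_law \<phi> M = distr M conf_space (\<lambda>\<gamma>. distr \<gamma> borel \<phi>)"

end

(* Conditionally on the configuration of centres, a diffeomorphism phi moves almost surely only
   finitely many clusters, because the expected number of clusters that hit the support of phi is
   finite. On the event that all clusters outside a finite set of centres miss the support, the
   infinite product of the cluster laws is transformed like a finite product, by the change of
   variables formula for the Riemannian volume; letting the finite set grow gives the density of
   the transformed product of the cluster laws. Integrating over the centres and projecting from
   marked configurations to configurations yields quasi-invariance and identifies the density.
   The laws depend measurably on the centres because proper configuration spaces are generated by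
   the void events {gamma B = 0}, whose conditional probabilities are limits of finite products
   over the points of the centre configuration. *)

theory Submission
  imports Defs
begin

text \<open>Assumption (i) is used through a single function, the
  \<open>\<eta> x\<close>-probability that a cluster hits a given compact set. It is
  \<open>\<theta>\<close>-integrable, so membership in the moment class makes its sum over almost
  every configuration of centres finite; that sum is the conditional expected number of hits. Along
  an exhaustion by compact sets the same bound gives local finiteness of the superposition.
  Simplicity comes from (ii): the volume has no atoms, the coordinate spaces having positive
  dimension, so almost surely the points of a cluster are distinct and no two clusters share a
  point. Since properness holds only almost surely, superpositions live in the space of all
  configurations until the proper ones are known to form a measurable set of full measure. The
  volume is given by its values in charts alone, so its existence, uniqueness and transformation law
  are glued from charts. Finally, \<open>h x\<close> is measurable for each \<open>x\<close>
  separately: absolute continuity is proved fibrewise over the centres, and joint measurability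
  enters only for the density, where the Radon-Nikodym derivative is shown to satisfy the equation
  that determines \<open>Iq_star\<close>.\<close>

section \<open>Change of variables\<close>

text \<open>The change of variables theorems of the library require a well-ordered index type. They are
  transferred to \<open>real ^ 'n\<close> along a copy of \<open>'n\<close> that carries a well-order.\<close>

typedef 'n ordered_copy = "UNIV :: 'n set" ..

instance ordered_copy :: (finite) finite
proof
  have "(UNIV :: 'a ordered_copy set) = Abs_ordered_copy ` UNIV"
    by (metis Rep_ordered_copy_inverse surjI)
  then show "finite (UNIV :: 'a ordered_copy set)"
    using finite_imageI[OF finite[of "UNIV :: 'a set"], of Abs_ordered_copy] by simp
qed

text \<open>An arbitrary injection; the order of \<open>nat\<close> pulled back along it is a
  well-order on any finite index type.\<close>

definition index_of :: "'n::finite \<Rightarrow> nat" where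
  "index_of = (SOME f. inj f)"

lemma inj_index_of: "inj (index_of :: 'a::finite \<Rightarrow> nat)"
proof -
  have "\<exists>f :: 'a \<Rightarrow> nat. inj f"
    using finite_imp_inj_to_nat_seg[OF finite[of "UNIV :: 'a set"]] by auto
  then show ?thesis
    unfolding index_of_def by (rule someI_ex)
qed

instantiation ordered_copy :: (finite) wellorder
begin

definition "x \<le> y \<longleftrightarrow> index_of (Rep_ordered_copy x) \<le> index_of (Rep_ordered_copy y)"

definition "x < y \<longleftrightarrow> index_of (Rep_ordered_copy x) < index_of (Rep_ordered_copy y)"

instance
proof
  fix P and a :: "'a ordered_copy"
  assume "\<And>x::'a ordered_copy. (\<And>y. y < x \<Longrightarrow> P y) \<Longrightarrow> P x"
  then show "P a"
    unfolding less_ordered_copy_def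
    by (induction a rule: measure_induct_rule[where f = "\<lambda>x. index_of (Rep_ordered_copy x)"]) blast
next
  fix x y :: "'a ordered_copy" assume "x \<le> y" "y \<le> x"
  then show "x = y"
    unfolding less_eq_ordered_copy_def
    by (intro Rep_ordered_copy_inject[THEN iffD1] injD[OF inj_index_of] antisym)
qed (simp_all add: less_eq_ordered_copy_def less_ordered_copy_def less_le_not_le linear)

end

definition reindex :: "real ^ 'n \<Rightarrow> real ^ 'n ordered_copy" where
  "reindex v = (\<chi> i. v $ Rep_ordered_copy i)"

definition unindex :: "real ^ 'n ordered_copy \<Rightarrow> real ^ 'n" where
  "unindex w = (\<chi> i. w $ Abs_ordered_copy i)"

lemma unindex_reindex [simp]: "unindex (reindex v) = v"
  by (simp add: reindex_def unindex_def Abs_ordered_copy_inverse vec_eq_iff)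

lemma reindex_unindex [simp]: "reindex (unindex v) = v"
  by (simp add: reindex_def unindex_def Rep_ordered_copy_inverse vec_eq_iff)

lemma linear_reindex: "linear (reindex :: real ^ 'n::finite \<Rightarrow> _)"
  by (rule linearI) (simp_all add: reindex_def vec_eq_iff)

lemma linear_unindex: "linear (unindex :: _ \<Rightarrow> real ^ 'n::finite)"
  by (rule linearI) (simp_all add: unindex_def vec_eq_iff)

lemma bij_Rep_ordered_copy: "bij (Rep_ordered_copy :: 'n ordered_copy \<Rightarrow> 'n)"
proof (rule bijI)
  show "inj (Rep_ordered_copy :: 'n ordered_copy \<Rightarrow> 'n)"
    by (rule injI) (simp add: Rep_ordered_copy_inject)
  show "surj (Rep_ordered_copy :: 'n ordered_copy \<Rightarrow> 'n)"
    by (rule surjI[of _ Abs_ordered_copy]) (simp add: Abs_ordered_copy_inverse)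
qed

text \<open>Conjugation by the bijection of index types maps the permutations of one type onto those
  of the other and preserves signs, so the Leibniz sums agree term by term.\<close>

lemma det_reindex:
  fixes M :: "real ^ 'n::finite ^ 'n"
  shows "det (\<chi> i j. M $ Rep_ordered_copy i $ Rep_ordered_copy j) = det M"
proof -
  let ?R = "Rep_ordered_copy :: 'n ordered_copy \<Rightarrow> 'n"
  let ?\<Phi> = "map_permutation UNIV ?R"
  have inj: "inj ?R" and bij: "bij ?R" using bij_Rep_ordered_copy bij_def by auto
  have app: "?\<Phi> p (?R i) = ?R (p i)" if "p permutes UNIV" for p i
    using map_permutation_apply[OF inj, of i p] by simp
  have "bij_betw ?\<Phi> {p. p permutes UNIV} {p. p permutes UNIV}"
  proof (rule bij_betwI')
    fix p q :: "'n ordered_copy \<Rightarrow> 'n ordered_copy" assume "p \<in> {p. p permutes UNIV}" "q \<in> {p. p permutes UNIV}"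
    then show "(?\<Phi> p = ?\<Phi> q) = (p = q)"
      using app[of p] app[of q] injD[OF inj] by (metis ext mem_Collect_eq)
  next
    fix p :: "'n ordered_copy \<Rightarrow> 'n ordered_copy" assume "p \<in> {p. p permutes UNIV}"
    then show "?\<Phi> p \<in> {p. p permutes UNIV}"
      using map_permutation_permutes[of ?R UNIV UNIV p] bij by simp
  next
    fix q :: "'n \<Rightarrow> 'n" assume q: "q \<in> {p. p permutes UNIV}"
    \<comment> \<open>Surjectivity: \<open>q\<close> is conjugated back to the copy.\<close>
    define p where "p = (inv ?R \<circ> q \<circ> ?R)"
    have p: "p permutes UNIV"
      unfolding p_def using permutes_bij[OF q[simplified]] bij
      by (intro bij_imp_permutes) (auto intro!: bij_comp bij_imp_bij_inv)
    have "?\<Phi> p (?R i) = q (?R i)" for i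
      using app[OF p] bij by (simp add: p_def bij_is_surj surj_f_inv_f)
    then have "?\<Phi> p = q" using bij_is_surj[OF bij] by (metis ext surjD)
    with p show "\<exists>p\<in>{p. p permutes UNIV}. q = ?\<Phi> p" by blast
  qed
  then have "det M = (\<Sum>p | p permutes UNIV. of_int (sign (?\<Phi> p)) * (\<Prod>i\<in>UNIV. M $ i $ ?\<Phi> p i))"
    unfolding det_def by (simp add: sum.reindex_bij_betw[where h = ?\<Phi>, symmetric])
  also have "\<dots> = (\<Sum>p | p permutes UNIV. of_int (sign p) * (\<Prod>i\<in>UNIV. M $ ?R i $ ?R (p i)))"
  proof (intro sum.cong refl)
    fix p :: "'n ordered_copy \<Rightarrow> 'n ordered_copy" assume p: "p \<in> {p. p permutes UNIV}"
    have "(\<Prod>i\<in>UNIV. M $ i $ ?\<Phi> p i) = (\<Prod>i\<in>UNIV. M $ ?R i $ ?\<Phi> p (?R i))"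
      using prod.reindex_bij_betw[OF bij, of "\<lambda>i. M $ i $ ?\<Phi> p i"] by simp
    with p app show "of_int (sign (?\<Phi> p)) * (\<Prod>i\<in>UNIV. M $ i $ ?\<Phi> p i) =
        of_int (sign p) * (\<Prod>i\<in>UNIV. M $ ?R i $ ?R (p i))"
      by (simp add: sign_map_permutation[OF inj])
  qed
  finally show ?thesis
    unfolding det_def by simp
qed


lemma prod_Basis_vec: "(\<Prod>b\<in>(Basis :: (real ^ 'n::finite) set). f b) = (\<Prod>i\<in>UNIV. f (axis i 1))"
proof -
  have eq: "(Basis :: (real ^ 'n) set) = range (\<lambda>i. axis i 1)"
    by (auto simp: Basis_vec_def)
  show ?thesis
    unfolding eq by (subst prod.reindex) (auto simp: inj_on_def axis_eq_axis)
qed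

text \<open>Relabelling coordinates permutes the side lengths of a box, and Lebesgue measure is
  determined by boxes.\<close>

lemma distr_reindex: "distr lborel borel (reindex :: real ^ 'n::finite \<Rightarrow> _) = lborel"
proof (rule lborel_eqI[symmetric])
  have [measurable]: "(reindex :: real ^ 'n \<Rightarrow> _) \<in> borel_measurable borel"
    by (intro borel_measurable_continuous_onI linear_continuous_on linear_conv_bounded_linear[THEN iffD1] linear_reindex)
  fix l u :: "real ^ 'n ordered_copy" assume *: "\<And>b. b \<in> Basis \<Longrightarrow> l \<bullet> b \<le> u \<bullet> b"
  have le: "l $ i \<le> u $ i" for i
    using *[of "axis i 1"] by (simp add: inner_axis axis_in_Basis_iff)
  have "reindex -` box l u = box (unindex l) (unindex u)"
  proof -
    have "(\<forall>i. l $ i < v $ Rep_ordered_copy i \<and> v $ Rep_ordered_copy i < u $ i) \<longleftrightarrow>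
        (\<forall>i. l $ Abs_ordered_copy i < v $ i \<and> v $ i < u $ Abs_ordered_copy i)" for v :: "real ^ 'n"
      by (metis Abs_ordered_copy_inverse Rep_ordered_copy_inverse UNIV_I)
    then show ?thesis
      by (auto simp: mem_box_cart reindex_def unindex_def)
  qed
  then have "emeasure (distr lborel borel reindex) (box l u) = emeasure lborel (box (unindex l) (unindex u))"
    by (simp add: emeasure_distr)
  also have "\<dots> = ennreal (\<Prod>b\<in>Basis. (unindex u - unindex l) \<bullet> b)"
    by (subst emeasure_lborel_box) (auto simp: Basis_vec_def inner_axis unindex_def intro: le)
  also have "(\<Prod>b\<in>Basis. (unindex u - unindex l) \<bullet> b) = (\<Prod>i\<in>UNIV. u $ Abs_ordered_copy i - l $ Abs_ordered_copy i)"
    by (simp add: prod_Basis_vec inner_axis unindex_def)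
  also have "\<dots> = (\<Prod>i\<in>UNIV. u $ i - l $ i)"
    using prod.reindex_bij_betw[OF bij_Rep_ordered_copy, of "\<lambda>i. u $ Abs_ordered_copy i - l $ Abs_ordered_copy i"]
    by (simp add: Rep_ordered_copy_inverse)
  also have "\<dots> = (\<Prod>b\<in>Basis. (u - l) \<bullet> b)"
    by (simp add: prod_Basis_vec inner_axis)
  finally show "emeasure (distr lborel borel reindex) (box l u) = (\<Prod>b\<in>Basis. (u - l) \<bullet> b)" .
qed simp

text \<open>\<open>has_measure_differentiable_image\<close> equates finite measure of the image with
  gauge integrability of the Jacobian, including the values. The infinite case follows by
  contraposition: a finite integral would give the image finite measure.\<close>

lemma emeasure_image_wellorder:
  fixes g :: "real ^ 'n::{finite,wellorder} \<Rightarrow> real ^ 'n::_"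
  assumes S: "S \<in> sets borel" and T: "g ` S \<in> sets borel"
    and der: "\<And>x. x \<in> S \<Longrightarrow> (g has_derivative g' x) (at x)" and inj: "inj_on g S"
    and meas: "(\<lambda>x. indicator S x * \<bar>det (matrix (g' x))\<bar>) \<in> borel_measurable borel"
  shows "emeasure lborel (g ` S) = (\<integral>\<^sup>+x. ennreal (indicator S x * \<bar>det (matrix (g' x))\<bar>) \<partial>lborel)"
proof -
  let ?F = "\<lambda>x. indicator S x * \<bar>det (matrix (g' x))\<bar>"
  have F: "(?F has_integral m) UNIV \<longleftrightarrow> ((\<lambda>x. \<bar>det (matrix (g' x))\<bar>) has_integral m) S" for m
  proof -
    have "?F = (\<lambda>x. if x \<in> S then \<bar>det (matrix (g' x))\<bar> else 0)" by auto
    then show ?thesis by (simp only: has_integral_restrict_UNIV)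
  qed
  have "S \<in> sets lebesgue" using S by simp
  then have key: "g ` S \<in> lmeasurable \<and> measure lebesgue (g ` S) = m \<longleftrightarrow> (?F has_integral m) UNIV" for m
    unfolding F by (intro has_measure_differentiable_image der[THEN has_derivative_at_withinI] inj)
  have eq: "emeasure lebesgue (g ` S) = emeasure lborel (g ` S)"
    using T by simp
  show ?thesis
  proof (cases "emeasure lborel (g ` S) = \<infinity>")
    case False
    then have "g ` S \<in> lmeasurable"
      using T eq by (intro fmeasurableI) (auto simp: less_top)
    then have "(?F has_integral measure lebesgue (g ` S)) UNIV" using key by blast
    then have "integral\<^sup>N lborel ?F = ennreal (measure lebesgue (g ` S))"
      using meas by (intro nn_integral_has_integral_lborel) auto
    also have "\<dots> = emeasure lebesgue (g ` S)"
      using False eq by (intro emeasure_eq_ennreal_measure[symmetric]) simp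
    finally show ?thesis using eq by simp
  next
    case True
    have "integral\<^sup>N lborel ?F = \<infinity>"
    proof (rule ccontr)
      assume fin: "integral\<^sup>N lborel ?F \<noteq> \<infinity>"
      then obtain r where "0 \<le> r" "integral\<^sup>N lborel ?F = ennreal r" 
        by (cases "integral\<^sup>N lborel ?F" rule: ennreal_cases) auto
      then have "(?F has_integral r) UNIV"
        using meas by (intro nn_integral_has_integral) auto
      then have "g ` S \<in> lmeasurable" using key by blast
      then show False using True eq unfolding fmeasurable_def by (metis (no_types, lifting) infinity_ennreal_def less_irrefl mem_Collect_eq)
    qed
    with True show ?thesis by simp
  qed
qed

text \<open>Conjugating \<open>g\<close> with the relabelling of coordinates moves the statement to
  the well-ordered copy. Relabelling preserves Lebesgue measure and only renames the indices of the
  derivative matrix, whose determinant is unchanged by \<open>det_reindex\<close>.\<close>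

lemma emeasure_differentiable_image:
  fixes g :: "real ^ 'n::finite \<Rightarrow> real ^ 'n"
  assumes S: "S \<in> sets borel" and T: "g ` S \<in> sets borel"
    and der: "\<And>x. x \<in> S \<Longrightarrow> (g has_derivative g' x) (at x)" and inj: "inj_on g S"
    and meas: "(\<lambda>x. indicator S x * \<bar>det (matrix (g' x))\<bar>) \<in> borel_measurable borel"
  shows "emeasure lborel (g ` S) = (\<integral>\<^sup>+x. ennreal (indicator S x * \<bar>det (matrix (g' x))\<bar>) \<partial>lborel)"
proof -
  let ?R = "reindex :: real ^ 'n \<Rightarrow> _" and ?U = "unindex :: _ \<Rightarrow> real ^ 'n"
  have bl: "bounded_linear ?R" "bounded_linear ?U"
    using linear_reindex linear_unindex linear_conv_bounded_linear by auto
  have [measurable]: "?R \<in> borel_measurable borel" "?U \<in> borel_measurable borel"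
    using bl by (auto intro!: borel_measurable_continuous_onI linear_continuous_on)
  have image: "?R ` B = ?U -` B" for B
    by (auto simp: image_iff) (metis reindex_unindex)
  have em: "emeasure lborel (?R ` B) = emeasure lborel B" if "B \<in> sets borel" for B
  proof -
    have "?R ` B \<in> sets borel"
      using that measurable_sets[of ?U borel borel B] by (simp add: image)
    moreover have "?R -` ?R ` B = B" by (auto simp: image)
    ultimately show ?thesis
      by (subst distr_reindex[symmetric]) (simp add: emeasure_distr)
  qed
  let ?g = "?R \<circ> g \<circ> ?U" and ?g' = "\<lambda>x. ?R \<circ> g' (?U x) \<circ> ?U"
  have eqS: "?g ` ?R ` S = ?R ` g ` S" by (auto simp: image_image)
  have RB: "?R ` B \<in> sets borel" if "B \<in> sets borel" for B
    using that measurable_sets[of ?U borel borel B] by (simp add: image)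
  have der': "(?g has_derivative ?g' x) (at x)" if "x \<in> ?R ` S" for x
  proof -
    have "?U x \<in> S" using that by auto
    then show ?thesis
      using diff_chain_at[OF diff_chain_at[OF bounded_linear_imp_has_derivative[OF bl(2)] der]
          bounded_linear_imp_has_derivative[OF bl(1)]]
      by (simp add: comp_assoc)
  qed
  have det: "det (matrix (?g' x)) = det (matrix (g' (?U x)))" if "x \<in> ?R ` S" for x
  proof -
    have "matrix (?g' x) = (\<chi> i j. matrix (g' (?U x)) $ Rep_ordered_copy i $ Rep_ordered_copy j)"
    proof -
      have "?U (axis j 1) = axis (Rep_ordered_copy j) 1" for j
        by (auto simp: unindex_def axis_def vec_eq_iff Rep_ordered_copy_inverse Abs_ordered_copy_inverse)
      then show ?thesis by (simp add: matrix_def reindex_def)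
    qed
    then show ?thesis by (simp add: det_reindex)
  qed
  have meq: "(\<lambda>x. indicator (?R ` S) x * \<bar>det (matrix (?g' x))\<bar>) =
      (\<lambda>x. (\<lambda>x. indicator S x * \<bar>det (matrix (g' x))\<bar>) (?U x))"
    using det by (auto simp: fun_eq_iff image split: split_indicator)
  have "emeasure lborel (g ` S) = emeasure lborel (?g ` ?R ` S)"
    unfolding eqS by (rule em[OF T, symmetric])
  also have "\<dots> = (\<integral>\<^sup>+x. ennreal (indicator (?R ` S) x * \<bar>det (matrix (?g' x))\<bar>) \<partial>lborel)"
  proof (rule emeasure_image_wellorder[OF RB[OF S]])
    show "?g ` ?R ` S \<in> sets borel" unfolding eqS by (rule RB[OF T])
    show "inj_on ?g (?R ` S)"
      using inj by (auto simp: inj_on_def) (metis unindex_reindex)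
    show "(\<lambda>x. indicator (?R ` S) x * \<bar>det (matrix (?g' x))\<bar>) \<in> borel_measurable borel"
      unfolding meq by (rule measurable_compose[OF _ meas]) measurable
  qed (rule der')
  also have "\<dots> = (\<integral>\<^sup>+x. (\<lambda>x. ennreal (indicator S x * \<bar>det (matrix (g' x))\<bar>)) (?U x) \<partial>distr lborel borel ?R)"
    using fun_cong[OF meq] by (simp add: distr_reindex)
  also have "\<dots> = (\<integral>\<^sup>+x. ennreal (indicator S x * \<bar>det (matrix (g' x))\<bar>) \<partial>lborel)"
    by (subst nn_integral_distr) (use meas in \<open>auto intro!: measurable_compose[OF _ measurable_ennreal]
          measurable_compose[of ?U borel borel, OF _ meas]\<close>)
  finally show ?thesis .
qed

text \<open>The formula for images, applied to the preimages of Borel subsets of the image, says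
  that Lebesgue measure on the image of \<open>S\<close> is the push-forward under \<open>g\<close>
  of the Jacobian density on \<open>S\<close>. The formula for integrals is then abstract.\<close>

lemma nn_integral_change_of_variables:
  fixes g :: "real ^ 'n::finite \<Rightarrow> real ^ 'n"
  assumes S: "S \<in> sets borel" and T: "g ` S \<in> sets borel"
    and der: "\<And>x. x \<in> S \<Longrightarrow> (g has_derivative g' x) (at x)"
    and inv: "\<And>x. x \<in> S \<Longrightarrow> k (g x) = x" and k: "k \<in> borel_measurable (restrict_space borel (g ` S))"
    and meas: "(\<lambda>x. indicator S x * \<bar>det (matrix (g' x))\<bar>) \<in> borel_measurable borel"
    and f: "f \<in> borel_measurable borel"
  shows "(\<integral>\<^sup>+y. f y * indicator (g ` S) y \<partial>lborel) =
    (\<integral>\<^sup>+x. f (g x) * ennreal \<bar>det (matrix (g' x))\<bar> * indicator S x \<partial>lborel)"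
proof -
  let ?D = "\<lambda>x. ennreal \<bar>det (matrix (g' x))\<bar>"
  have inj: "inj_on g S" using inv by (metis inj_on_def)
  have "continuous_on S g"
    using der by (meson continuous_at_imp_continuous_on has_derivative_continuous)
  then have g[measurable]: "g \<in> borel_measurable (restrict_space borel S)"
    by (rule borel_measurable_continuous_on_restrict)
  have D[measurable]: "?D \<in> borel_measurable (restrict_space lborel S)"
  proof -
    have "(\<lambda>x. \<bar>det (matrix (g' x))\<bar>) \<in> borel_measurable (restrict_space lborel S)"
      using meas S by (subst borel_measurable_restrict_space_iff) (auto simp: mult.commute)
    then show ?thesis by measurable
  qed
  have gm[measurable]: "g \<in> measurable (restrict_space lborel S) (restrict_space borel (g ` S))"
    by (rule measurable_restrict_space2) (auto simp: space_restrict_space measurable_cong_sets[OF sets_restrict_space_cong[OF sets_lborel] refl])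
  have "restrict_space lborel (g ` S) = distr (density (restrict_space lborel S) ?D) (restrict_space borel (g ` S)) g"
    (is "?L = ?Q")
  proof (rule measure_eqI)
    show "sets ?L = sets ?Q" by (simp add: sets_restrict_space)
    fix A assume A: "A \<in> sets ?L"
    then have A': "A \<subseteq> g ` S" "A \<in> sets borel"
      using T by (auto simp: sets_restrict_space_iff)
    define B where "B = S \<inter> g -` A"
    have "B = g -` A \<inter> space (restrict_space borel S)" by (auto simp: B_def space_restrict_space)
    then have "B \<in> sets (restrict_space borel S)"
      using g A' by (simp add: measurable_sets)
    then have B: "B \<in> sets borel" "B \<subseteq> S"
      using S by (auto simp: sets_restrict_space_iff)
    have gB: "g ` B = A" using A' by (auto simp: B_def)
    \<comment> \<open>The indicator of \<open>S\<close> is inserted because measurability of the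
      Jacobian is available only together with it.\<close>
    have ind: "indicator B x * \<bar>det (matrix (g' x))\<bar> = indicator B x * (indicator S x * \<bar>det (matrix (g' x))\<bar>)" for x
      using B by (auto split: split_indicator)
    have "emeasure ?L A = emeasure lborel (g ` B)"
      using A T by (subst emeasure_restrict_space) (auto simp: gB sets_restrict_space_iff)
    also have "\<dots> = (\<integral>\<^sup>+x. ennreal (indicator B x * \<bar>det (matrix (g' x))\<bar>) \<partial>lborel)"
      using B A' gB der inj_on_subset[OF inj]
      by (intro emeasure_differentiable_image) (auto simp: ind intro!: borel_measurable_times meas)
    also have "\<dots> = (\<integral>\<^sup>+x. ?D x * indicator B x * indicator S x \<partial>lborel)"
      using B by (intro nn_integral_cong) (auto split: split_indicator)
    also have "\<dots> = (\<integral>\<^sup>+x. ?D x * indicator B x \<partial>restrict_space lborel S)"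
      using S by (subst nn_integral_restrict_space) auto
    also have "\<dots> = emeasure (density (restrict_space lborel S) ?D) B"
      using B S by (subst emeasure_density[OF D]) (auto simp: sets_restrict_space_iff)
    also have "B = g -` A \<inter> space (density (restrict_space lborel S) ?D)"
      using S by (auto simp: B_def space_restrict_space)
    also have "emeasure (density (restrict_space lborel S) ?D) \<dots> = emeasure ?Q A"
      using A by (subst emeasure_distr) (auto simp: sets_restrict_space)
    finally show "emeasure ?L A = emeasure ?Q A" .
  qed
  have fT: "f \<in> borel_measurable (restrict_space borel (g ` S))"
    by (rule measurable_restrict_space1[OF f])
  have "(\<integral>\<^sup>+y. f y * indicator (g ` S) y \<partial>lborel) = integral\<^sup>N (restrict_space lborel (g ` S)) f"
    using T by (subst nn_integral_restrict_space) auto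
  also have "\<dots> = (\<integral>\<^sup>+x. f (g x) \<partial>density (restrict_space lborel S) ?D)"
    unfolding \<open>?L = ?Q\<close> using fT gm by (subst nn_integral_distr) auto
  also have "\<dots> = (\<integral>\<^sup>+x. ?D x * f (g x) \<partial>restrict_space lborel S)"
    by (subst nn_integral_density[OF D]) (auto intro!: measurable_compose[OF gm fT])
  also have "\<dots> = (\<integral>\<^sup>+x. f (g x) * ?D x * indicator S x \<partial>lborel)"
    using S by (subst nn_integral_restrict_space) (auto simp: mult_ac)
  finally show ?thesis .
qed

section \<open>The Riemannian volume\<close>

lemma sigma_sets_borel: "sigma_sets UNIV (sets borel) = sets borel"
  using sets.sigma_sets_eq[of borel] by simp

lemma sets_superpose [simp, measurable_cong]: "sets (superpose I m) = sets borel"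
  by (simp add: superpose_def sigma_sets_borel)

lemma space_superpose [simp]: "space (superpose I m) = UNIV"
  by (simp add: superpose_def)

text \<open>Countable additivity amounts to exchanging a series with the sum over
  \<open>I\<close>.\<close>

lemma emeasure_superpose:
  assumes m: "\<And>i. i \<in> I \<Longrightarrow> sets (m i) = sets borel" and B: "B \<in> sets borel"
  shows "emeasure (superpose I m) B = (\<integral>\<^sup>+i. emeasure (m i) B \<partial>count_space I)"
  unfolding superpose_def
proof (rule emeasure_measure_of_sigma)
  show "sigma_algebra UNIV (sets (borel :: 'b measure))"
    using sets.sigma_algebra_axioms[of "borel :: 'b measure"] by simp
  show "positive (sets borel) (\<lambda>B. \<integral>\<^sup>+i. emeasure (m i) B \<partial>count_space I)"
    by (simp add: positive_def)
  show "countably_additive (sets borel) (\<lambda>B. \<integral>\<^sup>+i. emeasure (m i) B \<partial>count_space I)"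
  proof (rule countably_additiveI)
    fix F :: "nat \<Rightarrow> 'b set" assume F: "range F \<subseteq> sets borel" "disjoint_family F"
    have "(\<Sum>n. \<integral>\<^sup>+i. emeasure (m i) (F n) \<partial>count_space I) = (\<integral>\<^sup>+i. (\<Sum>n. emeasure (m i) (F n)) \<partial>count_space I)"
      by (rule nn_integral_suminf[symmetric]) simp
    also have "\<dots> = (\<integral>\<^sup>+i. emeasure (m i) (\<Union>(range F)) \<partial>count_space I)"
      using F by (intro nn_integral_cong suminf_emeasure) (auto simp: m)
    finally show "(\<Sum>n. \<integral>\<^sup>+i. emeasure (m i) (F n) \<partial>count_space I) =
        (\<integral>\<^sup>+i. emeasure (m i) (\<Union>(range F)) \<partial>count_space I)" .
  qed
qed (rule B)

lemma emeasure_density_indicator: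
  assumes "B \<in> sets M" "S \<in> sets M"
  shows "emeasure (density M (indicator S)) B = emeasure M (B \<inter> S)"
  using assms by (simp add: emeasure_density Int_commute flip: indicator_inter_arith)

text \<open>The segment \<open>N\<close> from the identity to \<open>M\<close> consists of positive
  definite, hence invertible matrices. The determinant is continuous along it and equals 1 at the
  identity, so a value of \<open>det M\<close> that is not positive would force a zero on the
  way.\<close>

lemma det_pos_definite:
  fixes M :: "real ^ 'n::finite ^ 'n"
  assumes pos: "\<And>v. v \<noteq> 0 \<Longrightarrow> 0 < v \<bullet> (M *v v)"
  shows "0 < det M"
proof (rule ccontr)
  assume "\<not> 0 < det M"
  define N :: "real \<Rightarrow> real ^ 'n ^ 'n" where "N t = (\<chi> i j. t * M $ i $ j + (1 - t) * mat 1 $ i $ j)" for t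
  have N: "N t *v v = t *\<^sub>R (M *v v) + (1 - t) *\<^sub>R v" for t v
  proof -
    have "N t = t *\<^sub>R M + (1 - t) *\<^sub>R mat 1" by (simp add: N_def vec_eq_iff)
    then show ?thesis
      by (simp add: matrix_vector_mult_add_rdistrib scaleR_matrix_vector_assoc[symmetric])
  qed
  have cont: "continuous_on {0..1} (\<lambda>t. det (N t))"
    unfolding det_def N_def by (intro continuous_intros)
  have "det (N 0) = 1" "det (N 1) = det M"
  proof -
    have "N 0 = mat 1" "N 1 = M" by (simp_all add: N_def vec_eq_iff)
    then show "det (N 0) = 1" "det (N 1) = det M" by simp_all
  qed
  with \<open>\<not> 0 < det M\<close> IVT2'[OF _ _ _ cont, of 0] obtain t where t: "0 \<le> t" "t \<le> 1" "det (N t) = 0"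
    by auto
  then obtain v where v: "v \<noteq> 0" "N t *v v = 0"
    using invertible_det_nz[of "N t"]
    by (metis invertible_left_inverse matrix_left_invertible_ker)
  then have "t * (v \<bullet> (M *v v)) + (1 - t) * (v \<bullet> v) = 0"
    using arg_cong[OF v(2)[unfolded N], of "\<lambda>w. v \<bullet> w"] by (simp only: inner_add_right inner_scaleR_right inner_zero_right)
  moreover have "0 < t * (v \<bullet> (M *v v)) + (1 - t) * (v \<bullet> v)"
    using t pos[OF v(1)] v(1)
    by (cases "t = 0") (auto intro!: add_pos_nonneg)
  ultimately show False by simp
qed

text \<open>The map \<open>h\<close> has to agree with the composite only near \<open>x\<close>:
  coordinate expressions of composites coincide with composites of coordinate expressions only where
  the intermediate point stays in the chosen chart.\<close>

lemma jacobian_compose: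
  fixes f :: "real ^ 'n \<Rightarrow> real ^ 'm" and g :: "real ^ 'm \<Rightarrow> real ^ 'k"
  assumes f: "f differentiable (at x)" and g: "g differentiable (at (f x))"
    and S: "open S" "x \<in> S" and h: "\<And>y. y \<in> S \<Longrightarrow> h y = g (f y)"
  shows "jacobian h (at x) = jacobian g (at (f x)) ** jacobian f (at x)"
proof -
  have "(g \<circ> f has_derivative (\<lambda>v. jacobian g (at (f x)) *v v) \<circ> (\<lambda>v. jacobian f (at x) *v v)) (at x)"
    using f g unfolding jacobian_works by (intro diff_chain_at)
  then have "(h has_derivative (\<lambda>v. jacobian g (at (f x)) *v v) \<circ> (\<lambda>v. jacobian f (at x) *v v)) (at x)"
    by (rule has_derivative_transform_within_open[OF _ S]) (simp add: h)
  then have "(h has_derivative (\<lambda>v. (jacobian g (at (f x)) ** jacobian f (at x)) *v v)) (at x)"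
    by (simp add: o_def matrix_vector_mul_assoc)
  then have "frechet_derivative h (at x) = (\<lambda>v. (jacobian g (at (f x)) ** jacobian f (at x)) *v v)"
    by (rule frechet_derivative_at[symmetric])
  then show ?thesis
    unfolding jacobian_def by simp
qed

section \<open>Charts, metric and Jacobians in coordinates\<close>

locale manifold_with_metric =
  fixes A :: "('x::{t2_space, second_countable_topology}, 'n::finite) chart set"
    and G :: "('x, 'n) chart \<Rightarrow> 'x \<Rightarrow> real ^ 'n ^ 'n"
  assumes manifold: "riemannian_manifold A G"
begin

lemma
  assumes "(U, c) \<in> A"
  shows open_chart: "open U" and open_chart_image: "open (c ` U)"
    and chart_homeo: "homeomorphism U (c ` U) c (inv_into U c)"
proof -
  have "is_chart (U, c)"
    using manifold assms by (auto simp: riemannian_manifold_def smooth_atlas_def)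
  then show "open U" "open (c ` U)" "homeomorphism U (c ` U) c (inv_into U c)"
    by (auto simp: is_chart_def)
qed

lemma chart_inv [simp]: "(U, c) \<in> A \<Longrightarrow> x \<in> U \<Longrightarrow> inv_into U c (c x) = x"
  using chart_homeo by (simp add: homeomorphism_def)

lemma continuous_chart: "(U, c) \<in> A \<Longrightarrow> continuous_on U c"
  and continuous_chart_inv: "(U, c) \<in> A \<Longrightarrow> continuous_on (c ` U) (inv_into U c)"
  using chart_homeo by (auto simp: homeomorphism_def)

lemma chart_exists: "\<exists>U c. (U, c) \<in> A \<and> x \<in> U"
proof -
  have "x \<in> (\<Union>C\<in>A. fst C)"
    using manifold by (auto simp: riemannian_manifold_def smooth_atlas_def)
  then show ?thesis by force
qed

lemma chart_image_open: "(U, c) \<in> A \<Longrightarrow> open W \<Longrightarrow> W \<subseteq> U \<Longrightarrow> open (c ` W)"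
  using homeomorphism_imp_open_map[OF chart_homeo, of U c W] open_chart open_chart_image
  by (simp add: openin_open_eq)

text \<open>Smoothness of the identity is the compatibility of the charts. It lets changes of chart
  be treated as coordinate expressions of the identity map.\<close>

lemma smooth_map_id: "smooth_map A (\<lambda>x. x)"
  using manifold
  by (auto simp: riemannian_manifold_def smooth_atlas_def smooth_map_def o_def case_prod_beta)

lemma smooth_mapD:
  assumes "smooth_map A \<phi>" "(U, c) \<in> A" "(V, d) \<in> A"
  shows "smooth_on (c ` (U \<inter> \<phi> -` V)) (d \<circ> \<phi> \<circ> inv_into U c)"
  using assms unfolding smooth_map_def by fast

lemma smooth_map_continuous: "smooth_map A \<phi> \<Longrightarrow> continuous_on UNIV \<phi>"
  by (simp add: smooth_map_def)

lemma open_overlap: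
  assumes "smooth_map A \<phi>" "(U, c) \<in> A" "(V, d) \<in> A"
  shows "open (U \<inter> \<phi> -` V)"
  using smooth_map_continuous[OF assms(1)] open_chart[OF assms(2)] open_chart[OF assms(3)]
  by (intro open_Int) (auto simp: continuous_on_open_vimage[OF open_UNIV])

lemma local_differentiable:
  assumes "smooth_map A \<phi>" "(U, c) \<in> A" "(V, d) \<in> A" "x \<in> U" "\<phi> x \<in> V"
  shows "(d \<circ> \<phi> \<circ> inv_into U c) differentiable (at (c x))"
proof -
  have "Ck_on 1 (c ` (U \<inter> \<phi> -` V)) (d \<circ> \<phi> \<circ> inv_into U c)"
    using smooth_mapD[OF assms(1-3)] unfolding smooth_on_def by blast
  then show ?thesis using assms by (simp add: comp_def image_iff)
qed

lemma continuous_local_jacobian: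
  assumes "smooth_map A \<phi>" "(U, c) \<in> A" "(V, d) \<in> A"
  shows "continuous_on (c ` (U \<inter> \<phi> -` V)) (\<lambda>v. det (jacobian (d \<circ> \<phi> \<circ> inv_into U c) (at v)))"
proof -
  have "Ck_on 1 (c ` (U \<inter> \<phi> -` V)) (d \<circ> \<phi> \<circ> inv_into U c)"
    using smooth_mapD[OF assms] unfolding smooth_on_def by blast
  then have "continuous_on (c ` (U \<inter> \<phi> -` V)) (\<lambda>x. frechet_derivative (d \<circ> \<phi> \<circ> inv_into U c) (at x) v)" for v
    by simp
  then show ?thesis
    unfolding det_def jacobian_def matrix_def
    by (auto intro!: continuous_intros)
qed

lemma metric_det_pos: "(U, c) \<in> A \<Longrightarrow> x \<in> U \<Longrightarrow> 0 < det (G (U, c) x)"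
  using manifold
  by (intro det_pos_definite) (auto simp: riemannian_manifold_def riemannian_metric_def)

text \<open>The density of the Riemannian volume with respect to Lebesgue measure in the coordinates
  of the chart.\<close>

definition weight :: "('x, 'n) chart \<Rightarrow> real ^ 'n \<Rightarrow> real" where
  "weight = (\<lambda>(U, c) v. sqrt (det (G (U, c) (inv_into U c v))))"

lemma continuous_weight:
  assumes "(U, c) \<in> A"
  shows "continuous_on (c ` U) (weight (U, c))"
proof -
  have "smooth_on (c ` U) (\<lambda>v. G (U, c) (inv_into U c v))"
    using manifold assms by (auto simp: riemannian_manifold_def riemannian_metric_def)
  then have "Ck_on 0 (c ` U) (\<lambda>v. G (U, c) (inv_into U c v))"
    unfolding smooth_on_def by blast
  then have "continuous_on (c ` U) (\<lambda>v. G (U, c) (inv_into U c v))" by simp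
  then show ?thesis
    unfolding weight_def det_def by (auto intro!: continuous_intros)
qed

lemma weight_pos: "(U, c) \<in> A \<Longrightarrow> x \<in> U \<Longrightarrow> 0 < weight (U, c) (c x)"
  by (simp add: weight_def metric_det_pos)

text \<open>The expression inside \<open>riemannian_jacobian\<close> with the two charts as
  parameters, so that its independence of the charts can be stated.\<close>

definition local_jacobian :: "('x, 'n) chart \<Rightarrow> ('x, 'n) chart \<Rightarrow> ('x \<Rightarrow> 'x) \<Rightarrow> 'x \<Rightarrow> real" where
  "local_jacobian = (\<lambda>(U, c) (V, d) \<phi> x.
     \<bar>det (jacobian (d \<circ> \<phi> \<circ> inv_into U c) (at (c x)))\<bar> * weight (V, d) (d (\<phi> x)) / weight (U, c) (c x))"

text \<open>Chain rule for the determinants; the weight at the intermediate point occurs once as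
  numerator and once as denominator and cancels.\<close>

lemma local_jacobian_compose:
  assumes "smooth_map A \<phi>" "smooth_map A \<psi>" "(U, c) \<in> A" "(V, d) \<in> A" "(W, e) \<in> A"
    and "x \<in> U" "\<phi> x \<in> V" "\<psi> (\<phi> x) \<in> W"
  shows "local_jacobian (U, c) (W, e) (\<psi> \<circ> \<phi>) x =
    local_jacobian (V, d) (W, e) \<psi> (\<phi> x) * local_jacobian (U, c) (V, d) \<phi> x"
proof -
  have "jacobian (e \<circ> (\<psi> \<circ> \<phi>) \<circ> inv_into U c) (at (c x)) =
      jacobian (e \<circ> \<psi> \<circ> inv_into V d) (at ((d \<circ> \<phi> \<circ> inv_into U c) (c x))) ** jacobian (d \<circ> \<phi> \<circ> inv_into U c) (at (c x))"
  proof (rule jacobian_compose[where S = "c ` (U \<inter> \<phi> -` V)"])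
    show "open (c ` (U \<inter> \<phi> -` V))"
      using open_overlap assms by (intro chart_image_open) auto
    show "d \<circ> \<phi> \<circ> inv_into U c differentiable at (c x)"
      by (rule local_differentiable) (use assms in auto)
    show "e \<circ> \<psi> \<circ> inv_into V d differentiable at ((d \<circ> \<phi> \<circ> inv_into U c) (c x))"
      using local_differentiable[of \<psi> V d W e "\<phi> x"] assms by simp
  qed (use assms in auto)
  then show ?thesis
    using assms weight_pos[of V d "\<phi> x"]
    by (simp add: local_jacobian_def det_mul abs_mult)
qed

lemma local_jacobian_cong:
  assumes "smooth_map A \<phi>" "(U, c) \<in> A" "(V, d) \<in> A" "open W" "x \<in> W" "x \<in> U" "\<phi> x \<in> V"
    and eq: "\<And>y. y \<in> W \<Longrightarrow> \<phi> y = \<psi> y"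
  shows "local_jacobian (U, c) (V, d) \<phi> x = local_jacobian (U, c) (V, d) \<psi> x"
proof -
  let ?f = "d \<circ> \<phi> \<circ> inv_into U c" and ?g = "d \<circ> \<psi> \<circ> inv_into U c"
  have "(?f has_derivative frechet_derivative ?f (at (c x))) (at (c x))"
    using local_differentiable[of \<phi> U c V d x] assms frechet_derivative_works by blast
  moreover have "open (c ` (U \<inter> W))" "c x \<in> c ` (U \<inter> W)"
    using assms open_chart by (auto intro!: chart_image_open)
  ultimately have "(?g has_derivative frechet_derivative ?f (at (c x))) (at (c x))"
    by (rule has_derivative_transform_within_open) (use assms in auto)
  then have "frechet_derivative ?f (at (c x)) = frechet_derivative ?g (at (c x))"
    by (rule frechet_derivative_at)
  then show ?thesis
    using eq[OF \<open>x \<in> W\<close>] by (simp add: local_jacobian_def jacobian_def)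
qed

text \<open>Taking determinants in the tensor transformation rule produces the square of the
  determinant of the chart change; its root cancels the quotient of the weights.\<close>

lemma local_jacobian_ident:
  assumes "(U, c) \<in> A" "(V, d) \<in> A" "x \<in> U" "x \<in> V"
  shows "local_jacobian (U, c) (V, d) (\<lambda>x. x) x = 1"
proof -
  let ?D = "jacobian (d \<circ> inv_into U c) (at (c x))"
  have "G (U, c) x = transpose ?D ** G (V, d) x ** ?D"
    using manifold assms unfolding riemannian_manifold_def riemannian_metric_def Let_def by fast
  then have "det (G (U, c) x) = (det ?D)\<^sup>2 * det (G (V, d) x)"
    by (simp add: det_mul det_transpose power2_eq_square mult_ac)
  then have "weight (U, c) (c x) = \<bar>det ?D\<bar> * weight (V, d) (d x)"
    using assms by (simp add: weight_def real_sqrt_mult)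
  moreover have "0 < weight (U, c) (c x)"
    using assms by (simp add: weight_pos)
  ultimately show ?thesis
    by (auto simp: local_jacobian_def o_def)
qed

text \<open>The identity map, read between the two target charts and between the two source charts,
  is composed with \<open>\<phi>\<close> on either side; by \<open>local_jacobian_ident\<close>
  these factors are 1.\<close>

lemma local_jacobian_chart_independent:
  assumes \<phi>: "smooth_map A \<phi>" and "(U, c) \<in> A" "(V, d) \<in> A" "(U', c') \<in> A" "(V', d') \<in> A"
    and x: "x \<in> U" "x \<in> U'" "\<phi> x \<in> V" "\<phi> x \<in> V'"
  shows "local_jacobian (U', c') (V', d') \<phi> x = local_jacobian (U, c) (V, d) \<phi> x"
proof -
  have "local_jacobian (U', c') (V', d') ((\<lambda>x. x) \<circ> \<phi>) x =
      local_jacobian (V, d) (V', d') (\<lambda>x. x) (\<phi> x) * local_jacobian (U', c') (V, d) \<phi> x"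
    by (rule local_jacobian_compose) (use assms smooth_map_id in auto)
  moreover have "local_jacobian (U', c') (V, d) (\<phi> \<circ> (\<lambda>x. x)) x =
      local_jacobian (U, c) (V, d) \<phi> x * local_jacobian (U', c') (U, c) (\<lambda>x. x) x"
    by (rule local_jacobian_compose) (use assms smooth_map_id in auto)
  ultimately show ?thesis using assms by (simp add: local_jacobian_ident o_def)
qed

lemma chart_at: "chart_at A x \<in> A" "x \<in> fst (chart_at A x)"
proof -
  have "\<exists>C. C \<in> A \<and> x \<in> fst C" using chart_exists[of x] by force
  then have "chart_at A x \<in> A \<and> x \<in> fst (chart_at A x)"
    unfolding chart_at_def by (rule someI_ex)
  then show "chart_at A x \<in> A" "x \<in> fst (chart_at A x)" by auto
qed

lemma riemannian_jacobian_eq_local: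
  assumes \<phi>: "smooth_map A \<phi>" and "(U, c) \<in> A" "(V, d) \<in> A" "x \<in> U" "\<phi> x \<in> V"
  shows "riemannian_jacobian A G \<phi> x = local_jacobian (U, c) (V, d) \<phi> x"
proof -
  obtain U' c' V' d' where eq: "chart_at A x = (U', c')" "chart_at A (\<phi> x) = (V', d')"
    by fastforce
  then have *: "(U', c') \<in> A" "x \<in> U'" "(V', d') \<in> A" "\<phi> x \<in> V'"
    using chart_at[of x] chart_at[of "\<phi> x"] by auto
  then have "riemannian_jacobian A G \<phi> x = local_jacobian (U', c') (V', d') \<phi> x"
    by (simp add: riemannian_jacobian_def eq local_jacobian_def weight_def)
  also have "\<dots> = local_jacobian (U, c) (V, d) \<phi> x"
    using * assms by (intro local_jacobian_chart_independent) auto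
  finally show ?thesis .
qed

lemma riemannian_jacobian_compose:
  assumes "smooth_map A \<phi>" "smooth_map A \<psi>" "smooth_map A (\<psi> \<circ> \<phi>)"
  shows "riemannian_jacobian A G (\<psi> \<circ> \<phi>) x = riemannian_jacobian A G \<psi> (\<phi> x) * riemannian_jacobian A G \<phi> x"
proof -
  obtain U c V d W e where "(U, c) \<in> A" "x \<in> U" "(V, d) \<in> A" "\<phi> x \<in> V" "(W, e) \<in> A" "\<psi> (\<phi> x) \<in> W"
    using chart_exists by metis
  then show ?thesis
    using assms by (simp add: riemannian_jacobian_eq_local local_jacobian_compose)
qed

lemma riemannian_jacobian_nonneg: "0 \<le> riemannian_jacobian A G \<phi> x"
proof -
  obtain U c V d where eq: "chart_at A x = (U, c)" "chart_at A (\<phi> x) = (V, d)"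
    by fastforce
  then show ?thesis
    using metric_det_pos[of U c x] metric_det_pos[of V d "\<phi> x"] chart_at[of x] chart_at[of "\<phi> x"]
    by (auto simp: riemannian_jacobian_def)
qed

text \<open>Near \<open>x\<close> the map has the same germ as the identity. This will make the
  density factors trivial off the support.\<close>

lemma riemannian_jacobian_eq_1:
  assumes "smooth_map A \<phi>" "open W" "x \<in> W" "\<And>y. y \<in> W \<Longrightarrow> \<phi> y = y"
  shows "riemannian_jacobian A G \<phi> x = 1"
proof -
  obtain U c where "(U, c) \<in> A" "x \<in> U" using chart_exists by blast
  then show ?thesis
    using assms local_jacobian_cong[of \<phi> U c U c W x "\<lambda>x. x"]
    by (simp add: riemannian_jacobian_eq_local local_jacobian_ident)
qed

text \<open>The Jacobians of the map and of its inverse multiply to 1, which excludes the value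
  0.\<close>

lemma riemannian_jacobian_pos:
  assumes "bij \<phi>" "smooth_map A \<phi>" "smooth_map A (inv \<phi>)"
  shows "0 < riemannian_jacobian A G \<phi> x"
proof -
  have "inv \<phi> \<circ> \<phi> = (\<lambda>x. x)" using assms(1) by (auto simp: fun_eq_iff bij_is_inj)
  then have "riemannian_jacobian A G (inv \<phi>) (\<phi> x) * riemannian_jacobian A G \<phi> x = 1"
    using riemannian_jacobian_compose[OF assms(2,3), of x] smooth_map_id
      riemannian_jacobian_eq_1[OF smooth_map_id open_UNIV, of x] by simp
  then show ?thesis
    using riemannian_jacobian_nonneg[of \<phi> x] by (metis less_eq_real_def mult_zero_right zero_neq_one)
qed


section \<open>Gluing the chart densities to one measure\<close>

definition chart_integral :: "('x, 'n) chart \<Rightarrow> 'x set \<Rightarrow> ennreal" where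
  "chart_integral = (\<lambda>(U, c) B. \<integral>\<^sup>+v. ennreal (weight (U, c) v) * indicator (c ` B) v \<partial>lborel)"

lemma chart_image_vimage:
  assumes "(U, c) \<in> A" "B \<subseteq> U"
  shows "c ` B = c ` U \<inter> inv_into U c -` B"
proof -
  have "v \<in> c ` B" if "v = c x" "x \<in> U" "inv_into U c v \<in> B" for v x
    using that assms by auto
  then show ?thesis
    using assms by auto
qed

lemma chart_image_borel:
  assumes "(U, c) \<in> A" "B \<subseteq> U" "B \<in> sets borel"
  shows "c ` B \<in> sets borel"
proof -
  have "inv_into U c \<in> borel_measurable (restrict_space borel (c ` U))"
    using continuous_chart_inv[OF assms(1)] by (rule borel_measurable_continuous_on_restrict)
  then have "inv_into U c -` B \<inter> space (restrict_space borel (c ` U)) \<in> sets (restrict_space borel (c ` U))"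
    using assms(3) by (rule measurable_sets)
  moreover have "c ` U \<in> sets borel" using open_chart_image[OF assms(1)] by simp
  ultimately show ?thesis
    unfolding chart_image_vimage[OF assms(1,2)]
    by (simp add: sets_restrict_space_iff space_restrict_space Int_commute)
qed

lemma weight_measurable:
  assumes "(U, c) \<in> A"
  shows "(\<lambda>v. ennreal (weight (U, c) v) * indicator (c ` U) v) \<in> borel_measurable borel"
proof -
  have "weight (U, c) \<in> borel_measurable (restrict_space borel (c ` U))"
    using continuous_weight[OF assms] by (rule borel_measurable_continuous_on_restrict)
  then have "(\<lambda>v. ennreal (weight (U, c) v)) \<in> borel_measurable (restrict_space borel (c ` U))"
    by measurable
  then show ?thesis
    using open_chart_image[OF assms] by (subst (asm) borel_measurable_restrict_space_iff_ennreal) auto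
qed

text \<open>The coordinate density transported to the manifold, as a measure on the whole space that
  charges only \<open>U\<close>.\<close>

definition chart_measure :: "('x, 'n) chart \<Rightarrow> 'x measure" where
  "chart_measure = (\<lambda>(U, c). distr (density (restrict_space lborel (c ` U)) (\<lambda>v. ennreal (weight (U, c) v)))
     borel (inv_into U c))"

lemma sets_chart_measure [simp]: "sets (chart_measure C) = sets borel"
  by (simp add: chart_measure_def case_prod_beta)

lemma chart_inv_measurable:
  assumes "(U, c) \<in> A"
  shows "inv_into U c \<in> borel_measurable (restrict_space lborel (c ` U))"
proof -
  have "inv_into U c \<in> borel_measurable (restrict_space borel (c ` U))"
    using continuous_chart_inv[OF assms] by (rule borel_measurable_continuous_on_restrict)
  then show ?thesis
    by (simp add: measurable_cong_sets[OF sets_restrict_space_cong[OF sets_lborel] refl])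
qed

lemma emeasure_chart_measure:
  assumes C: "(U, c) \<in> A" and B: "B \<in> sets borel"
  shows "emeasure (chart_measure (U, c)) B = chart_integral (U, c) (B \<inter> U)"
proof -
  let ?R = "restrict_space lborel (c ` U)"
  have U: "c ` U \<in> sets borel" using open_chart_image[OF C] by simp
  have w: "(\<lambda>v. ennreal (weight (U, c) v)) \<in> borel_measurable ?R"
    using weight_measurable[OF C] U by (subst borel_measurable_restrict_space_iff_ennreal) auto
  have eq: "inv_into U c -` B \<inter> c ` U = c ` (B \<inter> U)"
    using C by (subst chart_image_vimage[of U c "B \<inter> U"]) (auto simp: chart_inv)
  have "inv_into U c -` B \<inter> space (density ?R (\<lambda>v. ennreal (weight (U, c) v))) \<in> sets ?R"
    using chart_inv_measurable[OF C] B by (simp add: measurable_sets)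
  then have "emeasure (chart_measure (U, c)) B = (\<integral>\<^sup>+v. ennreal (weight (U, c) v) * indicator (c ` (B \<inter> U)) v \<partial>?R)"
    unfolding chart_measure_def
    using B chart_inv_measurable[OF C]
    by (simp add: emeasure_distr emeasure_density w space_restrict_space eq)
  also have "\<dots> = chart_integral (U, c) (B \<inter> U)"
    using U unfolding chart_integral_def
    by (subst nn_integral_restrict_space) (auto intro!: nn_integral_cong split: split_indicator)
  finally show ?thesis .
qed

lemma local_measurable:
  assumes \<phi>: "smooth_map A \<phi>" and C: "(U, c) \<in> A" and D: "(V, d) \<in> A"
  shows "(\<lambda>v. det (jacobian (d \<circ> \<phi> \<circ> inv_into U c) (at v))) \<in> borel_measurable (restrict_space borel (c ` (U \<inter> \<phi> -` V)))"
  by (intro borel_measurable_continuous_on_restrict continuous_local_jacobian assms)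

text \<open>Euclidean change of variables for the coordinate expression of \<open>\<phi>\<close>;
  multiplying and dividing by the source weight turns the Euclidean Jacobian into
  \<open>local_jacobian\<close>.\<close>

lemma chart_integral_image:
  assumes bij: "bij \<phi>" and \<phi>: "smooth_map A \<phi>" and \<psi>: "smooth_map A (inv \<phi>)"
    and C: "(U, c) \<in> A" and D: "(V, d) \<in> A"
    and B: "B \<in> sets borel" "B \<subseteq> U" "\<phi> ` B \<subseteq> V"
  shows "chart_integral (V, d) (\<phi> ` B) =
    (\<integral>\<^sup>+v. ennreal (local_jacobian (U, c) (V, d) \<phi> (inv_into U c v)) * ennreal (weight (U, c) v) * indicator (c ` B) v \<partial>lborel)"
proof -
  let ?g = "d \<circ> \<phi> \<circ> inv_into U c"
  let ?g' = "\<lambda>v h. jacobian ?g (at v) *v h"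
  \<comment> \<open>\<open>weight\<close> is controlled only on the image of the chart; the
    indicator makes the integrand Borel on all of the coordinate space.\<close>
  let ?f = "\<lambda>w. ennreal (weight (V, d) w) * indicator (d ` V) w"
  have "\<phi> ` B = inv \<phi> -` B" using bij by (simp add: bij_vimage_eq_inv_image bij_imp_bij_inv inv_inv_eq)
  moreover have "inv \<phi> \<in> borel_measurable borel"
    using smooth_map_continuous[OF \<psi>] by (rule borel_measurable_continuous_onI)
  ultimately have \<phi>B: "\<phi> ` B \<in> sets borel"
    using B(1) by (metis Int_UNIV_right measurable_sets space_borel)
  have gB: "?g ` c ` B = d ` \<phi> ` B"
    unfolding image_image using B C by (intro image_cong) auto
  have sub: "c ` B \<subseteq> c ` (U \<inter> \<phi> -` V)" using B by blast
  have "chart_integral (V, d) (\<phi> ` B) = (\<integral>\<^sup>+w. ?f w * indicator (?g ` c ` B) w \<partial>lborel)"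
  proof -
    have "indicator (d ` \<phi> ` B) w = (indicator (d ` V) w * indicator (d ` \<phi> ` B) w :: ennreal)" for w
      using image_mono[OF B(3), of d] by (simp add: indicator_def) blast
    then show ?thesis
      unfolding gB chart_integral_def by (simp add: mult.assoc)
  qed
  also have "\<dots> = (\<integral>\<^sup>+v. ?f (?g v) * ennreal \<bar>det (matrix (?g' v))\<bar> * indicator (c ` B) v \<partial>lborel)"
  proof (rule nn_integral_change_of_variables)
    show "c ` B \<in> sets borel" using C B by (intro chart_image_borel) auto
    show "?g ` c ` B \<in> sets borel" unfolding gB using D B \<phi>B by (intro chart_image_borel) auto
    show "(?g has_derivative ?g' v) (at v)" if "v \<in> c ` B" for v
      using that local_differentiable[OF \<phi> C D] B unfolding jacobian_works by blast
    show "(c \<circ> inv \<phi> \<circ> inv_into V d) (?g v) = v" if v: "v \<in> c ` B" for v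
    proof -
      obtain x where "v = c x" "x \<in> B" using v by blast
      then show ?thesis using C D B bij by (simp add: image_subset_iff subset_iff bij_is_inj)
    qed
    show "c \<circ> inv \<phi> \<circ> inv_into V d \<in> borel_measurable (restrict_space borel (?g ` c ` B))"
    proof (rule borel_measurable_continuous_on_restrict, intro continuous_on_compose)
      show "continuous_on (?g ` c ` B) (inv_into V d)"
        unfolding gB by (rule continuous_on_subset[OF continuous_chart_inv[OF D] image_mono[OF B(3)]])
      show "continuous_on (inv_into V d ` ?g ` c ` B) (inv \<phi>)"
        using smooth_map_continuous[OF \<psi>] by (rule continuous_on_subset) simp
      have "inv_into V d ` ?g ` c ` B = \<phi> ` B"
      proof -
        have "inv_into V d (d (\<phi> x)) = \<phi> x" if "x \<in> B" for x
          using that B chart_inv[OF D, of "\<phi> x"] by blast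
        then show ?thesis unfolding gB by (simp add: image_image cong: image_cong)
      qed
      then have "inv \<phi> ` inv_into V d ` ?g ` c ` B = B"
        using bij by (simp add: image_comp bij_is_inj)
      then show "continuous_on (inv \<phi> ` inv_into V d ` ?g ` c ` B) c"
        using continuous_on_subset[OF continuous_chart[OF C]] B by auto
    qed
    show "(\<lambda>v. indicator (c ` B) v * \<bar>det (matrix (?g' v))\<bar>) \<in> borel_measurable borel"
    proof -
      have "(\<lambda>v. \<bar>det (jacobian ?g (at v))\<bar>) \<in> borel_measurable (restrict_space borel (c ` B))"
        using measurable_restrict_mono[OF local_measurable[OF \<phi> C D] sub] by measurable
      then show ?thesis
        using chart_image_borel[OF C] B by (subst (asm) borel_measurable_restrict_space_iff) (auto simp: mult.commute)
    qed
    show "?f \<in> borel_measurable borel" by (rule weight_measurable[OF D])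
  qed
  also have "\<dots> = (\<integral>\<^sup>+v. ennreal (local_jacobian (U, c) (V, d) \<phi> (inv_into U c v)) * ennreal (weight (U, c) v) * indicator (c ` B) v \<partial>lborel)"
  proof (intro nn_integral_cong)
    fix v
    show "?f (?g v) * ennreal \<bar>det (matrix (?g' v))\<bar> * indicator (c ` B) v =
        ennreal (local_jacobian (U, c) (V, d) \<phi> (inv_into U c v)) * ennreal (weight (U, c) v) * indicator (c ` B) v"
    proof (cases "v \<in> c ` B")
      case True
      then obtain x where x: "v = c x" "x \<in> B" by blast
      then have xU: "x \<in> U" "\<phi> x \<in> V" using B by auto
      then have "0 < weight (U, c) (c x)" "0 < weight (V, d) (d (\<phi> x))"
        using weight_pos C D by auto
      then show ?thesis
        using x xU C D by (simp add: local_jacobian_def ennreal_mult[symmetric] field_simps)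
    qed simp
  qed
  finally show ?thesis .
qed

text \<open>The previous formula for the identity map, whose local Jacobian is 1: overlapping charts
  assign the same mass.\<close>

lemma chart_integral_eq:
  assumes C: "(U, c) \<in> A" and D: "(V, d) \<in> A" and B: "B \<in> sets borel" "B \<subseteq> U" "B \<subseteq> V"
  shows "chart_integral (V, d) B = chart_integral (U, c) B"
proof -
  have inv: "inv (\<lambda>x. x) = (\<lambda>x::'x. x)" by (rule inv_equality) simp_all
  have "chart_integral (V, d) ((\<lambda>x. x) ` B) =
      (\<integral>\<^sup>+v. ennreal (local_jacobian (U, c) (V, d) (\<lambda>x. x) (inv_into U c v)) * ennreal (weight (U, c) v) * indicator (c ` B) v \<partial>lborel)"
    using assms smooth_map_id by (intro chart_integral_image) (auto simp: inv bij_id[unfolded id_def])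
  also have "\<dots> = chart_integral (U, c) B"
    unfolding chart_integral_def using B C D
    by (auto intro!: nn_integral_cong simp: local_jacobian_ident subset_iff split: split_indicator)
  finally show ?thesis by simp
qed

text \<open>A countable subcover, which exists by the Lindelof property; countability is what makes
  mass additive along the pieces cut out by the charts.\<close>

definition atlas_seq :: "nat \<Rightarrow> ('x, 'n) chart" where
  "atlas_seq = (SOME C. range C \<subseteq> A \<and> (\<Union>n. fst (C n)) = UNIV)"

lemma atlas_seq: "atlas_seq n \<in> A" "(\<Union>n. fst (atlas_seq n)) = UNIV"
proof -
  have "\<And>S. S \<in> fst ` A \<Longrightarrow> open S" using open_chart by auto
  then obtain \<U> where \<U>: "\<U> \<subseteq> fst ` A" "countable \<U>" "\<Union>\<U> = \<Union>(fst ` A)"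
    using Lindelof by metis
  have UN: "\<Union>\<U> = UNIV" using chart_exists unfolding \<U>(3) by force
  then have "\<U> \<noteq> {}" by auto
  define C where "C n = (SOME C. C \<in> A \<and> fst C = from_nat_into \<U> n)" for n
  have C: "C n \<in> A \<and> fst (C n) = from_nat_into \<U> n" for n
  proof -
    have "\<exists>C. C \<in> A \<and> fst C = from_nat_into \<U> n"
      using \<U>(1) from_nat_into[OF \<open>\<U> \<noteq> {}\<close>, of n] by (metis imageE subsetD)
    then show ?thesis unfolding C_def by (rule someI_ex)
  qed
  then have "(\<Union>n. fst (C n)) = \<Union>\<U>"
    using \<U>(2) \<open>\<U> \<noteq> {}\<close> by (simp add: Sup.SUP_cong[OF refl] range_from_nat_into[symmetric])
  then have "range C \<subseteq> A \<and> (\<Union>n. fst (C n)) = UNIV" using C UN by auto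
  then have "range atlas_seq \<subseteq> A \<and> (\<Union>n. fst (atlas_seq n)) = UNIV"
    unfolding atlas_seq_def by (rule someI[where P = "\<lambda>C. range C \<subseteq> A \<and> (\<Union>n. fst (C n)) = UNIV"])
  then show "atlas_seq n \<in> A" "(\<Union>n. fst (atlas_seq n)) = UNIV" by auto
qed

definition piece :: "nat \<Rightarrow> 'x set" where
  "piece = disjointed (\<lambda>n. fst (atlas_seq n))"

lemma piece: "piece n \<in> sets borel" "disjoint_family piece" "(\<Union>n. piece n) = UNIV" "piece n \<subseteq> fst (atlas_seq n)"
proof -
  have "open (fst (atlas_seq n))" for n
    using open_chart[of "fst (atlas_seq n)" "snd (atlas_seq n)"] atlas_seq(1)[of n] by simp
  then have "range (\<lambda>n. fst (atlas_seq n)) \<subseteq> sets borel" by auto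
  then have "range piece \<subseteq> sets borel"
    unfolding piece_def by (metis borel_comp sets.range_disjointed_sets)
  then show "piece n \<in> sets borel" by auto
  show "disjoint_family piece" "(\<Union>n. piece n) = UNIV" "piece n \<subseteq> fst (atlas_seq n)"
    using atlas_seq(2) disjointed_subset[of "\<lambda>n. fst (atlas_seq n)" n]
    by (simp_all add: piece_def disjoint_family_disjointed UN_disjointed_eq)
qed

lemma emeasure_pieces:
  assumes "sets M = sets borel" "B \<in> sets borel"
  shows "emeasure M B = (\<Sum>n. emeasure M (B \<inter> piece n))"
proof -
  have "disjoint_family (\<lambda>n. B \<inter> piece n)"
    using piece(2) by (auto simp: disjoint_family_on_def)
  then have "(\<Sum>n. emeasure M (B \<inter> piece n)) = emeasure M (\<Union>n. B \<inter> piece n)"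
    using piece(1) assms by (intro suminf_emeasure) auto
  also have "(\<Union>n. B \<inter> piece n) = B" using piece(3) by auto
  finally show ?thesis by simp
qed

text \<open>Each chart measure is cut down to its own disjoint piece, so that overlaps are counted
  once.\<close>

definition vol :: "'x measure" where
  "vol = superpose UNIV (\<lambda>n. density (chart_measure (atlas_seq n)) (indicator (piece n)))"

lemma sets_vol [simp, measurable_cong]: "sets vol = sets borel"
  by (simp add: vol_def)

lemma space_vol [simp]: "space vol = UNIV"
  by (simp add: vol_def)

lemma emeasure_vol:
  assumes "B \<in> sets borel"
  shows "emeasure vol B = (\<Sum>n. emeasure (chart_measure (atlas_seq n)) (B \<inter> piece n))"
proof -
  have "emeasure (density (chart_measure (atlas_seq n)) (indicator (piece n))) B =
      emeasure (chart_measure (atlas_seq n)) (B \<inter> piece n)" for n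
    using assms piece(1)[of n] by (intro emeasure_density_indicator) auto
  then show ?thesis
    using assms by (simp add: vol_def emeasure_superpose nn_integral_count_space_nat)
qed

text \<open>An arbitrary chart is compared with the selected one on every piece separately, where
  \<open>chart_integral_eq\<close> applies.\<close>

lemma chart_integral_vol:
  assumes C: "(U, c) \<in> A" and B: "B \<in> sets borel" "B \<subseteq> U"
  shows "emeasure vol B = chart_integral (U, c) B"
proof -
  have "emeasure (chart_measure (atlas_seq n)) (B \<inter> piece n) = emeasure (chart_measure (U, c)) (B \<inter> piece n)" for n
  proof -
    obtain V d where n: "atlas_seq n = (V, d)" by fastforce
    then have D: "(V, d) \<in> A" "piece n \<subseteq> V" using atlas_seq(1)[of n] piece(4)[of n] by auto
    then show ?thesis
      unfolding n using B C piece(1)[of n]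
      by (simp add: emeasure_chart_measure Int_assoc Int_absorb2 le_infI1 le_infI2
          chart_integral_eq[of U c V d "B \<inter> piece n"] flip: Int_assoc)
  qed
  then have "emeasure vol B = emeasure (chart_measure (U, c)) B"
    by (simp add: emeasure_vol[OF B(1)] emeasure_pieces[OF sets_chart_measure B(1)])
  also have "\<dots> = chart_integral (U, c) B"
    using B C by (simp add: emeasure_chart_measure Int_absorb2)
  finally show ?thesis .
qed

text \<open>Existence is \<open>chart_integral_vol\<close>. For uniqueness, any candidate has
  prescribed values on Borel sets inside one chart, hence on the countably many pieces of any Borel
  set. This discharges the definite description.\<close>

lemma riemannian_volume_eq_vol: "riemannian_volume A G = vol"
  unfolding riemannian_volume_def
proof (rule the_equality)
  show "sets vol = sets borel \<and> (\<forall>(U, c)\<in>A. \<forall>B\<in>sets borel. B \<subseteq> U \<longrightarrow>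
      emeasure vol B = (\<integral>\<^sup>+v. ennreal (sqrt (det (G (U, c) (inv_into U c v)))) * indicator (c ` B) v \<partial>lborel))"
    by (auto simp: chart_integral_vol chart_integral_def weight_def)
next
  fix M assume M: "sets M = sets borel \<and> (\<forall>(U, c)\<in>A. \<forall>B\<in>sets borel. B \<subseteq> U \<longrightarrow>
      emeasure M B = (\<integral>\<^sup>+v. ennreal (sqrt (det (G (U, c) (inv_into U c v)))) * indicator (c ` B) v \<partial>lborel))"
  show "M = vol"
  proof (rule measure_eqI)
    fix B assume "B \<in> sets M"
    then have B: "B \<in> sets borel" using M by simp
    have "emeasure M (B \<inter> piece n) = emeasure vol (B \<inter> piece n)" for n
    proof -
      obtain V d where n: "atlas_seq n = (V, d)" by fastforce
      then have D: "(V, d) \<in> A" "piece n \<subseteq> V" using atlas_seq(1)[of n] piece(4)[of n] by auto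
      have "emeasure M (B \<inter> piece n) = chart_integral (V, d) (B \<inter> piece n)"
        using M[THEN conjunct2, rule_format, OF D(1), unfolded split, rule_format, of "B \<inter> piece n"] D B piece(1)[of n]
        by (simp add: chart_integral_def weight_def le_infI2)
      then show ?thesis
        using D B piece(1)[of n] by (simp add: chart_integral_vol[of V d] le_infI2)
    qed
    then show "emeasure M B = emeasure vol B"
      using M B by (simp add: emeasure_pieces[of M] emeasure_pieces[of vol])
  qed (use M in simp)
qed


section \<open>Transformation of the volume under diffeomorphisms\<close>

lemma density_vol_chart:
  assumes C: "(U, c) \<in> A"
  shows "density vol (indicator U) = chart_measure (U, c)"
proof (rule measure_eqI)
  fix B assume "B \<in> sets (density vol (indicator U))"
  then show "emeasure (density vol (indicator U)) B = emeasure (chart_measure (U, c)) B"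
    using C open_chart[OF C]
    by (simp add: emeasure_density_indicator emeasure_chart_measure chart_integral_vol[OF C])
qed simp

lemma nn_integral_vol_chart:
  assumes C: "(U, c) \<in> A" and f: "f \<in> borel_measurable borel" and B: "B \<in> sets borel" "B \<subseteq> U"
  shows "(\<integral>\<^sup>+x. f x * indicator B x \<partial>vol) =
    (\<integral>\<^sup>+v. f (inv_into U c v) * ennreal (weight (U, c) v) * indicator (c ` B) v \<partial>lborel)"
proof -
  let ?R = "restrict_space lborel (c ` U)"
  have U: "c ` U \<in> sets borel" using open_chart_image[OF C] by simp
  have w: "(\<lambda>v. ennreal (weight (U, c) v)) \<in> borel_measurable ?R"
    using weight_measurable[OF C] U by (subst borel_measurable_restrict_space_iff_ennreal) auto
  note [measurable] = chart_inv_measurable[OF C] f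
  have "(\<integral>\<^sup>+x. f x * indicator B x \<partial>vol) = (\<integral>\<^sup>+x. indicator U x * (f x * indicator B x) \<partial>vol)"
    using B by (intro nn_integral_cong) (auto split: split_indicator)
  also have "\<dots> = (\<integral>\<^sup>+x. f x * indicator B x \<partial>density vol (indicator U))"
    using B open_chart[OF C] by (subst nn_integral_density) (auto intro!: borel_measurable_indicator)
  also have "\<dots> = (\<integral>\<^sup>+v. f (inv_into U c v) * indicator B (inv_into U c v) \<partial>density ?R (\<lambda>v. ennreal (weight (U, c) v)))"
    unfolding density_vol_chart[OF C] chart_measure_def split
    using B by (subst nn_integral_distr) auto
  also have "\<dots> = (\<integral>\<^sup>+v. ennreal (weight (U, c) v) * (f (inv_into U c v) * indicator B (inv_into U c v)) \<partial>?R)"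
    using B by (subst nn_integral_density[OF w]) auto
  also have "\<dots> = (\<integral>\<^sup>+v. ennreal (weight (U, c) v) * (f (inv_into U c v) * indicator B (inv_into U c v)) * indicator (c ` U) v \<partial>lborel)"
    using U by (subst nn_integral_restrict_space) auto
  also have "\<dots> = (\<integral>\<^sup>+v. f (inv_into U c v) * ennreal (weight (U, c) v) * indicator (c ` B) v \<partial>lborel)"
    unfolding chart_image_vimage[OF C B(2)]
    by (intro nn_integral_cong) (auto split: split_indicator simp: mult_ac)
  finally show ?thesis .
qed

text \<open>\<open>chart_at\<close> picks charts without any regularity in the point. On each of the
  countably many sets determined by one source and one target chart of \<open>atlas_seq\<close>,
  however, the Jacobian coincides with a continuous local expression.\<close>

lemma riemannian_jacobian_measurable:
  assumes \<phi>: "smooth_map A \<phi>"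
  shows "riemannian_jacobian A G \<phi> \<in> borel_measurable borel"
proof (rule measurable_piecewise_restrict)
  let ?P = "\<lambda>(i, j). fst (atlas_seq i) \<inter> \<phi> -` fst (atlas_seq j)"
  show "countable (range ?P)" by simp
  show "space borel \<subseteq> \<Union>(range ?P)"
  proof
    fix x :: 'x
    obtain i j where "x \<in> fst (atlas_seq i)" "\<phi> x \<in> fst (atlas_seq j)"
      using atlas_seq(2) by (metis UNIV_I UN_E)
    then have "x \<in> ?P (i, j)" by simp
    then show "x \<in> \<Union>(range ?P)" by blast
  qed
  fix \<Omega> assume "\<Omega> \<in> range ?P"
  then obtain i j where \<Omega>: "\<Omega> = fst (atlas_seq i) \<inter> \<phi> -` fst (atlas_seq j)" by auto
  obtain U c V d where ij: "atlas_seq i = (U, c)" "atlas_seq j = (V, d)" by fastforce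
  then have C: "(U, c) \<in> A" and D: "(V, d) \<in> A" using atlas_seq(1)[of i] atlas_seq(1)[of j] by auto
  have \<Omega>: "\<Omega> = U \<inter> \<phi> -` V" using \<Omega> ij by simp
  show "\<Omega> \<inter> space borel \<in> sets borel"
    using open_overlap[OF \<phi> C D] by (simp add: \<Omega>)
  have cU: "continuous_on (U \<inter> \<phi> -` V) c"
    by (rule continuous_on_subset[OF continuous_chart[OF C]]) simp
  have d\<phi>: "continuous_on (U \<inter> \<phi> -` V) (\<lambda>x. d (\<phi> x))"
    by (rule continuous_on_compose2[OF continuous_chart[OF D]
          continuous_on_subset[OF smooth_map_continuous[OF \<phi>]]]) auto
  have "continuous_on (U \<inter> \<phi> -` V) (local_jacobian (U, c) (V, d) \<phi>)"
    unfolding local_jacobian_def split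
  proof (intro continuous_intros)
    show "continuous_on (U \<inter> \<phi> -` V) (\<lambda>x. det (jacobian (d \<circ> \<phi> \<circ> inv_into U c) (at (c x))))"
      by (rule continuous_on_compose2[OF continuous_local_jacobian[OF \<phi> C D] cU]) auto
    show "continuous_on (U \<inter> \<phi> -` V) (\<lambda>x. weight (V, d) (d (\<phi> x)))"
      by (rule continuous_on_compose2[OF continuous_weight[OF D] d\<phi>]) auto
    show "continuous_on (U \<inter> \<phi> -` V) (\<lambda>x. weight (U, c) (c x))"
      by (rule continuous_on_compose2[OF continuous_weight[OF C] cU]) auto
    show "\<forall>x\<in>U \<inter> \<phi> -` V. weight (U, c) (c x) \<noteq> 0"
      using weight_pos[OF C] by (metis IntD1 less_irrefl)
  qed
  then have "continuous_on (U \<inter> \<phi> -` V) (riemannian_jacobian A G \<phi>)"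
    by (rule continuous_on_cong[THEN iffD1, rotated 2])
      (auto simp: riemannian_jacobian_eq_local[OF \<phi> C D])
  then show "riemannian_jacobian A G \<phi> \<in> borel_measurable (restrict_space borel \<Omega>)"
    unfolding \<Omega> by (rule borel_measurable_continuous_on_restrict)
qed

text \<open>The set is cut twice, by the piece containing \<open>x\<close> and by the piece
  containing \<open>\<phi> x\<close>, so that on each part a single source chart and a single target
  chart suffice and \<open>chart_integral_image\<close> applies.\<close>

lemma distr_density_jacobian:
  assumes bij: "bij \<phi>" and \<phi>: "smooth_map A \<phi>" and \<psi>: "smooth_map A (inv \<phi>)"
  shows "distr (density vol (\<lambda>x. ennreal (riemannian_jacobian A G \<phi> x))) borel \<phi> = vol"
proof (rule measure_eqI)
  let ?J = "\<lambda>x. ennreal (riemannian_jacobian A G \<phi> x)"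
  have [measurable]: "\<phi> \<in> borel_measurable borel" "riemannian_jacobian A G \<phi> \<in> borel_measurable borel"
    using smooth_map_continuous[OF \<phi>] riemannian_jacobian_measurable[OF \<phi>]
    by (auto intro: borel_measurable_continuous_onI)
  fix B assume "B \<in> sets (distr (density vol ?J) borel \<phi>)"
  then have B[measurable]: "B \<in> sets borel" by simp
  have *: "emeasure vol (B \<inter> piece j \<inter> \<phi> ` piece i) = emeasure (density vol ?J) (\<phi> -` (B \<inter> piece j) \<inter> piece i)" for i j
  proof -
    obtain U c V d where ij: "atlas_seq i = (U, c)" "atlas_seq j = (V, d)" by fastforce
    then have C: "(U, c) \<in> A" "piece i \<subseteq> U" and D: "(V, d) \<in> A" "piece j \<subseteq> V"
      using atlas_seq(1)[of i] atlas_seq(1)[of j] piece(4)[of i] piece(4)[of j] by auto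
    let ?B = "\<phi> -` (B \<inter> piece j) \<inter> piece i"
    have eq: "B \<inter> piece j \<inter> \<phi> ` piece i = \<phi> ` ?B" by auto
    have [measurable]: "piece i \<in> sets borel" "piece j \<in> sets borel" by (rule piece)+
    have B': "?B \<in> sets borel" "?B \<subseteq> U" "\<phi> ` ?B \<subseteq> V"
      using C D measurable_sets[of \<phi> borel borel "B \<inter> piece j"] by auto
    have "\<phi> ` ?B = B \<inter> piece j \<inter> inv \<phi> -` piece i"
    proof -
      have "y = \<phi> (inv \<phi> y)" for y using bij by (simp add: bij_is_surj surj_f_inv_f)
      then show ?thesis using bij by (auto simp: bij_is_inj) (metis IntI image_eqI vimageI)
    qed
    moreover have "inv \<phi> \<in> borel_measurable borel"
      using smooth_map_continuous[OF \<psi>] by (rule borel_measurable_continuous_onI)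
    ultimately have im: "\<phi> ` ?B \<in> sets borel"
      using measurable_sets[of "inv \<phi>" borel borel "piece i"] by simp
    have "emeasure vol (\<phi> ` ?B) = chart_integral (V, d) (\<phi> ` ?B)"
      using D B' im by (intro chart_integral_vol) auto
    also have "\<dots> = (\<integral>\<^sup>+v. ennreal (local_jacobian (U, c) (V, d) \<phi> (inv_into U c v)) * ennreal (weight (U, c) v) * indicator (c ` ?B) v \<partial>lborel)"
      by (rule chart_integral_image[OF bij \<phi> \<psi> C(1) D(1) B'])
    also have "\<dots> = (\<integral>\<^sup>+v. ?J (inv_into U c v) * ennreal (weight (U, c) v) * indicator (c ` ?B) v \<partial>lborel)"
      using B' C(1) riemannian_jacobian_eq_local[OF \<phi> C(1) D(1)]
      by (intro nn_integral_cong) (auto split: split_indicator simp: subset_iff)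
    also have "\<dots> = (\<integral>\<^sup>+x. ?J x * indicator ?B x \<partial>vol)"
      using B' C by (intro nn_integral_vol_chart[symmetric]) auto
    also have "\<dots> = emeasure (density vol ?J) ?B"
      using B' by (subst emeasure_density) auto
    finally show ?thesis by (simp only: eq)
  qed
  have im[measurable]: "\<phi> ` piece i \<in> sets borel" for i
  proof -
    have "\<phi> ` piece i = inv \<phi> -` piece i" using bij by (simp add: bij_vimage_eq_inv_image bij_imp_bij_inv inv_inv_eq)
    moreover have "inv \<phi> \<in> borel_measurable borel"
      using smooth_map_continuous[OF \<psi>] by (rule borel_measurable_continuous_onI)
    ultimately show ?thesis using measurable_sets[of "inv \<phi>" borel borel "piece i"] piece(1) by simp
  qed
  have "emeasure (distr (density vol ?J) borel \<phi>) B = emeasure (density vol ?J) (\<phi> -` B)"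
    using B by (subst emeasure_distr) auto
  also have "\<dots> = (\<Sum>i. emeasure (density vol ?J) (\<phi> -` B \<inter> piece i))"
    using measurable_sets[of \<phi> borel borel B] by (intro emeasure_pieces) auto
  also have "\<dots> = (\<Sum>i. emeasure vol (B \<inter> \<phi> ` piece i))"
  proof (intro suminf_cong)
    fix i
    have "emeasure vol (B \<inter> \<phi> ` piece i) = (\<Sum>j. emeasure vol (B \<inter> \<phi> ` piece i \<inter> piece j))"
      by (intro emeasure_pieces) auto
    also have "\<dots> = (\<Sum>j. emeasure (density vol ?J) (\<phi> -` (B \<inter> piece j) \<inter> piece i))"
      by (simp only: Int_assoc Int_commute[of "\<phi> ` piece i"] flip: *)
    also have "\<dots> = emeasure (density vol ?J) (\<Union>j. \<phi> -` (B \<inter> piece j) \<inter> piece i)"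
      using piece(2) piece(1) measurable_sets[of \<phi> borel borel]
      by (intro suminf_emeasure) (auto simp: disjoint_family_on_def)
    also have "(\<Union>j. \<phi> -` (B \<inter> piece j) \<inter> piece i) = \<phi> -` B \<inter> piece i"
    proof -
      have "(\<Union>j. \<phi> -` (B \<inter> piece j) \<inter> piece i) = \<phi> -` (B \<inter> (\<Union>j. piece j)) \<inter> piece i" by blast
      then show ?thesis by (simp add: piece(3))
    qed
    finally show "emeasure (density vol ?J) (\<phi> -` B \<inter> piece i) = emeasure vol (B \<inter> \<phi> ` piece i)" by simp
  qed
  also have "\<dots> = emeasure vol (\<Union>i. B \<inter> \<phi> ` piece i)"
  proof (intro suminf_emeasure)
    have "\<phi> ` piece m \<inter> \<phi> ` piece n = {}" if "m \<noteq> n" for m n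
      using disjoint_family_onD[OF piece(2) _ _ that]
      by (simp add: image_Int[OF bij_is_inj[OF bij], symmetric])
    then show "disjoint_family (\<lambda>i. B \<inter> \<phi> ` piece i)" by (fastforce simp: disjoint_family_on_def)
  qed auto
  also have "(\<Union>i. B \<inter> \<phi> ` piece i) = B \<inter> \<phi> ` (\<Union>i. piece i)" by blast
  also have "\<dots> = B" using bij by (simp add: piece(3) bij_is_surj)
  finally show "emeasure (distr (density vol ?J) borel \<phi>) B = emeasure vol B" .
qed simp

text \<open>The previous identity is solved for the image of the volume: on the right the volume is
  replaced by the image of its Jacobian density, and the positive Jacobian cancels against its
  inverse.\<close>

lemma distr_vol:
  assumes bij: "bij \<phi>" and \<phi>: "smooth_map A \<phi>" and \<psi>: "smooth_map A (inv \<phi>)"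
  shows "distr vol borel \<phi> = density vol (\<lambda>y. ennreal (inverse (riemannian_jacobian A G \<phi> (inv \<phi> y))))"
proof (rule measure_eqI)
  let ?J = "riemannian_jacobian A G \<phi>"
  have [measurable]: "\<phi> \<in> borel_measurable borel" "inv \<phi> \<in> borel_measurable borel" "?J \<in> borel_measurable borel"
    using smooth_map_continuous[OF \<phi>] smooth_map_continuous[OF \<psi>] riemannian_jacobian_measurable[OF \<phi>]
    by (auto intro: borel_measurable_continuous_onI)
  have m: "(\<lambda>y. ennreal (inverse (?J (inv \<phi> y)))) \<in> borel_measurable borel"
    by measurable
  fix B assume "B \<in> sets (distr vol borel \<phi>)"
  then have [measurable]: "B \<in> sets borel" by simp
  have pos: "0 < ?J x" for x by (rule riemannian_jacobian_pos[OF assms])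
  have "emeasure (density vol (\<lambda>y. ennreal (inverse (?J (inv \<phi> y))))) B =
      (\<integral>\<^sup>+y. ennreal (inverse (?J (inv \<phi> y))) * indicator B y \<partial>vol)"
    by (subst emeasure_density) auto
  also have "\<dots> = (\<integral>\<^sup>+y. ennreal (inverse (?J (inv \<phi> y))) * indicator B y \<partial>distr (density vol (\<lambda>x. ennreal (?J x))) borel \<phi>)"
    by (simp add: distr_density_jacobian[OF assms])
  also have "\<dots> = (\<integral>\<^sup>+x. ennreal (?J x) * (ennreal (inverse (?J x)) * indicator B (\<phi> x)) \<partial>vol)"
    using bij by (simp add: nn_integral_distr nn_integral_density bij_is_inj)
  also have "\<dots> = (\<integral>\<^sup>+x. indicator B (\<phi> x) \<partial>vol)"
    using pos by (simp add: ennreal_mult[symmetric] mult.assoc[symmetric] less_imp_neq[symmetric] less_imp_le)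
  also have "\<dots> = emeasure (distr vol borel \<phi>) B"
    by (simp add: nn_integral_distr[symmetric] flip: nn_integral_indicator)
  finally show "emeasure (distr vol borel \<phi>) B =
      emeasure (density vol (\<lambda>y. ennreal (inverse (?J (inv \<phi> y))))) B" ..
qed simp

text \<open>A point is a Lebesgue null set in coordinates. Absence of atoms is what later excludes
  coinciding cluster points.\<close>

lemma emeasure_vol_singleton: "emeasure vol {x} = 0"
proof -
  obtain U c where C: "(U, c) \<in> A" "x \<in> U" using chart_exists by blast
  then have "emeasure vol {x} = chart_integral (U, c) {x}"
    by (intro chart_integral_vol) auto
  also have "\<dots> = 0"
  proof -
    have "AE v in lborel. ennreal (weight (U, c) v) * indicator (c ` {x}) v = 0"
      using AE_lborel_singleton[of "c x"] by eventually_elim simp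
    then have "chart_integral (U, c) {x} = (\<integral>\<^sup>+v. 0 \<partial>(lborel :: (real ^ 'n) measure))"
      unfolding chart_integral_def split by (rule nn_integral_cong_AE)
    then show ?thesis by simp
  qed
  finally show ?thesis .
qed

text \<open>Points with coordinates and weight bounded by \<open>k\<close> have volume at most
  \<open>k\<close> times that of a ball of radius \<open>k\<close>; these sets cover each selected
  chart.\<close>

lemma sigma_finite_vol: "sigma_finite_measure vol"
proof
  define S where "S i k = {x \<in> fst (atlas_seq i). norm (snd (atlas_seq i) x) \<le> real k \<and>
      weight (atlas_seq i) (snd (atlas_seq i) x) \<le> real k}" for i k
  have S: "S i k \<in> sets borel \<and> emeasure vol (S i k) \<noteq> \<infinity>" for i k
  proof -
    obtain U c where i: "atlas_seq i = (U, c)" by fastforce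
    then have C: "(U, c) \<in> A" using atlas_seq(1)[of i] by simp
    have Seq: "S i k = {x \<in> U. norm (c x) \<le> real k \<and> weight (U, c) (c x) \<le> real k}" by (simp add: S_def i)
    have "continuous_on U (\<lambda>x. weight (U, c) (c x))" "continuous_on U (\<lambda>x. norm (c x))"
      using continuous_chart[OF C] continuous_on_compose2[OF continuous_weight[OF C] continuous_chart[OF C]]
      by (auto intro!: continuous_intros)
    then have [measurable]: "(\<lambda>x. weight (U, c) (c x)) \<in> borel_measurable (restrict_space borel U)"
        "(\<lambda>x. norm (c x)) \<in> borel_measurable (restrict_space borel U)"
      by (auto intro: borel_measurable_continuous_on_restrict)
    have "{x \<in> space (restrict_space borel U). norm (c x) \<le> real k \<and> weight (U, c) (c x) \<le> real k} \<in> sets (restrict_space borel U)"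
      by measurable
    then have Sm: "S i k \<in> sets borel"
      using open_chart[OF C] by (auto simp: sets_restrict_space_iff space_restrict_space Seq)
    have "emeasure vol (S i k) = chart_integral (U, c) (S i k)"
      using C Sm by (intro chart_integral_vol) (auto simp: Seq)
    also have "\<dots> \<le> (\<integral>\<^sup>+v. ennreal (real k) * indicator (cball (0 :: real ^ 'n) (real k)) v \<partial>lborel)"
      unfolding chart_integral_def split
      by (intro nn_integral_mono) (auto split: split_indicator simp: Seq ennreal_leI)
    also have "\<dots> = ennreal (real k) * emeasure lborel (cball (0 :: real ^ 'n) (real k))"
      by (subst nn_integral_cmult_indicator) auto
    also have "\<dots> < \<infinity>"
      using emeasure_lborel_cball_finite[of "0 :: real ^ 'n" "real k"] by (simp add: ennreal_mult_less_top)
    finally show ?thesis using Sm by simp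
  qed
  have "x \<in> (\<Union>(i, k)\<in>UNIV. S i k)" for x
  proof -
    obtain i where "x \<in> fst (atlas_seq i)" using atlas_seq(2) by auto
    moreover obtain k where "max (norm (snd (atlas_seq i) x)) (weight (atlas_seq i) (snd (atlas_seq i) x)) \<le> real k"
      using real_arch_simple by blast
    ultimately show ?thesis by (auto simp: S_def)
  qed
  then show "\<exists>S. countable S \<and> S \<subseteq> sets vol \<and> \<Union>S = space vol \<and> (\<forall>a\<in>S. emeasure vol a \<noteq> \<infinity>)"
    using S by (intro exI[of _ "range (\<lambda>(i, k). S i k)"]) auto
qed

text \<open>Coordinate balls whose closed balls stay inside the chart are relatively compact, and
  countably many suffice by the Lindelof property. The cover becomes the parameter \<open>W\<close>
  of the later locales.\<close>

lemma relatively_compact_cover: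
  "\<exists>W :: nat \<Rightarrow> 'x set. (\<forall>n. open (W n) \<and> compact (closure (W n))) \<and> (\<Union>n. W n) = UNIV"
proof -
  let ?F = "{W :: 'x set. open W \<and> compact (closure W)}"
  obtain \<U> where \<U>: "\<U> \<subseteq> ?F" "countable \<U>" "\<Union>\<U> = \<Union>?F"
    using Lindelof[of ?F] by auto
  have "x \<in> \<Union>?F" for x
  proof -
    obtain U c where C: "(U, c) \<in> A" "x \<in> U" using chart_exists by blast
    then obtain e where e: "0 < e" "cball (c x) e \<subseteq> c ` U"
      using open_chart_image[OF C(1)] open_contains_cball by blast
    let ?K = "inv_into U c ` cball (c x) e" and ?W = "inv_into U c ` ball (c x) e"
    have "compact ?K"
      using e by (intro compact_continuous_image continuous_on_subset[OF continuous_chart_inv[OF C(1)]]) auto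
    moreover have "?W \<subseteq> ?K" by (intro image_mono ball_subset_cball)
    ultimately have "compact (closure ?W)"
      by (metis closed_closure closure_minimal compact_Int_closed compact_imp_closed inf.absorb2)
    moreover have "open ?W"
    proof -
      have "homeomorphism (c ` U) U (inv_into U c) c"
        using chart_homeo[OF C(1)] by (rule homeomorphism_symD)
      then have "openin (top_of_set U) ?W"
        using subset_trans[OF ball_subset_cball e(2)] open_chart_image[OF C(1)]
        by (intro homeomorphism_imp_open_map[OF \<open>homeomorphism (c ` U) U _ _\<close>] openin_open_eq[THEN iffD2]) auto
      then show ?thesis
        using open_chart[OF C(1)] by (simp add: openin_open_eq)
    qed
    moreover have "x \<in> ?W" using C e(1) by (auto intro!: image_eqI[of _ _ "c x"])
    ultimately show ?thesis by blast
  qed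
  then have UN: "\<Union>\<U> = UNIV" using \<U>(3) by blast
  then have "\<U> \<noteq> {}" by auto
  then show ?thesis
    using \<U> UN from_nat_into[of \<U>] range_from_nat_into[of \<U>]
    by (intro exI[of _ "from_nat_into \<U>"]) auto
qed

end

section \<open>Finite tuples\<close>

definition cylinder :: "'a set list \<Rightarrow> 'a list set" where
  "cylinder Vs = {ys. list_all2 (\<lambda>y V. y \<in> V) ys Vs}"

lemma open_cylinder:
  assumes "\<And>V. V \<in> set Vs \<Longrightarrow> open V"
  shows "open (cylinder Vs)"
  unfolding open_list_def
proof (intro ballI exI conjI)
  fix ys assume "ys \<in> cylinder Vs"
  then show "list_all2 (\<lambda>x V. open V \<and> x \<in> V) ys Vs"
    using assms by (auto simp: cylinder_def list_all2_conv_all_nth)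
qed (simp add: cylinder_def)

lemma cylinder_refine:
  assumes B: "topological_basis B" and U: "open U" "xs \<in> U"
  shows "\<exists>Ws\<in>lists B. xs \<in> cylinder Ws \<and> cylinder Ws \<subseteq> U"
proof -
  obtain Vs where Vs: "list_all2 (\<lambda>x V. open V \<and> x \<in> V) xs Vs" "cylinder Vs \<subseteq> U"
    using U unfolding open_list_def cylinder_def by blast
  have "\<forall>i\<in>{..<length xs}. \<exists>W. W \<in> B \<and> xs ! i \<in> W \<and> W \<subseteq> Vs ! i"
  proof
    fix i assume "i \<in> {..<length xs}"
    then have "open (Vs ! i)" "xs ! i \<in> Vs ! i"
      using Vs(1) by (auto simp: list_all2_conv_all_nth)
    from topological_basisE[OF B this] show "\<exists>W. W \<in> B \<and> xs ! i \<in> W \<and> W \<subseteq> Vs ! i"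
      by blast
  qed
  from bchoice[OF this] obtain W where W: "\<And>i. i < length xs \<Longrightarrow> W i \<in> B \<and> xs ! i \<in> W i \<and> W i \<subseteq> Vs ! i"
    by blast
  let ?Ws = "map W [0..<length xs]"
  have "?Ws \<in> lists B" "xs \<in> cylinder ?Ws"
    using W by (auto simp: cylinder_def list_all2_conv_all_nth)
  moreover have "cylinder ?Ws \<subseteq> cylinder Vs"
    using W Vs(1) by (fastforce simp: cylinder_def list_all2_conv_all_nth subset_iff)
  ultimately show ?thesis using Vs(2) by blast
qed

text \<open>Cylinders over a countable basis form a countable basis. Second countability identifies
  the Borel sets of pairs of a point and a tuple with the product sigma-algebra, through
  \<open>borel_prod\<close>.\<close>

instance list :: (second_countable_topology) second_countable_topology
proof
  obtain B :: "'a set set" where B: "countable B" "topological_basis B"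
    using ex_countable_basis by blast
  have "topological_basis (cylinder ` lists B)"
  proof (rule topological_basisI)
    show "open S" if "S \<in> cylinder ` lists B" for S
      using that topological_basis_open[OF B(2)] by (auto intro!: open_cylinder simp: lists_eq_set)
    show "\<exists>S\<in>cylinder ` lists B. xs \<in> S \<and> S \<subseteq> U" if "open U" "xs \<in> U" for U and xs :: "'a list"
      using cylinder_refine[OF B(2) that] by blast
  qed
  then have "open = generate_topology (cylinder ` lists B)"
    by (rule topological_basis_imp_subbasis)
  moreover have "countable (cylinder ` lists B)"
    using B(1) by auto
  ultimately show "\<exists>B::'a list set set. countable B \<and> open = generate_topology B"
    by blast
qed

lemma open_length: "open {ys :: 'a::topological_space list. length ys = n}"
proof -
  have "{ys :: 'a list. length ys = n} = cylinder (replicate n UNIV)"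
    by (auto simp: cylinder_def list_all2_conv_all_nth)
  then show ?thesis
    by (auto intro!: open_cylinder)
qed

lemma open_nth:
  assumes "open V"
  shows "open {ys. i < length ys \<and> ys ! i \<in> V}"
  unfolding open_list_def
proof (intro ballI exI conjI)
  fix ys assume "ys \<in> {ys. i < length ys \<and> ys ! i \<in> V}"
  let ?Vs = "map (\<lambda>j. if j = i then V else UNIV) [0..<length ys]"
  show "list_all2 (\<lambda>x V. open V \<and> x \<in> V) ys ?Vs"
    "{zs. list_all2 (\<lambda>y V. y \<in> V) zs ?Vs} \<subseteq> {ys. i < length ys \<and> ys ! i \<in> V}"
    using assms \<open>ys \<in> _\<close> by (auto simp: list_all2_conv_all_nth split: if_splits)
qed

text \<open>Tuples of different length lie in disjoint open sets of constant length; tuples of equal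
  length are separated in a coordinate where they differ.\<close>

instance list :: (t2_space) t2_space
proof
  fix xs ys :: "'a list" assume "xs \<noteq> ys"
  then consider "length xs \<noteq> length ys" | i where "length xs = length ys" "i < length xs" "xs ! i \<noteq> ys ! i"
    using nth_equalityI by blast
  then show "\<exists>U V. open U \<and> open V \<and> xs \<in> U \<and> ys \<in> V \<and> U \<inter> V = {}"
  proof cases
    case 1
    then show ?thesis
      by (intro exI[of _ "{zs. length zs = length xs}"] exI[of _ "{zs. length zs = length ys}"])
        (auto simp: open_length)
  next
    case 2
    then obtain U V where "open U" "open V" "xs ! i \<in> U" "ys ! i \<in> V" "U \<inter> V = {}"
      using hausdorff[of "xs ! i" "ys ! i"] by auto
    then show ?thesis
      using 2 open_nth[of U i] open_nth[of V i]
      by (intro exI[of _ "{zs. i < length zs \<and> zs ! i \<in> U}"] exI[of _ "{zs. i < length zs \<and> zs ! i \<in> V}"]) auto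
  qed
qed

text \<open>A coordinate made total: beyond the length it has a constant value, so that it is Borel
  on the whole tuple space and conditions can quantify over all positions.\<close>

definition entry :: "nat \<Rightarrow> 'a list \<Rightarrow> 'a" where
  "entry i ys = (if i < length ys then ys ! i else undefined)"

lemma length_measurable [measurable]: "length \<in> measurable (borel :: 'a::topological_space list measure) (count_space UNIV)"
proof (rule measurableI)
  fix S :: "nat set"
  have "length -` S \<inter> space borel = (\<Union>n\<in>S. {ys :: 'a list. length ys = n})" by auto
  then show "length -` S \<inter> space borel \<in> sets (borel :: 'a list measure)"
    by (auto simp: open_length)
qed simp

lemma entry_measurable [measurable]: "entry i \<in> borel_measurable borel"
proof (rule borel_measurableI)
  fix V :: "'a set" assume "open V"
  have "entry i -` V = {ys. i < length ys \<and> ys ! i \<in> V} \<union> {ys. length ys \<le> i \<and> undefined \<in> V}"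
    by (auto simp: entry_def split: if_splits)
  moreover have "{ys \<in> space borel. length ys \<le> i \<and> undefined \<in> V} \<in> sets (borel :: 'a list measure)"
    by measurable
  ultimately show "entry i -` V \<inter> space borel \<in> sets borel"
    using open_nth[OF \<open>open V\<close>, of i] by auto
qed

text \<open>The sets of constant length form a countable open partition of the tuple space.\<close>

lemma measurable_from_list:
  assumes "\<And>n. g n \<in> measurable borel N" "\<And>n ys. length ys = n \<Longrightarrow> f ys = g n ys"
  shows "f \<in> measurable (borel :: 'a::topological_space list measure) N"
proof (rule measurable_piecewise_restrict2)
  show "\<exists>h\<in>borel \<rightarrow>\<^sub>M N. \<forall>x\<in>{ys. length ys = n}. f x = h x" for n
    using assms by blast
qed (auto simp: open_length)

lemma prod_list_measurable [measurable]:
  fixes f :: "'a::topological_space \<Rightarrow> 'b::{second_countable_topology, real_normed_field}"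
  assumes "f \<in> borel_measurable borel"
  shows "(\<lambda>ys. prod_list (map f ys)) \<in> borel_measurable borel"
proof (rule measurable_from_list)
  show "(\<lambda>ys. \<Prod>i<n. f (entry i ys)) \<in> borel_measurable borel" for n
    using assms by measurable
  show "prod_list (map f ys) = (\<Prod>i<n. f (entry i ys))" if "length ys = n" for n ys
    using that by (auto simp: prod.list_conv_set_nth atLeast0LessThan entry_def intro!: prod.cong)
qed


text \<open>The preimage of a cylinder is a finite rectangle or empty, and an open set is a
  countable union of cylinders over a countable basis.\<close>

lemma map_upt_measurable:
  assumes M: "sets M = sets borel"
  shows "(\<lambda>\<omega>. map \<omega> [0..<n]) \<in> measurable (\<Pi>\<^sub>M i\<in>{..<n}. M) (borel :: 'a::second_countable_topology list measure)"
proof (rule borel_measurableI)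
  obtain B :: "'a set set" where B: "countable B" "topological_basis B"
    using ex_countable_basis by blast
  fix U :: "'a list set" assume U: "open U"
  have U_eq: "U = (\<Union>Vs\<in>{Vs \<in> lists B. cylinder Vs \<subseteq> U}. cylinder Vs)"
  proof (intro subset_antisym subsetI)
    fix xs assume "xs \<in> U"
    then show "xs \<in> (\<Union>Vs\<in>{Vs \<in> lists B. cylinder Vs \<subseteq> U}. cylinder Vs)"
      using cylinder_refine[OF B(2) U] by blast
  qed auto
  have *: "(\<lambda>\<omega>. map \<omega> [0..<n]) -` cylinder Vs \<inter> space (\<Pi>\<^sub>M i\<in>{..<n}. M) \<in> sets (\<Pi>\<^sub>M i\<in>{..<n}. M)"
    if "Vs \<in> lists B" for Vs
  proof -
    have "Vs ! i \<in> sets M" if "i < length Vs" for i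
      using nth_mem[OF that] \<open>Vs \<in> lists B\<close> topological_basis_open[OF B(2)] M
      by (simp add: lists_eq_set subset_iff)
    then have V: "length Vs = n \<Longrightarrow> (\<Pi>\<^sub>E i\<in>{..<n}. Vs ! i) \<in> sets (\<Pi>\<^sub>M i\<in>{..<n}. M)"
      by (intro sets_PiM_I_finite) auto
    have "space M = UNIV" using sets_eq_imp_space_eq[OF M] by simp
    then have "(\<lambda>\<omega>. map \<omega> [0..<n]) -` cylinder Vs \<inter> space (\<Pi>\<^sub>M i\<in>{..<n}. M) =
        (if length Vs = n then \<Pi>\<^sub>E i\<in>{..<n}. Vs ! i else {})"
      by (auto simp: cylinder_def list_all2_conv_all_nth space_PiM PiE_iff)
    then show ?thesis using V by simp
  qed
  have cnt: "countable {Vs \<in> lists B. cylinder Vs \<subseteq> U}"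
    using B(1) by (intro countable_subset[OF _ countable_lists[OF B(1)]]) auto
  have "(\<lambda>\<omega>. map \<omega> [0..<n]) -` U \<inter> space (\<Pi>\<^sub>M i\<in>{..<n}. M) =
      (\<Union>Vs\<in>{Vs \<in> lists B. cylinder Vs \<subseteq> U}. (\<lambda>\<omega>. map \<omega> [0..<n]) -` cylinder Vs \<inter> space (\<Pi>\<^sub>M i\<in>{..<n}. M))"
    by (subst U_eq) blast
  also have "\<dots> \<in> sets (\<Pi>\<^sub>M i\<in>{..<n}. M)"
    using * cnt by (intro sets.countable_UN') auto
  finally show "(\<lambda>\<omega>. map \<omega> [0..<n]) -` U \<inter> space (\<Pi>\<^sub>M i\<in>{..<n}. M) \<in> sets (\<Pi>\<^sub>M i\<in>{..<n}. M)" .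
qed

lemma map_measurable [measurable]:
  fixes f :: "'a::topological_space \<Rightarrow> 'b::second_countable_topology"
  assumes [measurable]: "f \<in> borel_measurable borel"
  shows "map f \<in> borel_measurable borel"
proof (rule measurable_from_list)
  fix n
  have "(\<lambda>ys. \<lambda>i\<in>{..<n}. f (entry i ys)) \<in> measurable borel (\<Pi>\<^sub>M i\<in>{..<n}. (borel :: 'b measure))"
    by measurable
  from measurable_compose[OF this map_upt_measurable[OF refl]]
  show "(\<lambda>ys. map (\<lambda>i\<in>{..<n}. f (entry i ys)) [0..<n]) \<in> borel_measurable borel" .
  show "map f ys = map (\<lambda>i\<in>{..<n}. f (entry i ys)) [0..<n]" if "length ys = n" for ys
    using that by (auto simp: list_eq_iff_nth_eq entry_def)
qed

lemma all_entries: "(\<forall>y\<in>set ys. P y) \<longleftrightarrow> (\<forall>i. i < length ys \<longrightarrow> P (entry i ys))"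
  by (auto simp: entry_def all_set_conv_all_nth)

lemma sets_list_all [measurable]:
  assumes [measurable]: "S \<in> sets borel"
  shows "{ys. \<forall>y\<in>set ys. y \<in> S} \<in> sets borel"
proof -
  have "{ys \<in> space borel. \<forall>i. i < length ys \<longrightarrow> entry i ys \<in> S} \<in> sets borel"
    by measurable
  then show ?thesis by (simp add: all_entries)
qed

lemma sets_list_hit:
  assumes "S \<in> sets borel"
  shows "{ys. set ys \<inter> S \<noteq> {}} \<in> sets borel"
proof -
  have "{ys. set ys \<inter> S \<noteq> {}} = - {ys. \<forall>y\<in>set ys. y \<in> - S}"
    by auto
  moreover have "{ys. \<forall>y\<in>set ys. y \<in> - S} \<in> sets borel"
    using assms by (intro sets_list_all) auto
  ultimately show ?thesis
    by simp
qed

text \<open>Disjointness is a countable conjunction over pairs of positions, which leaves only the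
  measurability of equality between two entries.\<close>

lemma sets_disjoint_lists:
  "{p. set (fst p) \<inter> set (snd p) = {}} \<in>
    sets (borel \<Otimes>\<^sub>M (borel :: 'a::{second_countable_topology, t2_space} list measure))"
proof -
  have "{p \<in> space (borel \<Otimes>\<^sub>M borel). \<forall>i j. i < length (fst p) \<longrightarrow> j < length (snd p) \<longrightarrow>
      entry i (fst p) \<noteq> entry j (snd p)} \<in> sets (borel \<Otimes>\<^sub>M (borel :: 'a list measure))"
    by measurable
  also have "{p \<in> space (borel \<Otimes>\<^sub>M borel). \<forall>i j. i < length (fst p) \<longrightarrow> j < length (snd p) \<longrightarrow>
      entry i (fst p) \<noteq> entry j (snd p)} = {p :: 'a list \<times> 'a list. set (fst p) \<inter> set (snd p) = {}}"
    by (force simp: disjoint_iff space_pair_measure in_set_conv_nth entry_def)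
  finally show ?thesis .
qed

lemma sets_distinct: "{ys. distinct ys} \<in> sets (borel :: 'a::{second_countable_topology, t2_space} list measure)"
proof -
  have "{ys \<in> space borel. \<forall>i j. i < length ys \<longrightarrow> j < length ys \<longrightarrow> i \<noteq> j \<longrightarrow> entry i ys \<noteq> entry j ys} \<in> sets (borel :: 'a list measure)"
    by measurable
  also have "{ys \<in> space borel. \<forall>i j. i < length ys \<longrightarrow> j < length ys \<longrightarrow> i \<noteq> j \<longrightarrow> entry i ys \<noteq> entry j ys} = {ys :: 'a list. distinct ys}"
    by (auto simp: distinct_conv_nth entry_def)
  finally show ?thesis .
qed

section \<open>The volume on tuples and its transformation\<close>

lemma sets_tuple_volume [simp, measurable_cong]: "sets (tuple_volume M) = sets borel"
  by (simp add: tuple_volume_def)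

lemma space_tuple_volume [simp]: "space (tuple_volume M) = UNIV"
  by (simp add: tuple_volume_def)

lemma nn_integral_superpose:
  assumes m: "\<And>i. i \<in> I \<Longrightarrow> sets (m i) = sets borel" and f: "f \<in> borel_measurable borel"
  shows "(\<integral>\<^sup>+x. f x \<partial>superpose I m) = (\<integral>\<^sup>+i. (\<integral>\<^sup>+x. f x \<partial>m i) \<partial>count_space I)"
  using f
proof (induction rule: borel_measurable_induct)
  case (cong f g)
  then show ?case by (simp cong: nn_integral_cong)
next
  case (set A)
  have "emeasure (m i) A = (\<integral>\<^sup>+x. indicator A x \<partial>m i)" if "i \<in> I" for i
    using set m[OF that] by simp
  then have "(\<integral>\<^sup>+i. emeasure (m i) A \<partial>count_space I) = (\<integral>\<^sup>+i. (\<integral>\<^sup>+x. indicator A x \<partial>m i) \<partial>count_space I)"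
    by (intro nn_integral_cong) simp
  then show ?case using set m by (simp add: emeasure_superpose)
next
  case (mult u c)
  have "u \<in> borel_measurable (m i)" if "i \<in> I" for i
    using mult(2) m[OF that] by (simp cong: measurable_cong_sets)
  moreover have "u \<in> borel_measurable (superpose I m)"
    using mult(2) by (simp cong: measurable_cong_sets)
  moreover have "(\<integral>\<^sup>+i. (\<integral>\<^sup>+x. c * u x \<partial>m i) \<partial>count_space I) = (\<integral>\<^sup>+i. c * (\<integral>\<^sup>+x. u x \<partial>m i) \<partial>count_space I)"
    by (intro nn_integral_cong nn_integral_cmult) (use calculation in auto)
  ultimately show ?case
    using mult by (simp add: nn_integral_cmult)
next
  case (add u v)
  have "u \<in> borel_measurable (m i)" "v \<in> borel_measurable (m i)" if "i \<in> I" for i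
    using add m[OF that] by (simp_all cong: measurable_cong_sets)
  moreover have "u \<in> borel_measurable (superpose I m)" "v \<in> borel_measurable (superpose I m)"
    using add by (simp_all cong: measurable_cong_sets)
  moreover have "(\<integral>\<^sup>+i. (\<integral>\<^sup>+x. v x + u x \<partial>m i) \<partial>count_space I) =
      (\<integral>\<^sup>+i. (\<integral>\<^sup>+x. v x \<partial>m i) + (\<integral>\<^sup>+x. u x \<partial>m i) \<partial>count_space I)"
    by (intro nn_integral_cong nn_integral_add) (use calculation in auto)
  ultimately show ?case
    using add by (simp add: nn_integral_add)
next
  case (seq U)
  have U: "U k \<in> borel_measurable (m i)" if "i \<in> I" for i k
    using seq(1) m[OF that] by (simp cong: measurable_cong_sets)
  have "(\<integral>\<^sup>+x. (SUP k. U k) x \<partial>superpose I m) = (SUP k. \<integral>\<^sup>+x. U k x \<partial>superpose I m)"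
    unfolding SUP_apply using seq by (intro nn_integral_monotone_convergence_SUP) (auto cong: measurable_cong_sets)
  also have "\<dots> = (SUP k. \<integral>\<^sup>+i. (\<integral>\<^sup>+x. U k x \<partial>m i) \<partial>count_space I)"
    using seq by simp
  also have "\<dots> = (\<integral>\<^sup>+i. (SUP k. \<integral>\<^sup>+x. U k x \<partial>m i) \<partial>count_space I)"
    using seq(3) by (intro nn_integral_monotone_convergence_SUP[symmetric])
      (auto simp: incseq_def le_fun_def intro!: nn_integral_mono)
  also have "\<dots> = (\<integral>\<^sup>+i. (\<integral>\<^sup>+x. (SUP k. U k) x \<partial>m i) \<partial>count_space I)"
    unfolding SUP_apply using seq(3) U
    by (intro nn_integral_cong nn_integral_monotone_convergence_SUP[symmetric]) auto
  finally show ?case .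
qed

lemma nn_integral_tuple_volume:
  fixes M :: "'a::second_countable_topology measure"
  assumes M: "sets M = sets borel" and f: "f \<in> borel_measurable borel"
  shows "(\<integral>\<^sup>+ys. f ys \<partial>tuple_volume M) = (\<Sum>n. \<integral>\<^sup>+\<omega>. f (map \<omega> [0..<n]) \<partial>(\<Pi>\<^sub>M i\<in>{..<n}. M))"
  unfolding tuple_volume_def
  by (simp add: nn_integral_superpose f nn_integral_count_space_nat nn_integral_distr[OF map_upt_measurable[OF M]])

lemma AE_tuple_volume:
  fixes M :: "'a::second_countable_topology measure"
  assumes M: "sets M = sets borel" and P: "{ys. P ys} \<in> sets borel"
    and AE: "\<And>n. AE \<omega> in (\<Pi>\<^sub>M i\<in>{..<n}. M). P (map \<omega> [0..<n])"
  shows "AE ys in tuple_volume M. P ys"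
proof -
  have N: "{ys. \<not> P ys} \<in> sets borel"
    using sets.compl_sets[OF P] by (simp add: Compl_eq_Diff_UNIV[symmetric] Collect_neg_eq)
  have "emeasure (tuple_volume M) {ys. \<not> P ys} = (\<integral>\<^sup>+ys. indicator {ys. \<not> P ys} ys \<partial>tuple_volume M)"
    using N by simp
  also have "\<dots> = (\<Sum>n. \<integral>\<^sup>+\<omega>. indicator {ys. \<not> P ys} (map \<omega> [0..<n]) \<partial>(\<Pi>\<^sub>M i\<in>{..<n}. M))"
    using N by (intro nn_integral_tuple_volume[OF M]) auto
  also have "\<dots> = (\<Sum>n::nat. 0)"
  proof (intro suminf_cong)
    fix n
    have "AE \<omega> in (\<Pi>\<^sub>M i\<in>{..<n}. M). indicator {ys. \<not> P ys} (map \<omega> [0..<n]) = (0 :: ennreal)"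
      using AE[of n] by eventually_elim simp
    then have "(\<integral>\<^sup>+\<omega>. indicator {ys. \<not> P ys} (map \<omega> [0..<n]) \<partial>(\<Pi>\<^sub>M i\<in>{..<n}. M)) =
        (\<integral>\<^sup>+\<omega>. 0 \<partial>(\<Pi>\<^sub>M i\<in>{..<n}. M))"
      by (rule nn_integral_cong_AE)
    then show "(\<integral>\<^sup>+\<omega>. indicator {ys. \<not> P ys} (map \<omega> [0..<n]) \<partial>(\<Pi>\<^sub>M i\<in>{..<n}. M)) = 0" by simp
  qed
  finally show ?thesis
    using N by (intro AE_I[of _ _ "{ys. \<not> P ys}"]) auto
qed

text \<open>For each length and each position, the tuples with entry \<open>x\<close> there form a
  rectangle with one null factor.\<close>

lemma AE_tuple_volume_avoids:
  fixes M :: "'a::{second_countable_topology, t2_space} measure"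
  assumes M: "sets M = sets borel" and \<sigma>: "sigma_finite_measure M" and atom: "emeasure M {x} = 0"
  shows "AE ys in tuple_volume M. x \<notin> set ys"
proof (rule AE_tuple_volume[OF M])
  have "{ys. \<forall>y\<in>set ys. y \<in> - {x}} \<in> sets borel"
    by (intro sets_list_all) auto
  also have "{ys. \<forall>y\<in>set ys. y \<in> - {x}} = {ys. x \<notin> set ys}" by auto
  finally show "{ys. x \<notin> set ys} \<in> sets borel" .
  fix n :: nat
  interpret product_sigma_finite "\<lambda>_::nat. M" using \<sigma> by (simp add: product_sigma_finite_def)
  have sM: "space M = UNIV" using sets_eq_imp_space_eq[OF M] by simp
  have "AE \<omega> in (\<Pi>\<^sub>M i\<in>{..<n}. M). \<omega> i \<noteq> x" if i: "i < n" for i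
  proof (rule AE_I)
    let ?E = "\<Pi>\<^sub>E j\<in>{..<n}. (if j = i then {x} else UNIV)"
    show "{\<omega> \<in> space (\<Pi>\<^sub>M i\<in>{..<n}. M). \<not> \<omega> i \<noteq> x} \<subseteq> ?E"
      by (auto simp: space_PiM PiE_iff sM extensional_def)
    show "?E \<in> sets (\<Pi>\<^sub>M i\<in>{..<n}. M)"
      using M by (intro sets_PiM_I_finite) auto
    show "emeasure (\<Pi>\<^sub>M i\<in>{..<n}. M) ?E = 0"
      using M i atom by (subst emeasure_PiM) (auto intro!: prod_zero bexI[of _ i])
  qed
  then have "AE \<omega> in (\<Pi>\<^sub>M i\<in>{..<n}. M). \<forall>i\<in>{..<n}. \<omega> i \<noteq> x"
    by (intro AE_finite_allI) auto
  then show "AE \<omega> in (\<Pi>\<^sub>M i\<in>{..<n}. M). x \<notin> set (map \<omega> [0..<n])"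
    by eventually_elim auto
qed

text \<open>Fubini in the coordinate \<open>i\<close>: with the other coordinates fixed, equality
  with coordinate \<open>j\<close> confines coordinate \<open>i\<close> to a single point, which is
  null.\<close>

lemma AE_tuple_volume_distinct:
  fixes M :: "'a::{second_countable_topology, t2_space} measure"
  assumes M: "sets M = sets borel" and \<sigma>: "sigma_finite_measure M" and atom: "\<And>x. emeasure M {x} = 0"
  shows "AE ys in tuple_volume M. distinct ys"
proof (rule AE_tuple_volume[OF M sets_distinct])
  fix n :: nat
  interpret product_sigma_finite "\<lambda>_::nat. M" using \<sigma> by (simp add: product_sigma_finite_def)
  have [measurable_cong]: "sets M = sets borel" by (rule M)
  have sM: "space M = UNIV" using sets_eq_imp_space_eq[OF M] by simp
  have ne: "AE \<omega> in (\<Pi>\<^sub>M i\<in>{..<n}. M). \<omega> i \<noteq> \<omega> j" if i: "i < n" "j < n" "i \<noteq> j" for i j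
  proof -
    let ?I = "{..<n} - {i}"
    have ins: "insert i ?I = {..<n}" using i by auto
    let ?N = "{\<omega> \<in> space (\<Pi>\<^sub>M i\<in>{..<n}. M). \<omega> i = \<omega> j}"
    have [measurable]: "(\<lambda>\<omega>. \<omega> i) \<in> measurable (\<Pi>\<^sub>M i\<in>{..<n}. M) borel" "(\<lambda>\<omega>. \<omega> j) \<in> measurable (\<Pi>\<^sub>M i\<in>{..<n}. M) borel"
      using i M measurable_component_singleton[of i "{..<n}" "\<lambda>_. M"] measurable_component_singleton[of j "{..<n}" "\<lambda>_. M"]
      by (auto cong: measurable_cong_sets)
    have N: "?N \<in> sets (\<Pi>\<^sub>M i\<in>{..<n}. M)" by measurable
    have "emeasure (\<Pi>\<^sub>M i\<in>{..<n}. M) ?N = (\<integral>\<^sup>+\<omega>. indicator ?N \<omega> \<partial>(\<Pi>\<^sub>M i\<in>insert i ?I. M))"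
      using N unfolding ins by simp
    also have "\<dots> = (\<integral>\<^sup>+\<omega>. integral\<^sup>N M (\<lambda>y. indicator ?N (fun_upd \<omega> i y)) \<partial>(\<Pi>\<^sub>M i\<in>?I. M))"
      using N by (intro product_nn_integral_insert) (simp_all only: ins borel_measurable_indicator finite_Diff finite_lessThan, simp)
    also have "\<dots> = (\<integral>\<^sup>+\<omega>. 0 \<partial>(\<Pi>\<^sub>M i\<in>?I. M))"
    proof (intro nn_integral_cong)
      fix \<omega>
      have "integral\<^sup>N M (\<lambda>y. indicator ?N (fun_upd \<omega> i y)) \<le> (\<integral>\<^sup>+y. indicator {\<omega> j} y \<partial>M)"
        using i by (intro nn_integral_mono) (auto split: split_indicator)
      also have "\<dots> = 0" using M atom by simp
      finally show "integral\<^sup>N M (\<lambda>y. indicator ?N (fun_upd \<omega> i y)) = 0" by simp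
    qed
    finally show ?thesis using N by (intro AE_I[of _ _ ?N]) auto
  qed
  have "AE \<omega> in (\<Pi>\<^sub>M i\<in>{..<n}. M). \<forall>i\<in>{..<n}. \<forall>j\<in>{..<n} - {i}. \<omega> i \<noteq> \<omega> j"
    using ne by (intro AE_finite_allI) auto
  then show "AE \<omega> in (\<Pi>\<^sub>M i\<in>{..<n}. M). distinct (map \<omega> [0..<n])"
    by eventually_elim (auto simp: distinct_conv_nth)
qed

text \<open>Both sides are the product of the measures \<open>density M w\<close>, as is checked on
  rectangles. Finiteness of \<open>w\<close> keeps these densities sigma-finite, which makes the
  comparison on rectangles sufficient.\<close>

lemma distr_PiM_density:
  assumes \<sigma>: "sigma_finite_measure M" and I: "finite I"
    and w: "w \<in> borel_measurable M" "\<And>x. w x \<noteq> (\<infinity>::ennreal)"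
    and \<phi>: "\<phi> \<in> measurable M M" and eq: "distr M M \<phi> = density M w"
  shows "distr (\<Pi>\<^sub>M i\<in>I. M) (\<Pi>\<^sub>M i\<in>I. M) (\<lambda>\<omega>. \<lambda>i\<in>I. \<phi> (\<omega> i)) = density (\<Pi>\<^sub>M i\<in>I. M) (\<lambda>\<omega>. \<Prod>i\<in>I. w (\<omega> i))"
proof -
  interpret M: sigma_finite_measure M by fact
  interpret P: product_sigma_finite "\<lambda>_. M" using \<sigma> by (simp add: product_sigma_finite_def)
  interpret Q: product_sigma_finite "\<lambda>_. density M w"
    using w by (simp add: product_sigma_finite_def M.sigma_finite_iff_density_finite)
  have m[measurable]: "(\<lambda>\<omega>. \<lambda>i\<in>I. \<phi> (\<omega> i)) \<in> measurable (\<Pi>\<^sub>M i\<in>I. M) (\<Pi>\<^sub>M i\<in>I. M)"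
    using \<phi> by measurable
  have sets: "sets (\<Pi>\<^sub>M i\<in>I. density M w) = sets (\<Pi>\<^sub>M i\<in>I. M)"
    by (intro sets_PiM_cong) auto
  note [measurable] = w(1) \<phi>
  have "distr (\<Pi>\<^sub>M i\<in>I. M) (\<Pi>\<^sub>M i\<in>I. M) (\<lambda>\<omega>. \<lambda>i\<in>I. \<phi> (\<omega> i)) = (\<Pi>\<^sub>M i\<in>I. density M w)"
  proof (rule Q.PiM_eqI[OF I])
    fix B assume "\<And>i. i \<in> I \<Longrightarrow> B i \<in> sets (density M w)"
    then have B[measurable]: "\<And>i. i \<in> I \<Longrightarrow> B i \<in> sets M" by simp
    have E: "Pi\<^sub>E I B \<in> sets (\<Pi>\<^sub>M i\<in>I. M)" using B I by (intro sets_PiM_I_finite) auto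
    have "emeasure (distr (\<Pi>\<^sub>M i\<in>I. M) (\<Pi>\<^sub>M i\<in>I. M) (\<lambda>\<omega>. \<lambda>i\<in>I. \<phi> (\<omega> i))) (Pi\<^sub>E I B) =
        emeasure (\<Pi>\<^sub>M i\<in>I. M) (\<Pi>\<^sub>E i\<in>I. \<phi> -` B i \<inter> space M)"
      using E by (subst emeasure_distr) (auto simp: space_PiM PiE_iff intro!: arg_cong2[where f = emeasure])
    also have "\<dots> = (\<Prod>i\<in>I. emeasure M (\<phi> -` B i \<inter> space M))"
      using I B measurable_sets[OF \<phi>] by (intro P.emeasure_PiM) auto
    also have "\<dots> = (\<Prod>i\<in>I. emeasure (density M w) (B i))"
      unfolding eq[symmetric] using B by (intro prod.cong) (auto simp: emeasure_distr)
    finally show "emeasure (distr (\<Pi>\<^sub>M i\<in>I. M) (\<Pi>\<^sub>M i\<in>I. M) (\<lambda>\<omega>. \<lambda>i\<in>I. \<phi> (\<omega> i))) (Pi\<^sub>E I B) =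
        (\<Prod>i\<in>I. emeasure (density M w) (B i))" .
  qed (simp add: sets)
  also have "\<dots> = density (\<Pi>\<^sub>M i\<in>I. M) (\<lambda>\<omega>. \<Prod>i\<in>I. w (\<omega> i))"
  proof (rule Q.PiM_eqI[OF I, symmetric])
    fix B assume "\<And>i. i \<in> I \<Longrightarrow> B i \<in> sets (density M w)"
    then have B[measurable]: "\<And>i. i \<in> I \<Longrightarrow> B i \<in> sets M" by simp
    have E: "Pi\<^sub>E I B \<in> sets (\<Pi>\<^sub>M i\<in>I. M)" using B I by (intro sets_PiM_I_finite) auto
    have "emeasure (density (\<Pi>\<^sub>M i\<in>I. M) (\<lambda>\<omega>. \<Prod>i\<in>I. w (\<omega> i))) (Pi\<^sub>E I B) =
        (\<integral>\<^sup>+\<omega>. (\<Prod>i\<in>I. w (\<omega> i)) * indicator (Pi\<^sub>E I B) \<omega> \<partial>(\<Pi>\<^sub>M i\<in>I. M))"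
      using E by (subst emeasure_density) auto
    also have "\<dots> = (\<integral>\<^sup>+\<omega>. (\<Prod>i\<in>I. w (\<omega> i) * indicator (B i) (\<omega> i)) \<partial>(\<Pi>\<^sub>M i\<in>I. M))"
    proof (intro nn_integral_cong)
      fix \<omega> assume "\<omega> \<in> space (\<Pi>\<^sub>M i\<in>I. M)"
      then have "indicator (Pi\<^sub>E I B) \<omega> = (\<Prod>i\<in>I. indicator (B i) (\<omega> i) :: ennreal)"
        using I by (auto simp: space_PiM PiE_iff indicator_def intro!: prod.neutral[symmetric] prod_zero[symmetric])
      then show "(\<Prod>i\<in>I. w (\<omega> i)) * indicator (Pi\<^sub>E I B) \<omega> = (\<Prod>i\<in>I. w (\<omega> i) * indicator (B i) (\<omega> i))"
        by (simp add: prod.distrib)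
    qed
    also have "\<dots> = (\<Prod>i\<in>I. \<integral>\<^sup>+x. w x * indicator (B i) x \<partial>M)"
      using I by (intro P.product_nn_integral_prod) auto
    also have "\<dots> = (\<Prod>i\<in>I. emeasure (density M w) (B i))"
      using B by (intro prod.cong) (auto simp: emeasure_density)
    finally show "emeasure (density (\<Pi>\<^sub>M i\<in>I. M) (\<lambda>\<omega>. \<Prod>i\<in>I. w (\<omega> i))) (Pi\<^sub>E I B) =
        (\<Prod>i\<in>I. emeasure (density M w) (B i))" .
  qed (simp add: sets)
  finally show ?thesis .
qed

text \<open>The claim is split by length; on tuples of length \<open>n\<close> it is the product
  formula for \<open>n\<close> identical factors.\<close>

lemma distr_tuple_volume:
  fixes M :: "'a::second_countable_topology measure" and w :: "'a \<Rightarrow> real"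
  assumes M: "sets M = sets borel" and \<sigma>: "sigma_finite_measure M"
    and \<phi>[measurable]: "\<phi> \<in> borel_measurable borel" and w[measurable]: "w \<in> borel_measurable borel" "\<And>x. 0 \<le> w x"
    and eq: "distr M borel \<phi> = density M (\<lambda>x. ennreal (w x))"
  shows "distr (tuple_volume M) borel (map \<phi>) = density (tuple_volume M) (\<lambda>ys. ennreal (prod_list (map w ys)))"
proof (rule measure_eqI)
  have sM: "space M = UNIV" using sets_eq_imp_space_eq[OF M] by simp
  have [measurable_cong]: "sets M = sets borel" by (rule M)
  fix B assume "B \<in> sets (distr (tuple_volume M) borel (map \<phi>))"
  then have B[measurable]: "B \<in> sets borel" by simp
  have mB: "(\<lambda>ys. indicator B ys :: ennreal) \<in> borel_measurable borel" by measurable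
  have "emeasure (distr (tuple_volume M) borel (map \<phi>)) B = (\<integral>\<^sup>+ys. indicator B (map \<phi> ys) \<partial>tuple_volume M)"
    by (subst nn_integral_distr[symmetric, of _ _ borel]) auto
  also have "\<dots> = (\<Sum>n. \<integral>\<^sup>+\<omega>. indicator B (map \<phi> (map \<omega> [0..<n])) \<partial>(\<Pi>\<^sub>M i\<in>{..<n}. M))"
    by (intro nn_integral_tuple_volume[OF M]) measurable
  also have "\<dots> = (\<Sum>n. \<integral>\<^sup>+\<omega>. ennreal (prod_list (map w (map \<omega> [0..<n]))) * indicator B (map \<omega> [0..<n]) \<partial>(\<Pi>\<^sub>M i\<in>{..<n}. M))"
  proof (intro suminf_cong)
    fix n :: nat
    let ?P = "\<Pi>\<^sub>M i\<in>{..<n}. M"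
    have mu: "(\<lambda>\<omega>. map \<omega> [0..<n]) \<in> measurable ?P borel" by (rule map_upt_measurable[OF M])
    have mw: "(\<lambda>\<omega>. \<Prod>i<n. ennreal (w (\<omega> i))) \<in> borel_measurable ?P" by measurable
    have m\<phi>: "(\<lambda>\<omega>. \<lambda>i\<in>{..<n}. \<phi> (\<omega> i)) \<in> measurable ?P ?P" by measurable
    have "(\<integral>\<^sup>+\<omega>. indicator B (map \<phi> (map \<omega> [0..<n])) \<partial>?P) = (\<integral>\<^sup>+\<omega>. indicator B (map (\<lambda>i\<in>{..<n}. \<phi> (\<omega> i)) [0..<n]) \<partial>?P)"
      by (intro nn_integral_cong arg_cong[where f = "indicator B"]) simp
    also have "\<dots> = (\<integral>\<^sup>+\<omega>. indicator B (map \<omega> [0..<n]) \<partial>distr ?P ?P (\<lambda>\<omega>. \<lambda>i\<in>{..<n}. \<phi> (\<omega> i)))"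
      by (intro nn_integral_distr[symmetric] m\<phi> measurable_compose[OF mu mB, simplified o_def] | simp)+
    also have "\<dots> = (\<integral>\<^sup>+\<omega>. indicator B (map \<omega> [0..<n]) \<partial>density ?P (\<lambda>\<omega>. \<Prod>i<n. ennreal (w (\<omega> i))))"
      using eq by (subst distr_PiM_density[OF \<sigma>]) (auto cong: distr_cong simp: M distr_cong[OF refl M refl])
    also have "\<dots> = (\<integral>\<^sup>+\<omega>. (\<Prod>i<n. ennreal (w (\<omega> i))) * indicator B (map \<omega> [0..<n]) \<partial>?P)"
      by (intro nn_integral_density mw measurable_compose[OF mu mB])
    also have "\<dots> = (\<integral>\<^sup>+\<omega>. ennreal (prod_list (map w (map \<omega> [0..<n]))) * indicator B (map \<omega> [0..<n]) \<partial>?P)"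
      using w(2) by (intro nn_integral_cong)
        (simp add: prod.list_conv_set_nth atLeast0LessThan prod_ennreal)
    finally show "(\<integral>\<^sup>+\<omega>. indicator B (map \<phi> (map \<omega> [0..<n])) \<partial>?P) =
        (\<integral>\<^sup>+\<omega>. ennreal (prod_list (map w (map \<omega> [0..<n]))) * indicator B (map \<omega> [0..<n]) \<partial>?P)" .
  qed
  also have "\<dots> = (\<integral>\<^sup>+ys. ennreal (prod_list (map w ys)) * indicator B ys \<partial>tuple_volume M)"
    by (intro nn_integral_tuple_volume[OF M, symmetric]) measurable
  also have "\<dots> = emeasure (density (tuple_volume M) (\<lambda>ys. ennreal (prod_list (map w ys)))) B"
    by (subst emeasure_density) auto
  finally show "emeasure (distr (tuple_volume M) borel (map \<phi>)) B =
      emeasure (density (tuple_volume M) (\<lambda>ys. ennreal (prod_list (map w ys)))) B" .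
qed simp

text \<open>Moving by \<open>F\<close> replaces the density \<open>h\<close> by its composition with
  the inverse, times \<open>w\<close>; dividing by \<open>h\<close> turns this into a density
  relative to the original measure. The division is legitimate because both values of
  \<open>h\<close> are positive almost everywhere; the value 1 of \<open>\<rho>\<close> elsewhere
  concerns a null set.\<close>

lemma distr_density_bij:
  fixes h w :: "'a \<Rightarrow> real"
  assumes F[measurable]: "F \<in> measurable V V" and F'[measurable]: "F' \<in> measurable V V"
    and inv: "\<And>x. F' (F x) = x"
    and w[measurable]: "w \<in> borel_measurable V" and w_pos: "\<And>x. 0 < w x"
    and h[measurable]: "h \<in> borel_measurable V" and h_nonneg: "\<And>x. 0 \<le> h x" and h_pos: "AE x in V. 0 < h x"
    and eq: "distr V V F = density V (\<lambda>x. ennreal (w x))"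
  defines "\<rho> \<equiv> \<lambda>y. if h y = 0 \<or> h (F' y) = 0 then 1 else h (F' y) / h y * w y"
  shows "distr (density V (\<lambda>x. ennreal (h x))) V F = density (density V (\<lambda>x. ennreal (h x))) (\<lambda>x. ennreal (\<rho> x))"
proof (rule measure_eqI)
  have \<rho>m[measurable]: "\<rho> \<in> borel_measurable V" unfolding \<rho>_def by measurable
  \<comment> \<open>Positivity is pulled through the image measure; as \<open>w\<close> is positive,
    that measure has the same null sets as \<open>V\<close>.\<close>
  have "AE x in V. 0 < h (F' (F x))" using h_pos by (simp add: inv)
  then have "AE y in distr V V F. 0 < h (F' y)"
    by (subst AE_distr_iff) measurable
  then have "AE y in V. 0 < ennreal (w y) \<longrightarrow> 0 < h (F' y)"
    unfolding eq by (subst (asm) AE_density) auto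
  then have pos': "AE y in V. 0 < h (F' y)"
    using w_pos by simp
  fix B assume "B \<in> sets (distr (density V (\<lambda>x. ennreal (h x))) V F)"
  then have B[measurable]: "B \<in> sets V" by simp
  have "emeasure (distr (density V (\<lambda>x. ennreal (h x))) V F) B = (\<integral>\<^sup>+x. indicator B (F x) \<partial>density V (\<lambda>x. ennreal (h x)))"
    by (subst nn_integral_distr[symmetric, of _ _ V]) auto
  also have "\<dots> = (\<integral>\<^sup>+x. ennreal (h x) * indicator B (F x) \<partial>V)"
    by (subst nn_integral_density) auto
  also have "\<dots> = (\<integral>\<^sup>+y. ennreal (h (F' y)) * indicator B y \<partial>distr V V F)"
    by (subst nn_integral_distr) (auto simp: inv)
  also have "\<dots> = (\<integral>\<^sup>+y. ennreal (w y) * (ennreal (h (F' y)) * indicator B y) \<partial>V)"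
    unfolding eq by (subst nn_integral_density) auto
  also have "\<dots> = (\<integral>\<^sup>+y. ennreal (h y) * (ennreal (\<rho> y) * indicator B y) \<partial>V)"
  proof (rule nn_integral_cong_AE)
    show "AE y in V. ennreal (w y) * (ennreal (h (F' y)) * indicator B y) = ennreal (h y) * (ennreal (\<rho> y) * indicator B y)"
      using h_pos pos'
    proof eventually_elim
      case (elim y)
      then have "w y * h (F' y) = h y * \<rho> y" by (simp add: \<rho>_def)
      then have "ennreal (w y) * ennreal (h (F' y)) = ennreal (h y) * ennreal (\<rho> y)"
        using elim w_pos[of y] by (simp add: \<rho>_def less_imp_le flip: ennreal_mult)
      then show ?case by (simp add: mult.assoc[symmetric])
    qed
  qed
  also have "\<dots> = (\<integral>\<^sup>+y. ennreal (\<rho> y) * indicator B y \<partial>density V (\<lambda>x. ennreal (h x)))"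
    by (subst nn_integral_density) auto
  also have "\<dots> = emeasure (density (density V (\<lambda>x. ennreal (h x))) (\<lambda>x. ennreal (\<rho> x))) B"
    by (subst emeasure_density[of _ "density V (\<lambda>x. ennreal (h x))"]) auto
  finally show "emeasure (distr (density V (\<lambda>x. ennreal (h x))) V F) B =
      emeasure (density (density V (\<lambda>x. ennreal (h x))) (\<lambda>x. ennreal (\<rho> x))) B" .
qed simp

section \<open>Configuration spaces\<close>

lemma sets_dirac_sum [simp, measurable_cong]: "sets (dirac_sum I s) = sets borel"
  by (simp add: dirac_sum_def)

lemma space_dirac_sum [simp]: "space (dirac_sum I s) = UNIV"
  by (simp add: dirac_sum_def)

lemma emeasure_dirac_sum:
  "B \<in> sets borel \<Longrightarrow> emeasure (dirac_sum I s) B = emeasure (count_space I) {i \<in> I. s i \<in> B}"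
  unfolding dirac_sum_def by (subst emeasure_distr) (auto intro!: arg_cong2[where f = emeasure])

lemma nn_integral_dirac_sum:
  "f \<in> borel_measurable borel \<Longrightarrow> (\<integral>\<^sup>+x. f x \<partial>dirac_sum I s) = (\<integral>\<^sup>+i. f (s i) \<partial>count_space I)"
  unfolding dirac_sum_def by (subst nn_integral_distr) auto

lemma dirac_sum_reindex:
  assumes "bij_betw g J I"
  shows "dirac_sum I s = dirac_sum J (s \<circ> g)"
proof -
  have "dirac_sum I s = distr (distr (count_space J) (count_space I) g) borel s"
    by (simp add: dirac_sum_def distr_bij_count_space[OF assms])
  also have "\<dots> = distr (count_space J) borel (s \<circ> g)"
    using assms by (intro distr_distr) (auto simp: bij_betw_def)
  finally show ?thesis by (simp add: dirac_sum_def)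
qed

lemma dirac_sum_in_configurations:
  assumes "countable I"
  shows "dirac_sum I s \<in> configurations"
proof -
  have "bij_betw (from_nat_into I) (to_nat_on I ` I) I"
    by (rule bij_betw_byWitness[where f' = "to_nat_on I"]) (auto simp: assms)
  from dirac_sum_reindex[OF this, of s] show ?thesis
    unfolding configurations_def by blast
qed

lemma configurationsE:
  assumes "\<gamma> \<in> configurations"
  obtains I :: "nat set" and s where "\<gamma> = dirac_sum I s"
  using assms by (auto simp: configurations_def)

lemma sets_configuration: "\<gamma> \<in> configurations \<Longrightarrow> sets \<gamma> = sets borel"
  by (auto elim!: configurationsE)

lemma emeasure_dirac_sum_singleton:
  fixes s :: "'i \<Rightarrow> 'a::t1_space"
  shows "emeasure (dirac_sum I s) {x} = emeasure (count_space I) {i \<in> I. s i = x}"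
  by (subst emeasure_dirac_sum) auto

lemma points_dirac_sum:
  fixes s :: "'i \<Rightarrow> 'a::t1_space"
  shows "points (dirac_sum I s) = s ` I"
proof -
  have "emeasure (dirac_sum I s) {x} \<noteq> 0 \<longleftrightarrow> x \<in> s ` I" for x
    by (subst emeasure_dirac_sum_singleton, subst emeasure_count_space_eq_0) auto
  then show ?thesis by (auto simp: points_def)
qed

text \<open>Two indices with the same value would put mass at least 2 on it.\<close>

lemma simple_dirac_sum_inj:
  fixes s :: "'i \<Rightarrow> 'a::t1_space"
  assumes "\<And>x. emeasure (dirac_sum I s) {x} \<le> 1"
  shows "inj_on s I"
proof (rule inj_onI)
  fix i j assume ij: "i \<in> I" "j \<in> I" "s i = s j"
  show "i = j"
  proof (rule ccontr)
    assume "i \<noteq> j"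
    have "emeasure (count_space I) {i, j} \<le> emeasure (count_space I) {k \<in> I. s k = s i}"
      using ij by (intro emeasure_mono) auto
    also have "\<dots> \<le> 1"
      using assms[of "s i"] by (simp add: emeasure_dirac_sum_singleton)
    finally show False
      using ij \<open>i \<noteq> j\<close> by (simp add: emeasure_count_space)
  qed
qed

text \<open>Simplicity makes the indexing injective, so the points can serve as their own index set.
  Integrals over a proper configuration thereby become sums over
  \<open>points \<gamma>\<close>.\<close>

lemma proper_eq_dirac_sum:
  fixes \<gamma> :: "'a::t1_space measure"
  assumes "\<gamma> \<in> proper_configurations"
  shows "countable (points \<gamma>)" "\<gamma> = dirac_sum (points \<gamma>) (\<lambda>x. x)"
proof -
  obtain I s where \<gamma>: "\<gamma> = dirac_sum (I :: nat set) s"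
    using assms by (auto simp: proper_configurations_def elim: configurationsE)
  then have "inj_on s I"
    using assms by (intro simple_dirac_sum_inj) (auto simp: proper_configurations_def)
  then have bij: "bij_betw s I (points \<gamma>)"
    unfolding \<gamma> points_dirac_sum by (simp add: bij_betw_def)
  show "countable (points \<gamma>)" by (simp add: \<gamma> points_dirac_sum)
  show "\<gamma> = dirac_sum (points \<gamma>) (\<lambda>x. x)"
    using dirac_sum_reindex[OF bij, of "\<lambda>x. x"] by (simp add: \<gamma> o_def)
qed

lemma emeasure_proper:
  fixes \<gamma> :: "'a::t1_space measure"
  assumes "\<gamma> \<in> proper_configurations" "B \<in> sets borel"
  shows "emeasure \<gamma> B = emeasure (count_space UNIV) (points \<gamma> \<inter> B)"
  using assms(2) by (subst proper_eq_dirac_sum(2)[OF assms(1)], subst emeasure_dirac_sum)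
    (auto simp: emeasure_count_space Int_def)

lemma nn_integral_proper:
  fixes \<gamma> :: "'a::t1_space measure"
  assumes "\<gamma> \<in> proper_configurations" "f \<in> borel_measurable borel"
  shows "(\<integral>\<^sup>+x. f x \<partial>\<gamma>) = (\<integral>\<^sup>+x. f x \<partial>count_space (points \<gamma>))"
  using assms(2) by (subst proper_eq_dirac_sum(2)[OF assms(1)], subst nn_integral_dirac_sum) auto

lemma finite_points_compact:
  fixes \<gamma> :: "'a::t2_space measure"
  assumes "\<gamma> \<in> proper_configurations" "compact K"
  shows "finite (points \<gamma> \<inter> K)"
proof -
  have "emeasure \<gamma> K < \<infinity>" using assms by (auto simp: proper_configurations_def)
  then show ?thesis
    using emeasure_proper[OF assms(1), of K] compact_imp_closed[OF assms(2)]
    by (auto simp: emeasure_count_space split: if_splits)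
qed

lemma dirac_sum_proper:
  fixes s :: "'i \<Rightarrow> 'a::t2_space"
  assumes "countable I" "inj_on s I" "\<And>K. compact K \<Longrightarrow> finite {i \<in> I. s i \<in> K}"
  shows "dirac_sum I s \<in> proper_configurations"
proof -
  have "emeasure (dirac_sum I s) {x} \<le> 1" for x
  proof -
    have "{i \<in> I. s i = x} \<subseteq> {inv_into I s x}"
      using assms(2) by auto
    then have "finite {i \<in> I. s i = x}" "card {i \<in> I. s i = x} \<le> 1"
      by (auto intro: finite_subset dest: card_mono[rotated])
    then show ?thesis by (simp add: emeasure_dirac_sum_singleton emeasure_count_space)
  qed
  then show ?thesis
    using assms dirac_sum_in_configurations[OF assms(1), of s]
    by (auto simp: proper_configurations_def emeasure_dirac_sum compact_imp_closed emeasure_count_space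
        of_nat_less_top)
qed

text \<open>The dependent sum is extended by zero to a rectangle over a common countable index set,
  where Tonelli applies.\<close>

lemma nn_integral_count_space_Sigma:
  fixes f :: "'i \<Rightarrow> 'j \<Rightarrow> ennreal"
  assumes "countable I" "\<And>i. i \<in> I \<Longrightarrow> countable (J i)"
  shows "(\<integral>\<^sup>+(i, j). f i j \<partial>count_space (Sigma I J)) = (\<integral>\<^sup>+i. (\<integral>\<^sup>+j. f i j \<partial>count_space (J i)) \<partial>count_space I)"
proof -
  define K where "K = (\<Union>i\<in>I. J i)"
  have K: "countable K" using assms by (simp add: K_def)
  let ?g = "\<lambda>(i, j). f i j * indicator (J i) j"
  have "(\<integral>\<^sup>+(i, j). f i j \<partial>count_space (Sigma I J)) = (\<integral>\<^sup>+p. ?g p \<partial>count_space (Sigma I J))"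
    by (intro nn_integral_cong) auto
  also have "\<dots> = (\<integral>\<^sup>+p. ?g p \<partial>count_space (I \<times> K))"
    by (intro nn_integral_count_space_eq) (auto simp: K_def indicator_def)
  also have "\<dots> = (\<integral>\<^sup>+p. ?g p \<partial>(count_space I \<Otimes>\<^sub>M count_space K))"
    using assms K by (simp add: pair_measure_countable)
  also have "\<dots> = (\<integral>\<^sup>+i. (\<integral>\<^sup>+j. f i j * indicator (J i) j \<partial>count_space K) \<partial>count_space I)"
  proof -
    interpret sigma_finite_measure "count_space K" using K by (rule sigma_finite_measure_count_space_countable)
    have "?g \<in> borel_measurable (count_space I \<Otimes>\<^sub>M count_space K)"
      using assms K by (subst pair_measure_countable) auto
    from nn_integral_fst[OF this] show ?thesis by simp
  qed
  also have "\<dots> = (\<integral>\<^sup>+i. (\<integral>\<^sup>+j. f i j \<partial>count_space (J i)) \<partial>count_space I)"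
  proof (intro nn_integral_cong)
    fix i assume "i \<in> space (count_space I)"
    then have "(\<integral>\<^sup>+j. f i j * indicator (J i) j \<partial>count_space K) = (\<integral>\<^sup>+j. f i j * indicator (J i) j \<partial>count_space (J i))"
      by (intro nn_integral_count_space_eq) (auto simp: K_def indicator_def)
    also have "\<dots> = (\<integral>\<^sup>+j. f i j \<partial>count_space (J i))"
      by (intro nn_integral_cong) auto
    finally show "(\<integral>\<^sup>+j. f i j * indicator (J i) j \<partial>count_space K) = (\<integral>\<^sup>+j. f i j \<partial>count_space (J i))" .
  qed
  finally show ?thesis .
qed

lemma superpose_dirac_sums:
  fixes s :: "'i \<Rightarrow> 'j \<Rightarrow> 'a::topological_space"
  assumes "countable I" "\<And>i. i \<in> I \<Longrightarrow> countable (J i)" "\<And>i. i \<in> I \<Longrightarrow> m i = dirac_sum (J i) (s i)"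
  shows "superpose I m = dirac_sum (Sigma I J) (\<lambda>(i, j). s i j)"
proof (rule measure_eqI)
  fix B assume "B \<in> sets (superpose I m)"
  then have B: "B \<in> sets borel" by simp
  have "emeasure (superpose I m) B = (\<integral>\<^sup>+i. emeasure (m i) B \<partial>count_space I)"
    using assms B by (intro emeasure_superpose) auto
  also have "\<dots> = (\<integral>\<^sup>+i. (\<integral>\<^sup>+j. indicator B (s i j) \<partial>count_space (J i)) \<partial>count_space I)"
    using assms B by (intro nn_integral_cong) (simp flip: nn_integral_dirac_sum)
  also have "\<dots> = (\<integral>\<^sup>+(i, j). indicator B (s i j) \<partial>count_space (Sigma I J))"
    by (rule nn_integral_count_space_Sigma[symmetric]) (use assms in auto)
  also have "\<dots> = (\<integral>\<^sup>+p. indicator B p \<partial>dirac_sum (Sigma I J) (\<lambda>(i, j). s i j))"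
    using B by (subst nn_integral_dirac_sum) (auto simp: split_beta')
  also have "\<dots> = emeasure (dirac_sum (Sigma I J) (\<lambda>(i, j). s i j)) B"
    using B by simp
  finally show "emeasure (superpose I m) B = emeasure (dirac_sum (Sigma I J) (\<lambda>(i, j). s i j)) B" .
qed simp

lemma superpose_in_configurations:
  assumes I: "countable I" and m: "\<And>i. i \<in> I \<Longrightarrow> m i \<in> configurations"
  shows "superpose I m \<in> configurations"
proof -
  have "\<forall>i\<in>I. \<exists>p :: nat set \<times> (nat \<Rightarrow> 'b). m i = dirac_sum (fst p) (snd p)"
    using m by (fastforce elim: configurationsE)
  from bchoice[OF this] obtain p :: "'a \<Rightarrow> nat set \<times> (nat \<Rightarrow> 'b)"
    where p: "\<And>i. i \<in> I \<Longrightarrow> m i = dirac_sum (fst (p i)) (snd (p i))" by blast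
  have "superpose I m = dirac_sum (Sigma I (\<lambda>i. fst (p i))) (\<lambda>(i, j). snd (p i) j)"
    using I p by (intro superpose_dirac_sums) auto
  also have "\<dots> \<in> configurations"
    using I by (intro dirac_sum_in_configurations) auto
  finally show ?thesis .
qed

section \<open>The evaluation sigma-algebra and its generators\<close>

lemma evaluation_generator: "{{\<gamma>\<in>\<Omega>. emeasure \<gamma> B \<in> E} | B E. B \<in> sets borel \<and> E \<in> sets borel} \<subseteq> Pow \<Omega>"
  by auto

lemma space_evaluation_space [simp]: "space (evaluation_space \<Omega>) = \<Omega>"
  unfolding evaluation_space_def by (rule space_measure_of[OF evaluation_generator])

lemma sets_evaluation_space:
  "sets (evaluation_space \<Omega>) = sigma_sets \<Omega> {{\<gamma>\<in>\<Omega>. emeasure \<gamma> B \<in> E} | B E. B \<in> sets borel \<and> E \<in> sets borel}"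
  unfolding evaluation_space_def by (rule sets_measure_of[OF evaluation_generator])

lemma measurable_emeasure_evaluation:
  assumes "B \<in> sets borel"
  shows "(\<lambda>\<gamma>. emeasure \<gamma> B) \<in> borel_measurable (evaluation_space \<Omega>)"
proof (rule measurableI)
  fix E :: "ennreal set" assume "E \<in> sets borel"
  moreover have "(\<lambda>\<gamma>. emeasure \<gamma> B) -` E \<inter> space (evaluation_space \<Omega>) = {\<gamma>\<in>\<Omega>. emeasure \<gamma> B \<in> E}"
    by auto
  ultimately show "(\<lambda>\<gamma>. emeasure \<gamma> B) -` E \<inter> space (evaluation_space \<Omega>) \<in> sets (evaluation_space \<Omega>)"
    unfolding sets_evaluation_space using assms by (auto intro!: sigma_sets.Basic)
qed simp

lemma measurable_evaluation_spaceI: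
  assumes "\<And>x. x \<in> space M \<Longrightarrow> f x \<in> \<Omega>"
    and "\<And>B. B \<in> sets borel \<Longrightarrow> (\<lambda>x. emeasure (f x) B) \<in> borel_measurable M"
  shows "f \<in> measurable M (evaluation_space \<Omega>)"
  unfolding evaluation_space_def
proof (rule measurable_measure_of[OF evaluation_generator])
  show "f \<in> space M \<rightarrow> \<Omega>" using assms(1) by auto
  fix Y assume "Y \<in> {{\<gamma>\<in>\<Omega>. emeasure \<gamma> B \<in> E} | B E. B \<in> sets borel \<and> E \<in> sets borel}"
  then obtain B E where Y: "Y = {\<gamma>\<in>\<Omega>. emeasure \<gamma> B \<in> E}" "B \<in> sets borel" "E \<in> sets borel" by auto
  have "f -` Y \<inter> space M = (\<lambda>x. emeasure (f x) B) -` E \<inter> space M"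
    using assms(1) by (auto simp: Y)
  then show "f -` Y \<inter> space M \<in> sets M"
    using measurable_sets[OF assms(2)[OF Y(2)] Y(3)] by simp
qed

lemma measurable_nn_integral_evaluation:
  assumes f: "f \<in> borel_measurable borel" and \<Omega>: "\<Omega> \<subseteq> configurations"
  shows "(\<lambda>\<gamma>. \<integral>\<^sup>+x. f x \<partial>\<gamma>) \<in> borel_measurable (evaluation_space \<Omega>)"
  using f
proof (induction rule: borel_measurable_induct)
  case (cong f g)
  have "(\<integral>\<^sup>+x. f x \<partial>\<gamma>) = (\<integral>\<^sup>+x. g x \<partial>\<gamma>)" for \<gamma>
    using cong(3) by (intro nn_integral_cong) auto
  then show ?case using cong by simp
next
  case (set A)
  have *: "(\<integral>\<^sup>+x. indicator A x \<partial>\<gamma>) = emeasure \<gamma> A" if "\<gamma> \<in> space (evaluation_space \<Omega>)" for \<gamma>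
  proof -
    have "sets \<gamma> = sets borel" using that \<Omega> sets_configuration by auto
    then show ?thesis using set by simp
  qed
  show ?case
    by (subst measurable_cong[OF *]) (auto intro: measurable_emeasure_evaluation set)
next
  case (mult u c)
  have *: "(\<integral>\<^sup>+x. c * u x \<partial>\<gamma>) = c * (\<integral>\<^sup>+x. u x \<partial>\<gamma>)" if "\<gamma> \<in> space (evaluation_space \<Omega>)" for \<gamma>
  proof -
    have "sets \<gamma> = sets borel" using that \<Omega> sets_configuration by auto
    then show ?thesis using mult by (intro nn_integral_cmult) (simp cong: measurable_cong_sets)
  qed
  show ?case using mult by (subst measurable_cong[OF *]) auto
next
  case (add u v)
  have *: "(\<integral>\<^sup>+x. v x + u x \<partial>\<gamma>) = (\<integral>\<^sup>+x. v x \<partial>\<gamma>) + (\<integral>\<^sup>+x. u x \<partial>\<gamma>)" if "\<gamma> \<in> space (evaluation_space \<Omega>)" for \<gamma>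
  proof -
    have "sets \<gamma> = sets borel" using that \<Omega> sets_configuration by auto
    then show ?thesis using add by (intro nn_integral_add) (simp_all cong: measurable_cong_sets)
  qed
  show ?case using add by (subst measurable_cong[OF *]) auto
next
  case (seq U)
  have *: "(\<integral>\<^sup>+x. (SUP i. U i) x \<partial>\<gamma>) = (SUP i. \<integral>\<^sup>+x. U i x \<partial>\<gamma>)" if "\<gamma> \<in> space (evaluation_space \<Omega>)" for \<gamma>
  proof -
    have "sets \<gamma> = sets borel" using that \<Omega> sets_configuration by auto
    then show ?thesis
      unfolding SUP_apply using seq
      by (intro nn_integral_monotone_convergence_SUP) (simp_all cong: measurable_cong_sets)
  qed
  show ?case using seq by (subst measurable_cong[OF *]) auto
qed

lemma proper_subset_configurations: "proper_configurations \<subseteq> configurations"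
  by (auto simp: proper_configurations_def)

text \<open>Renyi's observation: for simple configurations, the number of points in \<open>B\<close> is at least \<open>k\<close> iff
  \<open>B\<close> meets \<open>k\<close> disjoint basic open sets in points of the configuration, so that the events
  that \<open>B\<close> contains no point generate the \<open>\<sigma>\<close>-algebra. Unlike the evaluation events
  these void events are closed under intersection.\<close>

definition void_events :: "'a::topological_space measure set set" where
  "void_events = {{\<gamma>\<in>proper_configurations. emeasure \<gamma> B = 0} | B. B \<in> sets borel}"

text \<open>Pairwise Hausdorff neighbourhoods are intersected; finiteness keeps the intersection
  open.\<close>

lemma finite_separation:
  fixes T :: "'a::t2_space set"
  assumes "finite T"
  shows "\<exists>N. (\<forall>x\<in>T. open (N x) \<and> x \<in> N x) \<and> (\<forall>x\<in>T. \<forall>y\<in>T. x \<noteq> y \<longrightarrow> N x \<inter> N y = {})"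
proof -
  let ?P = "\<lambda>x y p. open (fst p) \<and> open (snd p) \<and> x \<in> fst p \<and> y \<in> snd p \<and> fst p \<inter> snd p = ({} :: 'a set)"
  define p where "p x y = (SOME p. ?P x y p)" for x y
  have p: "?P x y (p x y)" if xy: "x \<noteq> y" for x y
  proof -
    obtain U V where "open U" "open V" "x \<in> U" "y \<in> V" "U \<inter> V = {}"
      using hausdorff[OF xy] by blast
    then have "\<exists>p. ?P x y p" by (intro exI[of _ "(U, V)"]) simp
    then show ?thesis unfolding p_def by (rule someI_ex)
  qed
  \<comment> \<open>The pairs chosen for \<open>(x, y)\<close> and \<open>(y, x)\<close> are
    unrelated, so both are used; then \<open>N x\<close> and \<open>N y\<close> lie in the two
    halves of one and the same pair.\<close>
  define N where "N x = (\<Inter>y\<in>T - {x}. fst (p x y) \<inter> snd (p y x))" for x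
  have "open (N x)" for x
    unfolding N_def using p assms by (intro open_INT) auto
  moreover have "x \<in> N x" for x
    unfolding N_def
  proof
    fix y assume "y \<in> T - {x}"
    then show "x \<in> fst (p x y) \<inter> snd (p y x)" using p[of x y] p[of y x] by auto
  qed
  moreover have "N x \<inter> N y = {}" if "x \<in> T" "y \<in> T" "x \<noteq> y" for x y
  proof -
    have "N x \<subseteq> fst (p x y)" "N y \<subseteq> snd (p x y)"
      using that by (auto simp: N_def)
    then show ?thesis using p[OF that(3)] by auto
  qed
  ultimately show ?thesis by (intro exI[of _ N]) simp
qed

text \<open>Forward, \<open>k\<close> points in \<open>B\<close> are separated by the Hausdorff
  property and the neighbourhoods shrunk into the basis; backward, points chosen in disjoint sets
  are distinct. For a countable basis only countably many lists \<open>Us\<close> occur.\<close>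

lemma count_ge_iff:
  fixes \<gamma> :: "'a::t2_space measure"
  assumes \<gamma>: "\<gamma> \<in> proper_configurations" and B: "B \<in> sets borel" and \<B>: "topological_basis \<B>"
  shows "of_nat k \<le> emeasure \<gamma> B \<longleftrightarrow>
    (\<exists>Us\<in>{Us \<in> lists \<B>. length Us = k \<and> (\<forall>i<k. \<forall>j<k. i \<noteq> j \<longrightarrow> Us ! i \<inter> Us ! j = {})}.
      \<forall>i\<in>{..<k}. \<not> emeasure \<gamma> (B \<inter> Us ! i) = 0)"
proof
  assume le: "of_nat k \<le> emeasure \<gamma> B"
  have "\<exists>T. T \<subseteq> points \<gamma> \<inter> B \<and> finite T \<and> card T = k"
  proof (cases "finite (points \<gamma> \<inter> B)")
    case True
    then have "k \<le> card (points \<gamma> \<inter> B)"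
      using le emeasure_proper[OF \<gamma> B] by (simp add: emeasure_count_space)
    then show ?thesis using True by (meson obtain_subset_with_card_n)
  next
    case False
    then show ?thesis using infinite_arbitrarily_large by blast
  qed
  then obtain T where T: "T \<subseteq> points \<gamma> \<inter> B" "finite T" "card T = k" by blast
  obtain xs where xs: "set xs = T" "distinct xs" "length xs = k"
    using finite_distinct_list[OF T(2)] distinct_card[where 'a = 'a] T(3) by auto
  from finite_separation[OF T(2)]
  obtain N where "(\<forall>x\<in>T. open (N x) \<and> x \<in> N x) \<and> (\<forall>x\<in>T. \<forall>y\<in>T. x \<noteq> y \<longrightarrow> N x \<inter> N y = {})" ..
  then have N: "\<forall>x\<in>T. open (N x) \<and> x \<in> N x" "\<forall>x\<in>T. \<forall>y\<in>T. x \<noteq> y \<longrightarrow> N x \<inter> N y = {}"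
    by (rule conjunct1, rule conjunct2)
  have "\<forall>x\<in>T. \<exists>U. U \<in> \<B> \<and> x \<in> U \<and> U \<subseteq> N x"
  proof
    fix x assume "x \<in> T"
    then have "open (N x)" "x \<in> N x" using N(1) by auto
    from topological_basisE[OF \<B> this] show "\<exists>U. U \<in> \<B> \<and> x \<in> U \<and> U \<subseteq> N x" by blast
  qed
  from bchoice[OF this] obtain U where U: "\<And>x. x \<in> T \<Longrightarrow> U x \<in> \<B> \<and> x \<in> U x \<and> U x \<subseteq> N x"
    by blast
  have xsT: "xs ! i \<in> T" if "i < k" for i using xs that by (metis nth_mem)
  show "\<exists>Us\<in>{Us \<in> lists \<B>. length Us = k \<and> (\<forall>i<k. \<forall>j<k. i \<noteq> j \<longrightarrow> Us ! i \<inter> Us ! j = {})}.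
      \<forall>i\<in>{..<k}. \<not> emeasure \<gamma> (B \<inter> Us ! i) = 0"
  proof (intro bexI[of _ "map U xs"] CollectI conjI allI impI ballI)
    show "map U xs \<in> lists \<B>" using U xs by auto
    show "length (map U xs) = k" using xs by simp
    show "map U xs ! i \<inter> map U xs ! j = {}" if ij: "i < k" "j < k" "i \<noteq> j" for i j
    proof -
      have "xs ! i \<noteq> xs ! j" using ij xs by (simp add: nth_eq_iff_index_eq)
      then have "N (xs ! i) \<inter> N (xs ! j) = {}" using N(2) xsT ij by blast
      then show ?thesis using U[OF xsT[OF ij(1)]] U[OF xsT[OF ij(2)]] xs ij by auto
    qed
    show "\<not> emeasure \<gamma> (B \<inter> map U xs ! i) = 0" if "i \<in> {..<k}" for i
    proof -
      have i: "i < k" using that by simp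
      have "U (xs ! i) \<in> sets borel"
        using U[OF xsT[OF i]] topological_basis_open[OF \<B>] by auto
      moreover have "xs ! i \<in> points \<gamma> \<inter> (B \<inter> U (xs ! i))"
        using T(1) xsT[OF i] U[OF xsT[OF i]] by blast
      ultimately show ?thesis
        using emeasure_proper[OF \<gamma>, of "B \<inter> U (xs ! i)"] B i xs
        by (auto simp: emeasure_count_space_eq_0)
    qed
  qed
next
  assume "\<exists>Us\<in>{Us \<in> lists \<B>. length Us = k \<and> (\<forall>i<k. \<forall>j<k. i \<noteq> j \<longrightarrow> Us ! i \<inter> Us ! j = {})}.
      \<forall>i\<in>{..<k}. \<not> emeasure \<gamma> (B \<inter> Us ! i) = 0"
  then obtain Us where "Us \<in> {Us \<in> lists \<B>. length Us = k \<and> (\<forall>i<k. \<forall>j<k. i \<noteq> j \<longrightarrow> Us ! i \<inter> Us ! j = {})}"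
      "\<forall>i\<in>{..<k}. \<not> emeasure \<gamma> (B \<inter> Us ! i) = 0" ..
  then have Us: "Us \<in> lists \<B>" "length Us = k"
      "\<And>i j. i < k \<Longrightarrow> j < k \<Longrightarrow> i \<noteq> j \<Longrightarrow> Us ! i \<inter> Us ! j = {}"
      "\<And>i. i < k \<Longrightarrow> emeasure \<gamma> (B \<inter> Us ! i) \<noteq> 0" by auto
  have "\<forall>i\<in>{..<k}. \<exists>x. x \<in> points \<gamma> \<inter> (B \<inter> Us ! i)"
  proof
    fix i assume i: "i \<in> {..<k}"
    then have "Us ! i \<in> \<B>" using Us(1,2) by (auto simp: lists_eq_set)
    then have "Us ! i \<in> sets borel" using topological_basis_open[OF \<B>] by auto
    then show "\<exists>x. x \<in> points \<gamma> \<inter> (B \<inter> Us ! i)"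
      using Us(4)[of i] i emeasure_proper[OF \<gamma>, of "B \<inter> Us ! i"] B
      by (auto simp: emeasure_count_space_eq_0)
  qed
  from bchoice[OF this] obtain x where x: "\<And>i. i < k \<Longrightarrow> x i \<in> points \<gamma> \<inter> (B \<inter> Us ! i)" by blast
  have "inj_on x {..<k}"
    using x Us(3) by (intro inj_onI) (metis IntD2 IntI empty_iff lessThan_iff)
  then have "of_nat k = emeasure (count_space UNIV) (x ` {..<k})"
    by (simp add: emeasure_count_space card_image)
  also have "\<dots> \<le> emeasure (count_space UNIV) (points \<gamma> \<inter> B)"
    using x by (intro emeasure_mono) auto
  also have "\<dots> = emeasure \<gamma> B" by (rule emeasure_proper[OF \<gamma> B, symmetric])
  finally show "of_nat k \<le> emeasure \<gamma> B" .
qed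

lemma void_events_Pow: "void_events \<subseteq> Pow proper_configurations"
  by (auto simp: void_events_def)

text \<open>By \<open>count_ge_iff\<close> the event that \<open>B\<close> has at least
  \<open>k\<close> points is a countable union of finite intersections of complements of void
  events, and these events determine the mass of \<open>B\<close>.\<close>

lemma sets_conf_space:
  "sets (conf_space :: 'a::{t2_space, second_countable_topology} measure measure) = sigma_sets proper_configurations void_events"
proof
  let ?S = "sigma proper_configurations (void_events :: 'a measure set set)"
  have space[simp]: "space ?S = proper_configurations"
    by (rule space_measure_of[OF void_events_Pow])
  have sets: "sets ?S = sigma_sets proper_configurations void_events"
    by (rule sets_measure_of[OF void_events_Pow])
  have void: "{\<gamma>\<in>proper_configurations. emeasure \<gamma> B = 0} \<in> sets ?S" if "B \<in> sets borel" for B :: "'a set"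
    unfolding sets using that by (auto simp: void_events_def)
  obtain \<B> :: "'a set set" where \<B>: "countable \<B>" "topological_basis \<B>"
    using ex_countable_basis by blast
  have "(\<lambda>\<gamma>. \<gamma>) \<in> measurable ?S (conf_space :: 'a measure measure)"
  proof (rule measurable_evaluation_spaceI)
    fix B :: "'a set" assume B: "B \<in> sets borel"
    have "{\<gamma>\<in>proper_configurations. of_nat k \<le> emeasure \<gamma> B} \<in> sets ?S" for k
    proof -
      let ?L = "{Us \<in> lists \<B>. length Us = k \<and> (\<forall>i<k. \<forall>j<k. i \<noteq> j \<longrightarrow> Us ! i \<inter> Us ! j = {})}"
      have "countable ?L"
        by (rule countable_subset[OF _ countable_lists[OF \<B>(1)]]) auto
      have "{\<gamma>\<in>proper_configurations. of_nat k \<le> emeasure \<gamma> B} =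
          {\<gamma>\<in>space ?S. \<exists>Us\<in>?L. \<forall>i\<in>{..<k}. \<not> emeasure \<gamma> (B \<inter> Us ! i) = 0}"
        unfolding space by (intro Collect_cong conj_cong refl count_ge_iff B \<B>(2))
      also have "\<dots> \<in> sets ?S"
      proof (intro sets.sets_Collect_countable_Ex' sets.sets_Collect_finite_All sets.sets_Collect_neg \<open>countable ?L\<close>)
        fix Us i assume Us: "Us \<in> ?L" "i \<in> {..<k}"
        then have "Us ! i \<in> \<B>" by (auto simp: lists_eq_set)
        then have "B \<inter> Us ! i \<in> sets borel" using B topological_basis_open[OF \<B>(2)] by auto
        from void[OF this] show "{\<gamma>\<in>space ?S. emeasure \<gamma> (B \<inter> Us ! i) = 0} \<in> sets ?S" by simp
      qed auto
      finally show ?thesis .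
    qed
    \<comment> \<open>A count is the supremum of the numbers \<open>k\<close> that it reaches; this
      also covers an infinite count.\<close>
    then have "(\<lambda>\<gamma>. SUP k. of_nat k * indicator {\<gamma>\<in>proper_configurations. of_nat k \<le> emeasure \<gamma> B} \<gamma> :: ennreal)
        \<in> borel_measurable ?S"
      by (intro borel_measurable_SUP) auto
    moreover have "(SUP k. of_nat k * indicator {\<gamma>\<in>proper_configurations. of_nat k \<le> emeasure \<gamma> B} \<gamma> :: ennreal) = emeasure \<gamma> B"
      if \<gamma>: "\<gamma> \<in> space ?S" for \<gamma>
    proof -
      have \<gamma>: "\<gamma> \<in> proper_configurations" using \<gamma> by simp
      show ?thesis
      proof (cases "finite (points \<gamma> \<inter> B)")
        case True
        then have n: "emeasure \<gamma> B = of_nat (card (points \<gamma> \<inter> B))"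
          using emeasure_proper[OF \<gamma> B] by (simp add: emeasure_count_space)
        show ?thesis
        proof (rule antisym)
          show "(SUP k. of_nat k * indicator {\<gamma>\<in>proper_configurations. of_nat k \<le> emeasure \<gamma> B} \<gamma> :: ennreal) \<le> emeasure \<gamma> B"
            by (rule SUP_least) (auto split: split_indicator)
          show "emeasure \<gamma> B \<le> (SUP k. of_nat k * indicator {\<gamma>\<in>proper_configurations. of_nat k \<le> emeasure \<gamma> B} \<gamma> :: ennreal)"
            using \<gamma> by (intro SUP_upper2[of "card (points \<gamma> \<inter> B)"]) (auto simp: n)
        qed
      next
        case False
        then have "emeasure \<gamma> B = \<infinity>"
          using emeasure_proper[OF \<gamma> B] by (simp add: emeasure_count_space)
        then show ?thesis using \<gamma> ennreal_SUP_of_nat_eq_top by simp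
      qed
    qed
    ultimately show "(\<lambda>\<gamma>. emeasure \<gamma> B) \<in> borel_measurable ?S"
      by (subst measurable_cong[symmetric]) auto
  qed simp
  then show "sets (conf_space :: 'a measure measure) \<subseteq> sigma_sets proper_configurations void_events"
    using measurable_sets[of "\<lambda>\<gamma>. \<gamma>" ?S conf_space] sets.sets_into_space[of _ conf_space]
    by (fastforce simp: sets Int_absorb2)
  have "{\<gamma>\<in>proper_configurations. emeasure \<gamma> B = 0} \<in> sets conf_space" if "B \<in> sets borel" for B :: "'a set"
    using measurable_sets[OF measurable_emeasure_evaluation[OF that, of proper_configurations], of "{0}"]
    by (simp add: vimage_def Int_def conj_commute)
  then have "void_events \<subseteq> sets (conf_space :: 'a measure measure)"
    by (auto simp: void_events_def)
  then show "sigma_sets proper_configurations void_events \<subseteq> sets (conf_space :: 'a measure measure)"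
    using sets.sigma_sets_subset[of void_events "conf_space :: 'a measure measure"] by simp
qed

lemma Int_stable_void_events: "Int_stable (void_events :: 'a::t1_space measure set set)"
proof (rule Int_stableI)
  fix S T :: "'a measure set" assume "S \<in> void_events" "T \<in> void_events"
  then obtain B C where BC: "S = {\<gamma>\<in>proper_configurations. emeasure \<gamma> B = 0}" "B \<in> sets borel"
      "T = {\<gamma>\<in>proper_configurations. emeasure \<gamma> C = 0}" "C \<in> sets borel"
    by (auto simp: void_events_def)
  have "emeasure \<gamma> (B \<union> C) = 0 \<longleftrightarrow> emeasure \<gamma> B = 0 \<and> emeasure \<gamma> C = 0" if "\<gamma> \<in> proper_configurations" for \<gamma>
    using BC that by (auto simp: emeasure_proper emeasure_count_space_eq_0)
  then have "S \<inter> T = {\<gamma>\<in>proper_configurations. emeasure \<gamma> (B \<union> C) = 0}"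
    using BC by auto
  then show "S \<inter> T \<in> void_events"
    using BC by (auto simp: void_events_def)
qed

text \<open>Testing on void events suffices, and for marked configurations these reduce to
  conditions on single centres.\<close>

lemma measurable_conf_spaceI:
  fixes f :: "'b \<Rightarrow> 'a::{t2_space, second_countable_topology} measure"
  assumes "\<And>x. x \<in> space M \<Longrightarrow> f x \<in> proper_configurations"
    and "\<And>B. B \<in> sets borel \<Longrightarrow> {x \<in> space M. emeasure (f x) B = 0} \<in> sets M"
  shows "f \<in> measurable M conf_space"
proof (rule measurable_sigma_sets[OF sets_conf_space void_events_Pow])
  show "f \<in> space M \<rightarrow> proper_configurations" using assms(1) by auto
  fix Y assume "Y \<in> (void_events :: 'a measure set set)"
  then obtain B where Y: "Y = {\<gamma>\<in>proper_configurations. emeasure \<gamma> B = 0}" "B \<in> sets borel"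
    by (auto simp: void_events_def)
  have "f -` Y \<inter> space M = {x \<in> space M. emeasure (f x) B = 0}"
    using assms(1) by (auto simp: Y)
  then show "f -` Y \<inter> space M \<in> sets M" using assms(2)[OF Y(2)] by simp
qed

text \<open>The product is the exponential of a difference of two integrals against the
  configuration, once two exceptional cases are split off: infinitely many nontrivial factors, where
  the product is 1 by convention, and a factor 0, which has no logarithm.\<close>

lemma measurable_prod_points:
  fixes g :: "'a::{t2_space, second_countable_topology} \<Rightarrow> real"
  assumes g[measurable]: "g \<in> borel_measurable borel" and nonneg: "\<And>z. 0 \<le> g z"
  shows "(\<lambda>\<gamma>. \<Prod>z | z \<in> points \<gamma> \<and> g z \<noteq> 1. g z) \<in> borel_measurable conf_space"
proof -
  define P where "P f \<gamma> = (\<integral>\<^sup>+z. ennreal (f z) \<partial>\<gamma>)" for f :: "'a \<Rightarrow> real" and \<gamma>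
  have [measurable]: "P f \<in> borel_measurable conf_space" if "f \<in> borel_measurable borel" for f
    unfolding P_def using that proper_subset_configurations by (intro measurable_nn_integral_evaluation) auto
  have [measurable]: "(\<lambda>\<gamma>. emeasure \<gamma> B) \<in> borel_measurable conf_space" if "B \<in> sets borel" for B :: "'a set"
    using that by (rule measurable_emeasure_evaluation)
  have Beq: "{z. g z \<noteq> 1} \<in> sets borel" "{z. g z = 0} \<in> sets borel"
  proof -
    have "{z \<in> space borel. g z \<noteq> 1} \<in> sets borel" "{z \<in> space borel. g z = 0} \<in> sets borel" by measurable
    then show "{z. g z \<noteq> 1} \<in> sets borel" "{z. g z = 0} \<in> sets borel" by simp_all
  qed
  note [measurable] = Beq
  \<comment> \<open>\<open>ennreal\<close> sends negative reals to 0, so the two applications of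
    \<open>P\<close> sum the positive and the negative parts of the logarithm.\<close>
  have "(\<lambda>\<gamma>. if emeasure \<gamma> {z. g z \<noteq> 1} = \<infinity> then 1 else if emeasure \<gamma> {z. g z = 0} \<noteq> 0 then 0
      else exp (enn2real (P (\<lambda>z. ln (g z)) \<gamma>) - enn2real (P (\<lambda>z. - ln (g z)) \<gamma>))) \<in> borel_measurable conf_space"
    by measurable
  moreover have "(\<Prod>z | z \<in> points \<gamma> \<and> g z \<noteq> 1. g z) =
      (if emeasure \<gamma> {z. g z \<noteq> 1} = \<infinity> then 1 else if emeasure \<gamma> {z. g z = 0} \<noteq> 0 then 0
      else exp (enn2real (P (\<lambda>z. ln (g z)) \<gamma>) - enn2real (P (\<lambda>z. - ln (g z)) \<gamma>)))"
    if "\<gamma> \<in> space conf_space" for \<gamma>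
  proof -
    have \<gamma>: "\<gamma> \<in> proper_configurations" using that by simp
    let ?S = "{z. z \<in> points \<gamma> \<and> g z \<noteq> 1}"
    have S: "points \<gamma> \<inter> {z. g z \<noteq> 1} = ?S" by auto
    show ?thesis
    proof (cases "finite ?S")
      case False
      then have "emeasure \<gamma> {z. g z \<noteq> 1} = \<infinity>"
        by (simp add: emeasure_proper[OF \<gamma> Beq(1)] S emeasure_count_space)
      then show ?thesis using False by simp
    next
      case fin: True
      then have nt: "emeasure \<gamma> {z. g z \<noteq> 1} \<noteq> \<infinity>"
        by (simp add: emeasure_proper[OF \<gamma> Beq(1)] S emeasure_count_space)
      have z: "emeasure \<gamma> {z. g z = 0} = 0 \<longleftrightarrow> (\<forall>z\<in>points \<gamma>. g z \<noteq> 0)"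
        by (auto simp: emeasure_proper[OF \<gamma> Beq(2)] emeasure_count_space_eq_0)
      show ?thesis
      proof (cases "\<forall>z\<in>points \<gamma>. g z \<noteq> 0")
        case False
        then have "(\<Prod>z\<in>?S. g z) = 0" using fin by (intro prod_zero) auto
        then show ?thesis using nt False z by simp
      next
        case True
        have sum: "enn2real (P f \<gamma>) = (\<Sum>z\<in>?S. max 0 (f z))"
          if "\<And>z. g z = 1 \<Longrightarrow> f z = 0" "f \<in> borel_measurable borel" for f
        proof -
          have "P f \<gamma> = (\<integral>\<^sup>+z. ennreal (f z) \<partial>count_space (points \<gamma>))"
            unfolding P_def using that(2) by (intro nn_integral_proper[OF \<gamma>]) auto
          also have "\<dots> = (\<Sum>z\<in>?S. ennreal (f z))"
            using that(1) fin by (intro nn_integral_count_space') auto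
          also have "\<dots> = (\<Sum>z\<in>?S. ennreal (max 0 (f z)))"
            by (intro sum.cong) (auto simp: max_def ennreal_neg)
          also have "\<dots> = ennreal (\<Sum>z\<in>?S. max 0 (f z))"
            by (intro sum_ennreal) auto
          finally show ?thesis by (simp add: sum_nonneg)
        qed
        have "enn2real (P (\<lambda>z. ln (g z)) \<gamma>) - enn2real (P (\<lambda>z. - ln (g z)) \<gamma>) =
            (\<Sum>z\<in>?S. max 0 (ln (g z)) - max 0 (- ln (g z)))"
          by (simp add: sum sum_subtractf)
        also have "\<dots> = (\<Sum>z\<in>?S. ln (g z))"
          by (intro sum.cong) (auto simp: max_def)
        finally have "exp (enn2real (P (\<lambda>z. ln (g z)) \<gamma>) - enn2real (P (\<lambda>z. - ln (g z)) \<gamma>)) = (\<Prod>z\<in>?S. exp (ln (g z)))"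
          using fin by (simp add: exp_sum)
        also have "\<dots> = (\<Prod>z\<in>?S. g z)"
          using True nonneg by (intro prod.cong refl exp_ln) (auto simp: less_le)
        finally show ?thesis using nt z True by simp
      qed
    qed
  qed
  ultimately show ?thesis
    by (subst measurable_cong) auto
qed

text \<open>The bound on singletons ranges over uncountably many points. On a compact set of finite
  mass it is replaced by the existence of a finite cover by basic open sets, each of which carries
  at most mass 1 there; only countably many covers have to be considered.\<close>

lemma sets_proper_configurations:
  fixes W :: "nat \<Rightarrow> 'a::{t2_space, second_countable_topology} set"
  assumes W: "\<And>n. open (W n)" "\<And>n. compact (closure (W n))" "(\<Union>n. W n) = UNIV"
  shows "proper_configurations \<in> sets (gconf_space :: 'a measure measure)"
proof -
  obtain \<B> :: "'a set set" where \<B>: "countable \<B>" "topological_basis \<B>"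
    using ex_countable_basis by blast
  have \<B>_open: "open U" if "U \<in> \<B>" for U
    using topological_basis_open[OF \<B>(2)] that by simp
  let ?K = "\<lambda>n. closure (W n)"
  let ?F = "{F. finite F \<and> F \<subseteq> \<B>}"
  have [measurable]: "(\<lambda>\<gamma>. emeasure \<gamma> B) \<in> borel_measurable gconf_space" if "B \<in> sets borel" for B :: "'a set"
    using that by (rule measurable_emeasure_evaluation)
  have "countable ?F" by (rule countable_Collect_finite_subset[OF \<B>(1)])
  have eq: "proper_configurations = {\<gamma>\<in>space gconf_space. \<forall>n. emeasure \<gamma> (?K n) < \<infinity> \<and>
      (\<exists>F\<in>?F. ?K n \<subseteq> \<Union>F \<and> (\<forall>U\<in>F. emeasure \<gamma> (?K n \<inter> U) \<le> 1))}"
  proof (intro set_eqI iffI)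
    fix \<gamma> :: "'a measure" assume \<gamma>: "\<gamma> \<in> proper_configurations"
    have "\<exists>F\<in>?F. ?K n \<subseteq> \<Union>F \<and> (\<forall>U\<in>F. emeasure \<gamma> (?K n \<inter> U) \<le> 1)" for n
    proof -
      let ?\<C> = "{U \<in> \<B>. emeasure \<gamma> (?K n \<inter> U) \<le> 1}"
      have fin: "finite (points \<gamma> \<inter> ?K n)" by (rule finite_points_compact[OF \<gamma> W(2)])
      have "?K n \<subseteq> \<Union>?\<C>"
      proof
        fix x assume "x \<in> ?K n"
        \<comment> \<open>Removing the finitely many other points of the configuration in the
          compact set leaves an open neighbourhood of \<open>x\<close>.\<close>
        have "open (- (points \<gamma> \<inter> ?K n - {x}))"
          using fin by (intro open_Compl finite_imp_closed) simp
        moreover have "x \<in> - (points \<gamma> \<inter> ?K n - {x})" by simp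
        ultimately have U: "open (- (points \<gamma> \<inter> ?K n - {x}))" "x \<in> - (points \<gamma> \<inter> ?K n - {x})" by auto
        from topological_basisE[OF \<B>(2) U]
        obtain U where U: "U \<in> \<B>" "x \<in> U" "U \<subseteq> - (points \<gamma> \<inter> ?K n - {x})"
          by blast
        then have "points \<gamma> \<inter> (?K n \<inter> U) \<subseteq> {x}" by auto
        then have "emeasure (count_space UNIV) (points \<gamma> \<inter> (?K n \<inter> U)) \<le> emeasure (count_space UNIV) {x}"
          by (intro emeasure_mono) auto
        then have "emeasure \<gamma> (?K n \<inter> U) \<le> 1"
          using \<B>_open[OF U(1)] by (subst emeasure_proper[OF \<gamma>]) (auto simp: emeasure_count_space)
        then show "x \<in> \<Union>?\<C>" using U by blast
      qed
      then obtain F where "F \<subseteq> ?\<C>" "finite F" "?K n \<subseteq> \<Union>F"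
      proof (rule compactE[OF W(2)])
        show "open U" if "U \<in> ?\<C>" for U using \<B>_open that by simp
      qed
      then show ?thesis by blast
    qed
    then show "\<gamma> \<in> {\<gamma>\<in>space gconf_space. \<forall>n. emeasure \<gamma> (?K n) < \<infinity> \<and>
        (\<exists>F\<in>?F. ?K n \<subseteq> \<Union>F \<and> (\<forall>U\<in>F. emeasure \<gamma> (?K n \<inter> U) \<le> 1))}"
      using \<gamma> W(2) by (auto simp: proper_configurations_def)
  next
    fix \<gamma> :: "'a measure" assume "\<gamma> \<in> {\<gamma>\<in>space gconf_space. \<forall>n. emeasure \<gamma> (?K n) < \<infinity> \<and>
        (\<exists>F\<in>?F. ?K n \<subseteq> \<Union>F \<and> (\<forall>U\<in>F. emeasure \<gamma> (?K n \<inter> U) \<le> 1))}"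
    then have \<gamma>: "\<gamma> \<in> configurations" and fin: "\<And>n. emeasure \<gamma> (?K n) < \<infinity>"
      and F: "\<And>n. \<exists>F\<in>?F. ?K n \<subseteq> \<Union>F \<and> (\<forall>U\<in>F. emeasure \<gamma> (?K n \<inter> U) \<le> 1)" by auto
    have sets[simp]: "sets \<gamma> = sets borel" by (rule sets_configuration[OF \<gamma>])
    have "emeasure \<gamma> B < \<infinity>" if B: "compact B" for B
    proof -
      obtain T where T: "finite T" "B \<subseteq> (\<Union>n\<in>T. W n)"
        using compactE_image[OF B, of UNIV W] W by auto
      have "emeasure \<gamma> B \<le> emeasure \<gamma> (\<Union>n\<in>T. ?K n)"
        using T closure_subset[of "W _"] by (intro emeasure_mono) (auto, blast)
      also have "\<dots> \<le> (\<Sum>n\<in>T. emeasure \<gamma> (?K n))"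
        using T by (intro emeasure_subadditive_finite) auto
      also have "\<dots> < \<infinity>" using T fin by simp
      finally show ?thesis .
    qed
    moreover have "emeasure \<gamma> {x} \<le> 1" for x
    proof -
      obtain n where n: "x \<in> ?K n" using W(3) closure_subset by blast
      then obtain F U where U: "F \<subseteq> \<B>" "U \<in> F" "x \<in> U" "emeasure \<gamma> (?K n \<inter> U) \<le> 1" using F[of n] by blast
      have "emeasure \<gamma> {x} \<le> emeasure \<gamma> (?K n \<inter> U)"
        using n U \<B>_open[of U] by (intro emeasure_mono) auto
      with U show ?thesis by simp
    qed
    ultimately show "\<gamma> \<in> proper_configurations" using \<gamma> by (simp add: proper_configurations_def)
  qed
  have fin: "{\<gamma> \<in> space gconf_space. emeasure \<gamma> (?K n) < \<infinity>} \<in> sets gconf_space" for n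
    by measurable
  have cov: "{\<gamma> \<in> space gconf_space. ?K n \<subseteq> \<Union>F \<and> (\<forall>U\<in>F. emeasure \<gamma> (?K n \<inter> U) \<le> 1)} \<in> sets gconf_space"
    if F: "F \<in> ?F" for n F
  proof (intro sets.sets_Collect_conj sets.sets_Collect_const sets.sets_Collect_finite_All)
    fix U assume "U \<in> F"
    then have "?K n \<inter> U \<in> sets borel" using F \<B>_open by auto
    then show "{\<gamma> \<in> space gconf_space. emeasure \<gamma> (?K n \<inter> U) \<le> 1} \<in> sets gconf_space"
      by measurable
  qed (use F in simp)
  show ?thesis
    unfolding eq
    by (intro sets.sets_Collect_countable_All sets.sets_Collect_conj fin
        sets.sets_Collect_countable_Ex'[OF cov \<open>countable ?F\<close>])
qed

text \<open>The generators are traced one by one. This identifies the measurable sets of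
  \<open>cluster_measure\<close> with those of the proper configuration space.\<close>

lemma sets_restrict_gconf_space:
  assumes "proper_configurations \<in> sets (gconf_space :: 'a::topological_space measure measure)"
  shows "sets (restrict_space (gconf_space :: 'a measure measure) proper_configurations) = sets conf_space"
proof -
  let ?C = "configurations :: 'a measure set" and ?P = "proper_configurations :: 'a measure set"
  let ?G = "\<lambda>\<Omega>. {{\<gamma>\<in>\<Omega>. emeasure \<gamma> B \<in> E} | B E. B \<in> sets (borel :: 'a measure) \<and> E \<in> sets (borel :: ennreal measure)}"
  have "sets (restrict_space gconf_space ?P) = sigma_sets ?P ((\<inter>) ?P ` ?G ?C)"
    using assms proper_subset_configurations unfolding sets_restrict_space sets_evaluation_space
    by (intro sigma_sets_Int) auto
  also have "(\<inter>) ?P ` ?G ?C = ?G ?P"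
  proof -
    have "?P \<inter> {\<gamma>\<in>?C. emeasure \<gamma> B \<in> E} = {\<gamma>\<in>?P. emeasure \<gamma> B \<in> E}" for B E
      using proper_subset_configurations by auto
    then show ?thesis by (auto simp: image_iff) (metis (no_types, lifting))+
  qed
  finally show ?thesis by (simp add: sets_evaluation_space)
qed

section \<open>Marked configurations\<close>

lemma measurable_nn_integral_count_space:
  fixes f :: "'i \<Rightarrow> 'b \<Rightarrow> ennreal"
  assumes I: "countable I" and f: "\<And>i. i \<in> I \<Longrightarrow> f i \<in> borel_measurable M"
  shows "(\<lambda>x. \<integral>\<^sup>+i. f i x \<partial>count_space I) \<in> borel_measurable M"
proof -
  let ?J = "to_nat_on I ` I"
  have bij: "bij_betw (from_nat_into I) ?J I"
    by (rule bij_betw_byWitness[where f' = "to_nat_on I"]) (auto simp: I)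
  have mem: "from_nat_into I n \<in> I" if "n \<in> ?J" for n
    using that bij by (auto simp: bij_betw_def)
  have "(\<integral>\<^sup>+i. f i x \<partial>count_space I) = (\<Sum>n. if n \<in> ?J then f (from_nat_into I n) x else 0)" for x
  proof -
    have "(\<integral>\<^sup>+i. f i x \<partial>count_space I) = (\<integral>\<^sup>+n. f (from_nat_into I n) x \<partial>count_space ?J)"
      by (rule nn_integral_bij_count_space[OF bij, symmetric])
    also have "\<dots> = (\<integral>\<^sup>+n. (if n \<in> ?J then f (from_nat_into I n) x else 0) \<partial>count_space ?J)"
      by (intro nn_integral_cong) simp
    also have "\<dots> = (\<integral>\<^sup>+n. (if n \<in> ?J then f (from_nat_into I n) x else 0) \<partial>count_space UNIV)"
      by (intro nn_integral_count_space_eq) auto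
    finally show ?thesis by (simp only: nn_integral_count_space_nat)
  qed
  moreover have "(\<lambda>x. if n \<in> ?J then f (from_nat_into I n) x else 0) \<in> borel_measurable M" for n
    using f[OF mem[of n]] by (cases "n \<in> ?J") simp_all
  ultimately show ?thesis
    by (simp only:) (intro borel_measurable_suminf_order)
qed

text \<open>Both sides agree on finite cylinders, which determine measures on infinite products. It
  relates the product of configuration-valued cluster laws in \<open>gen_cluster_measure\<close> to
  the product of the tuple laws.\<close>

lemma PiM_distr:
  assumes M: "\<And>i. i \<in> I \<Longrightarrow> prob_space (M i)" and f: "\<And>i. i \<in> I \<Longrightarrow> f i \<in> measurable (M i) (N i)"
  shows "(\<Pi>\<^sub>M i\<in>I. distr (M i) (N i) (f i)) = distr (PiM I M) (PiM I N) (\<lambda>\<omega>. \<lambda>i\<in>I. f i (\<omega> i))"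
    (is "?L = ?R")
proof (rule measure_eqI_PiM_infinite)
  have D: "prob_space (distr (M i) (N i) (f i))" if "i \<in> I" for i
    using M f that by (intro prob_space.prob_space_distr) auto
  have T: "(\<lambda>\<omega>. \<lambda>i\<in>I. f i (\<omega> i)) \<in> measurable (PiM I M) (PiM I N)"
    using f by (intro measurable_restrict measurable_compose[OF measurable_component_singleton]) auto
  show "sets ?L = sets (PiM I N)" by (intro sets_PiM_cong) auto
  show "sets ?R = sets (PiM I N)" by simp
  interpret prob_space ?L by (intro prob_space_PiM D)
  show "finite_measure ?L" by unfold_locales
  fix A J assume J: "finite J" "J \<subseteq> I" and A: "\<And>i. i \<in> J \<Longrightarrow> A i \<in> sets (N i)"
  have "emeasure ?L (prod_emb I N J (Pi\<^sub>E J A)) = (\<Prod>i\<in>J. emeasure (distr (M i) (N i) (f i)) (A i))"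
  proof -
    have "prod_emb I N J (Pi\<^sub>E J A) = prod_emb I (\<lambda>i. distr (M i) (N i) (f i)) J (Pi\<^sub>E J A)"
      by (simp add: prod_emb_def)
    then show ?thesis using J A D by (simp add: emeasure_PiM_emb)
  qed
  also have "\<dots> = (\<Prod>i\<in>J. emeasure (M i) (f i -` A i \<inter> space (M i)))"
    using J A f by (intro prod.cong) (auto simp: emeasure_distr)
  also have "\<dots> = emeasure (PiM I M) (prod_emb I M J (\<Pi>\<^sub>E i\<in>J. f i -` A i \<inter> space (M i)))"
    using J A f M by (intro emeasure_PiM_emb[symmetric]) (auto intro: measurable_sets)
  also have "prod_emb I M J (\<Pi>\<^sub>E i\<in>J. f i -` A i \<inter> space (M i)) =
      (\<lambda>\<omega>. \<lambda>i\<in>I. f i (\<omega> i)) -` prod_emb I N J (Pi\<^sub>E J A) \<inter> space (PiM I M)"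
    using J measurable_space[OF f] by (auto simp: prod_emb_def space_PiM PiE_iff subset_iff Pi_iff)
  also have "emeasure (PiM I M) \<dots> = emeasure ?R (prod_emb I N J (Pi\<^sub>E J A))"
    using J A T by (intro emeasure_distr[symmetric] sets_PiM_I) auto
  finally show "emeasure ?L (prod_emb I N J (Pi\<^sub>E J A)) = emeasure ?R (prod_emb I N J (Pi\<^sub>E J A))" .
qed

lemma emeasure_tuple_conf:
  "B \<in> sets borel \<Longrightarrow> emeasure (tuple_conf ys) B = (\<Sum>i<length ys. indicator B (ys ! i))"
proof -
  assume B: "B \<in> sets borel"
  then have "emeasure (tuple_conf ys) B = (\<integral>\<^sup>+x. indicator B x \<partial>tuple_conf ys)"
    by (simp add: tuple_conf_def)
  also have "\<dots> = (\<integral>\<^sup>+i. indicator B (ys ! i) \<partial>count_space {..<length ys})"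
    unfolding tuple_conf_def using B by (intro nn_integral_dirac_sum) auto
  also have "\<dots> = (\<Sum>i<length ys. indicator B (ys ! i))"
    by (simp add: nn_integral_count_space_finite)
  finally show ?thesis .
qed

lemma sets_tuple_conf [simp, measurable_cong]: "sets (tuple_conf ys) = sets borel"
  by (simp add: tuple_conf_def)

lemma measurable_emeasure_tuple_conf:
  "B \<in> sets borel \<Longrightarrow> (\<lambda>ys. emeasure (tuple_conf ys) B) \<in> borel_measurable borel"
proof (rule measurable_from_list)
  assume [measurable]: "B \<in> sets borel"
  show "(\<lambda>ys. \<Sum>i<n. indicator B (entry i ys) :: ennreal) \<in> borel_measurable borel" for n
    by measurable
  show "emeasure (tuple_conf ys) B = (\<Sum>i<n. indicator B (entry i ys))" if "length ys = n" for n ys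
    using that by (simp add: emeasure_tuple_conf entry_def)
qed

lemma tuple_conf_in_configurations: "tuple_conf ys \<in> configurations"
  unfolding tuple_conf_def by (intro dirac_sum_in_configurations) auto

lemma measurable_tuple_conf: "tuple_conf \<in> measurable borel gconf_space"
  by (rule measurable_evaluation_spaceI)
    (simp_all add: tuple_conf_in_configurations measurable_emeasure_tuple_conf)

lemma measurable_superpose:
  assumes "countable I"
  shows "superpose I \<in> measurable (\<Pi>\<^sub>M i\<in>I. gconf_space) gconf_space"
proof (rule measurable_evaluation_spaceI)
  fix m :: "'a \<Rightarrow> 'b measure" assume "m \<in> space (\<Pi>\<^sub>M i\<in>I. gconf_space)"
  then show "superpose I m \<in> configurations"
    using assms by (intro superpose_in_configurations) (auto simp: space_PiM)
next
  fix B :: "'b set" assume B: "B \<in> sets borel"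
  have "(\<lambda>m. emeasure (m i) B) \<in> borel_measurable (\<Pi>\<^sub>M i\<in>I. gconf_space)" if "i \<in> I" for i
    by (rule measurable_compose[OF measurable_component_singleton[OF that] measurable_emeasure_evaluation[OF B]])
  then have "(\<lambda>m. \<integral>\<^sup>+i. emeasure (m i) B \<partial>count_space I) \<in> borel_measurable (\<Pi>\<^sub>M i\<in>I. gconf_space)"
    using assms by (intro measurable_nn_integral_count_space)
  moreover have "emeasure (superpose I m) B = (\<integral>\<^sup>+i. emeasure (m i) B \<partial>count_space I)"
    if "m \<in> space (\<Pi>\<^sub>M i\<in>I. gconf_space)" for m :: "'a \<Rightarrow> 'b measure"
    using that B by (intro emeasure_superpose sets_configuration) (auto simp: space_PiM)
  ultimately show "(\<lambda>m. emeasure (superpose I m) B) \<in> borel_measurable (\<Pi>\<^sub>M i\<in>I. gconf_space)"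
    by (subst measurable_cong) auto
qed

text \<open>The mass of \<open>B\<close> under the image is the integral, against the marked
  configuration, of the number of tuple entries in \<open>B\<close>.\<close>

lemma measurable_cluster_map:
  "cluster_map \<in> measurable (conf_space :: ('a::{t2_space, second_countable_topology} \<times> 'a list) measure measure) gconf_space"
proof (rule measurable_evaluation_spaceI)
  fix \<gamma> :: "('a \<times> 'a list) measure" assume "\<gamma> \<in> space conf_space"
  then have "countable (points \<gamma>)" by (intro proper_eq_dirac_sum(1)) simp
  then show "cluster_map \<gamma> \<in> configurations"
    unfolding cluster_map_def by (intro superpose_in_configurations tuple_conf_in_configurations)
next
  fix B :: "'a set" assume B: "B \<in> sets borel"
  have m: "(\<lambda>z. emeasure (tuple_conf (snd z)) B) \<in> borel_measurable (borel :: ('a \<times> 'a list) measure)"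
    unfolding borel_prod[symmetric]
    by (rule measurable_compose[OF measurable_snd measurable_emeasure_tuple_conf[OF B]])
  then have "(\<lambda>\<gamma>. \<integral>\<^sup>+z. emeasure (tuple_conf (snd z)) B \<partial>\<gamma>) \<in> borel_measurable (conf_space :: ('a \<times> 'a list) measure measure)"
    by (intro measurable_nn_integral_evaluation proper_subset_configurations)
  moreover have "emeasure (cluster_map \<gamma>) B = (\<integral>\<^sup>+z. emeasure (tuple_conf (snd z)) B \<partial>\<gamma>)"
    if "\<gamma> \<in> space conf_space" for \<gamma> :: "('a \<times> 'a list) measure"
    using that B m by (simp add: cluster_map_def emeasure_superpose nn_integral_proper)
  ultimately show "(\<lambda>\<gamma>. emeasure (cluster_map \<gamma>) B) \<in> borel_measurable (conf_space :: ('a \<times> 'a list) measure measure)"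
    by (subst measurable_cong) auto
qed

text \<open>The random marked configuration inside \<open>marked_measure\<close>, for fixed centres;
  \<open>\<omega>\<close> matters only on the centres.\<close>

definition mark :: "'x measure \<Rightarrow> ('x \<Rightarrow> 'x list) \<Rightarrow> ('x::topological_space \<times> 'x list) measure" where
  "mark \<gamma> \<omega> = dirac_sum (points \<gamma>) (\<lambda>x. (x, \<omega> x))"

text \<open>A compact set of marked points projects to a compact set of centres, which gives local
  finiteness. Distinct centres stay distinct after marking, so no multiple points arise.\<close>

lemma mark_proper:
  fixes \<gamma> :: "'x::t2_space measure"
  assumes "\<gamma> \<in> proper_configurations"
  shows "mark \<gamma> \<omega> \<in> proper_configurations"
  unfolding mark_def
proof (rule dirac_sum_proper)
  show "countable (points \<gamma>)" using assms by (rule proper_eq_dirac_sum)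
  show "inj_on (\<lambda>x. (x, \<omega> x)) (points \<gamma>)" by (auto simp: inj_on_def)
  fix K :: "('x \<times> 'x list) set" assume "compact K"
  then have "compact (fst ` K)" by (intro compact_continuous_image continuous_on_fst continuous_on_id)
  then have "finite (points \<gamma> \<inter> fst ` K)" using assms by (rule finite_points_compact[rotated])
  then show "finite {x \<in> points \<gamma>. (x, \<omega> x) \<in> K}"
    by (rule finite_subset[rotated]) force
qed

lemma points_mark: "points (mark \<gamma> \<omega>) = (\<lambda>x. (x, \<omega> x)) ` points \<gamma>"
  for \<gamma> :: "'x::t2_space measure"
  unfolding mark_def by (rule points_dirac_sum)

lemma cluster_map_mark:
  fixes \<gamma> :: "'x::t2_space measure"
  shows "cluster_map (mark \<gamma> \<omega>) = superpose (points \<gamma>) (\<lambda>x. tuple_conf (\<omega> x))"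
proof (rule measure_eqI)
  fix B assume "B \<in> sets (cluster_map (mark \<gamma> \<omega>))"
  then have B: "B \<in> sets borel" by (simp add: cluster_map_def)
  have bij: "bij_betw (\<lambda>x. (x, \<omega> x)) (points \<gamma>) (points (mark \<gamma> \<omega>))"
    by (simp add: points_mark bij_betw_def inj_on_def)
  have "emeasure (cluster_map (mark \<gamma> \<omega>)) B = (\<integral>\<^sup>+z. emeasure (tuple_conf (snd z)) B \<partial>count_space (points (mark \<gamma> \<omega>)))"
    unfolding cluster_map_def using B by (intro emeasure_superpose) auto
  also have "\<dots> = (\<integral>\<^sup>+x. emeasure (tuple_conf (\<omega> x)) B \<partial>count_space (points \<gamma>))"
    by (subst nn_integral_bij_count_space[OF bij, symmetric]) simp
  also have "\<dots> = emeasure (superpose (points \<gamma>) (\<lambda>x. tuple_conf (\<omega> x))) B"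
    using B by (intro emeasure_superpose[symmetric]) auto
  finally show "emeasure (cluster_map (mark \<gamma> \<omega>)) B = emeasure (superpose (points \<gamma>) (\<lambda>x. tuple_conf (\<omega> x))) B" .
qed (simp add: cluster_map_def)

text \<open>The cover \<open>W\<close> is what is taken from the manifold at this stage: it makes
  properness a countable condition and exhausts the centres by finite parts.\<close>

locale cluster_setting =
  fixes \<mu> :: "'x::{t2_space, second_countable_topology} measure measure"
    and \<eta> :: "'x \<Rightarrow> 'x list measure" and W :: "nat \<Rightarrow> 'x set"
  assumes W_open: "\<And>n. open (W n)" and W_compact: "\<And>n. compact (closure (W n))" and W_cover: "(\<Union>n. W n) = UNIV"
    and mu_sets: "sets \<mu> = sets conf_space" and mu_prob: "prob_space \<mu>"
    and eta_sets [simp, measurable_cong]: "\<And>x. sets (\<eta> x) = sets borel" and eta_prob: "\<And>x. prob_space (\<eta> x)"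
    and eta_meas: "\<And>B. B \<in> sets borel \<Longrightarrow> (\<lambda>x. emeasure (\<eta> x) B) \<in> borel_measurable borel"
begin

lemma space_mu: "space \<mu> = proper_configurations"
  using sets_eq_imp_space_eq[OF mu_sets] by simp

lemma space_eta [simp]: "space (\<eta> x) = UNIV"
  using sets_eq_imp_space_eq[OF eta_sets[of x]] by simp

definition exhaustion :: "nat \<Rightarrow> 'x set" where
  "exhaustion n = (\<Union>i\<le>n. closure (W i))"

lemma compact_exhaustion: "compact (exhaustion n)"
  unfolding exhaustion_def using W_compact by (intro compact_UN) auto

lemma exhaustion_mono: "m \<le> n \<Longrightarrow> exhaustion m \<subseteq> exhaustion n"
  unfolding exhaustion_def by (intro UN_mono) auto

lemma exhaustion_cover: "\<exists>n. x \<in> exhaustion n"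
proof -
  obtain n where "x \<in> W n" using W_cover by auto
  then have "x \<in> exhaustion n"
    unfolding exhaustion_def using closure_subset by blast
  then show ?thesis ..
qed

lemma compact_subset_exhaustion:
  assumes "compact K"
  shows "\<exists>n. K \<subseteq> exhaustion n"
proof -
  obtain T where T: "finite T" "K \<subseteq> (\<Union>n\<in>T. W n)"
    using compactE_image[OF assms, of UNIV W] W_open W_cover by auto
  have "K \<subseteq> exhaustion (Max (insert 0 T))"
  proof
    fix x assume "x \<in> K"
    then obtain n where "n \<in> T" "x \<in> W n" using T(2) by auto
    then show "x \<in> exhaustion (Max (insert 0 T))"
      unfolding exhaustion_def using T(1) closure_subset[of "W n"] by (intro UN_I[of n]) auto
  qed
  then show ?thesis ..
qed

lemma eta_kernel: "\<eta> \<in> measurable borel (subprob_algebra borel)"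
proof (rule measurable_subprob_algebra)
  show "subprob_space (\<eta> a)" for a
    using eta_prob by (rule prob_space_imp_subprob_space)
qed (auto simp: eta_meas)

abbreviation law :: "'x measure \<Rightarrow> ('x \<Rightarrow> 'x list) measure" where
  "law \<gamma> \<equiv> PiM (points \<gamma>) \<eta>"

lemma prob_law: "prob_space (law \<gamma>)"
  by (intro prob_space_PiM eta_prob)

lemma product_law: "product_prob_space \<eta>"
  unfolding product_prob_space_def product_sigma_finite_def product_prob_space_axioms_def
  using eta_prob by (auto intro: prob_space_imp_sigma_finite)

lemma component_measurable [measurable]:
  "x \<in> points \<gamma> \<Longrightarrow> (\<lambda>\<omega>. \<omega> x) \<in> measurable (law \<gamma>) borel"
  using measurable_component_singleton[of x "points \<gamma>" \<eta>] by (simp cong: measurable_cong_sets)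

lemma section_borel:
  assumes "B \<in> sets (borel :: ('x \<times> 'x list) measure)"
  shows "{ys. (x, ys) \<notin> B} \<in> sets borel"
proof -
  have "Pair x \<in> measurable borel (borel \<Otimes>\<^sub>M (borel :: 'x list measure))" by measurable
  then have "Pair x \<in> measurable borel (borel :: ('x \<times> 'x list) measure)" by (simp add: borel_prod)
  from measurable_sets[OF this, of "- B"] show ?thesis using assms by (simp add: vimage_def)
qed

lemma avoid_eq:
  fixes \<gamma> :: "'x measure"
  assumes "\<gamma> \<in> proper_configurations" "B \<in> sets borel"
  shows "emeasure (mark \<gamma> \<omega>) B = 0 \<longleftrightarrow> (\<forall>x\<in>points \<gamma>. (x, \<omega> x) \<notin> B)"
  using assms mark_proper[OF assms(1), of \<omega>]
  by (auto simp: emeasure_proper points_mark emeasure_count_space_eq_0)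

lemma mark_measurable:
  assumes \<gamma>: "\<gamma> \<in> proper_configurations"
  shows "mark \<gamma> \<in> measurable (law \<gamma>) conf_space"
proof (rule measurable_conf_spaceI)
  show "mark \<gamma> \<omega> \<in> proper_configurations" for \<omega> by (rule mark_proper[OF \<gamma>])
  fix B :: "('x \<times> 'x list) set" assume B: "B \<in> sets borel"
  have "{\<omega> \<in> space (law \<gamma>). \<forall>x\<in>points \<gamma>. \<omega> x \<in> {ys. (x, ys) \<notin> B}} \<in> sets (law \<gamma>)"
  proof (rule sets.sets_Collect_countable_All')
    show "countable (points \<gamma>)" by (rule proper_eq_dirac_sum(1)[OF \<gamma>])
    fix x assume "x \<in> points \<gamma>"
    note [measurable] = section_borel[OF B, of x] component_measurable[OF this]
    show "{\<omega> \<in> space (law \<gamma>). \<omega> x \<in> {ys. (x, ys) \<notin> B}} \<in> sets (law \<gamma>)" by measurable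
  qed
  then show "{\<omega> \<in> space (law \<gamma>). emeasure (mark \<gamma> \<omega>) B = 0} \<in> sets (law \<gamma>)"
    by (simp add: avoid_eq[OF \<gamma> B])
qed

text \<open>Avoiding \<open>B\<close> is the decreasing limit of avoiding it at the finitely many
  centres in \<open>exhaustion n\<close>, whose probability is a finite product by independence.
  Factors at other centres are set to 1 and trivial factors are dropped, which is the shape that
  \<open>measurable_prod_points\<close> handles.\<close>

lemma avoid_probability:
  assumes \<gamma>: "\<gamma> \<in> proper_configurations" and B: "B \<in> sets borel"
  shows "emeasure (law \<gamma>) {\<omega> \<in> space (law \<gamma>). emeasure (mark \<gamma> \<omega>) B = 0} =
    (INF n. ennreal (\<Prod>x | x \<in> points \<gamma> \<and> (if x \<in> exhaustion n then measure (\<eta> x) {ys. (x, ys) \<notin> B} else 1) \<noteq> 1.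
      if x \<in> exhaustion n then measure (\<eta> x) {ys. (x, ys) \<notin> B} else 1))"
proof -
  interpret product_prob_space \<eta> "points \<gamma>" by (rule product_law)
  let ?p = "\<lambda>x. measure (\<eta> x) {ys. (x, ys) \<notin> B}"
  define E where "E n = {\<omega> \<in> space (law \<gamma>). \<forall>x\<in>points \<gamma> \<inter> exhaustion n. \<omega> x \<in> {ys. (x, ys) \<notin> B}}" for n
  have fin: "finite (points \<gamma> \<inter> exhaustion n)" for n
    by (rule finite_points_compact[OF \<gamma> compact_exhaustion])
  have E: "E n \<in> sets (law \<gamma>)" for n
    unfolding E_def
  proof (rule sets.sets_Collect_finite_All)
    fix x assume x: "x \<in> points \<gamma> \<inter> exhaustion n"
    note [measurable] = section_borel[OF B, of x] component_measurable[OF IntD1[OF x]]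
    show "{\<omega> \<in> space (law \<gamma>). \<omega> x \<in> {ys. (x, ys) \<notin> B}} \<in> sets (law \<gamma>)" by measurable
  qed (rule fin)
  have "emeasure (law \<gamma>) (E n) = ennreal (\<Prod>x | x \<in> points \<gamma> \<and> (if x \<in> exhaustion n then ?p x else 1) \<noteq> 1.
      if x \<in> exhaustion n then ?p x else 1)" for n
  proof -
    have "emeasure (law \<gamma>) (E n) = (\<Prod>x\<in>points \<gamma> \<inter> exhaustion n. emeasure (\<eta> x) {ys. (x, ys) \<notin> B})"
      unfolding E_def using fin section_borel[OF B] by (intro emeasure_PiM_Collect) auto
    also have "\<dots> = ennreal (\<Prod>x\<in>points \<gamma> \<inter> exhaustion n. ?p x)"
      by (simp add: M.emeasure_eq_measure prod_ennreal)
    also have "(\<Prod>x\<in>points \<gamma> \<inter> exhaustion n. ?p x) =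
        (\<Prod>x | x \<in> points \<gamma> \<and> (if x \<in> exhaustion n then ?p x else 1) \<noteq> 1. if x \<in> exhaustion n then ?p x else 1)"
      using fin by (intro prod.mono_neutral_cong_right) auto
    finally show ?thesis .
  qed
  moreover have "{\<omega> \<in> space (law \<gamma>). emeasure (mark \<gamma> \<omega>) B = 0} = (\<Inter>n. E n)"
    using exhaustion_cover by (auto simp: E_def avoid_eq[OF \<gamma> B])
  moreover have "decseq E"
    using exhaustion_mono by (force simp: decseq_def E_def)
  then have "(INF n. emeasure (law \<gamma>) (E n)) = emeasure (law \<gamma>) (\<Inter>n. E n)"
    using E by (intro INF_emeasure_decseq) auto
  ultimately show ?thesis by simp
qed

definition kernel :: "'x measure \<Rightarrow> ('x \<times> 'x list) measure measure" where
  "kernel \<gamma> = distr (law \<gamma>) conf_space (mark \<gamma>)"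

lemma prob_kernel: "\<gamma> \<in> proper_configurations \<Longrightarrow> prob_space (kernel \<gamma>)"
  unfolding kernel_def by (intro prob_space.prob_space_distr prob_law mark_measurable)

text \<open>Void events are an intersection-stable generator, so only their probabilities have to
  depend measurably on the centres; these are the infima of finite products from
  \<open>avoid_probability\<close>.\<close>

lemma kernel_measurable: "kernel \<in> measurable \<mu> (subprob_algebra conf_space)"
proof (rule measurable_subprob_algebra_generated[OF sets_conf_space Int_stable_void_events void_events_Pow])
  fix \<gamma> assume "\<gamma> \<in> space \<mu>"
  then show "subprob_space (kernel \<gamma>)" "sets (kernel \<gamma>) = sets conf_space"
    using prob_kernel by (auto simp: space_mu kernel_def intro: prob_space_imp_subprob_space)
next
  have "(\<lambda>\<gamma>. emeasure (kernel \<gamma>) proper_configurations) \<in> borel_measurable \<mu> \<longleftrightarrow> (\<lambda>\<gamma>. 1 :: ennreal) \<in> borel_measurable \<mu>"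
  proof (rule measurable_cong)
    fix \<gamma> assume "\<gamma> \<in> space \<mu>"
    then have "prob_space (kernel \<gamma>)" by (simp add: space_mu prob_kernel)
    from prob_space.emeasure_space_1[OF this] show "emeasure (kernel \<gamma>) proper_configurations = 1"
      by (simp add: kernel_def)
  qed
  then show "(\<lambda>\<gamma>. emeasure (kernel \<gamma>) proper_configurations) \<in> borel_measurable \<mu>" by simp
next
  fix A :: "('x \<times> 'x list) measure set" assume "A \<in> void_events"
  then obtain B where A: "A = {\<gamma>\<in>proper_configurations. emeasure \<gamma> B = 0}" and B: "B \<in> sets borel"
    by (auto simp: void_events_def)
  then have A_sets: "A \<in> sets conf_space"
    unfolding sets_conf_space by (auto simp: void_events_def)
  define g where "g n x = (if x \<in> exhaustion n then measure (\<eta> x) {ys. (x, ys) \<notin> B} else 1)" for n x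
  have gm: "g n \<in> borel_measurable borel" for n
  proof -
    have K: "exhaustion n \<in> sets borel"
      using compact_imp_closed[OF compact_exhaustion] by simp
    \<comment> \<open>The complement of \<open>B\<close> is a Borel set of pairs, so the
      probabilities of its sections are measurable in \<open>x\<close> by the kernel property of
      \<open>\<eta>\<close>.\<close>
    have "(SIGMA x:space borel. {ys. (x, ys) \<notin> B}) = - B" by auto
    moreover have "- B \<in> sets (borel \<Otimes>\<^sub>M (borel :: 'x list measure))"
      unfolding borel_prod using B by (rule borel_comp)
    ultimately have "(SIGMA x:space borel. {ys. (x, ys) \<notin> B}) \<in> sets (borel \<Otimes>\<^sub>M (borel :: 'x list measure))"
      by (simp only:)
    from emeasure_measurable_subprob_algebra2[OF this eta_kernel]
    have "(\<lambda>x. emeasure (\<eta> x) {ys. (x, ys) \<notin> B}) \<in> borel_measurable borel" .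
    then show ?thesis
      unfolding g_def measure_def using K by measurable
  qed
  have eq: "emeasure (kernel \<gamma>) A = (INF n. ennreal (\<Prod>x | x \<in> points \<gamma> \<and> g n x \<noteq> 1. g n x))"
    if "\<gamma> \<in> space \<mu>" for \<gamma>
  proof -
    have \<gamma>: "\<gamma> \<in> proper_configurations" using that by (simp add: space_mu)
    have "emeasure (kernel \<gamma>) A = emeasure (law \<gamma>) (mark \<gamma> -` A \<inter> space (law \<gamma>))"
      unfolding kernel_def by (rule emeasure_distr[OF mark_measurable[OF \<gamma>] A_sets])
    also have "mark \<gamma> -` A \<inter> space (law \<gamma>) = {\<omega> \<in> space (law \<gamma>). emeasure (mark \<gamma> \<omega>) B = 0}"
      using mark_proper[OF \<gamma>] by (auto simp: A)
    finally show ?thesis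
      unfolding g_def by (simp only: avoid_probability[OF \<gamma> B])
  qed
  have "(\<lambda>\<gamma>. INF n. ennreal (\<Prod>x | x \<in> points \<gamma> \<and> g n x \<noteq> 1. g n x)) \<in> borel_measurable conf_space"
  proof (intro borel_measurable_INF measurable_compose[OF measurable_prod_points measurable_ennreal])
    show "0 \<le> g n z" for n z by (simp add: g_def)
  qed (use gm in auto)
  then have "(\<lambda>\<gamma>. INF n. ennreal (\<Prod>x | x \<in> points \<gamma> \<and> g n x \<noteq> 1. g n x)) \<in> borel_measurable \<mu>"
    by (simp only: measurable_cong_sets[OF mu_sets refl])
  then show "(\<lambda>\<gamma>. emeasure (kernel \<gamma>) A) \<in> borel_measurable \<mu>"
    by (subst measurable_cong[OF eq])
qed

lemma marked_measure_eq: "marked_measure \<mu> \<eta> = \<mu> \<bind> kernel"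
  by (simp add: marked_measure_def kernel_def[abs_def] mark_def[abs_def])

lemma mu_not_empty: "space \<mu> \<noteq> {}"
  using mu_prob by (rule prob_space.not_empty)

lemma sets_marked [simp, measurable_cong]: "sets (marked_measure \<mu> \<eta>) = sets conf_space"
  unfolding marked_measure_eq using mu_not_empty by (intro sets_bind) (auto simp: kernel_def)

lemma nn_integral_marked:
  assumes "f \<in> borel_measurable conf_space"
  shows "(\<integral>\<^sup>+\<gamma>h. f \<gamma>h \<partial>marked_measure \<mu> \<eta>) = (\<integral>\<^sup>+\<gamma>. (\<integral>\<^sup>+\<omega>. f (mark \<gamma> \<omega>) \<partial>law \<gamma>) \<partial>\<mu>)"
proof -
  have "(\<integral>\<^sup>+\<gamma>h. f \<gamma>h \<partial>marked_measure \<mu> \<eta>) = (\<integral>\<^sup>+\<gamma>. (\<integral>\<^sup>+\<gamma>h. f \<gamma>h \<partial>kernel \<gamma>) \<partial>\<mu>)"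
    unfolding marked_measure_eq by (rule nn_integral_bind[OF assms kernel_measurable])
  also have "\<dots> = (\<integral>\<^sup>+\<gamma>. (\<integral>\<^sup>+\<omega>. f (mark \<gamma> \<omega>) \<partial>law \<gamma>) \<partial>\<mu>)"
    using assms by (intro nn_integral_cong) (simp add: kernel_def space_mu nn_integral_distr mark_measurable)
  finally show ?thesis .
qed

lemma AE_marked:
  assumes P: "{\<gamma>h \<in> proper_configurations. P \<gamma>h} \<in> sets conf_space"
    and AE: "AE \<gamma> in \<mu>. AE \<omega> in law \<gamma>. P (mark \<gamma> \<omega>)"
  shows "AE \<gamma>h in marked_measure \<mu> \<eta>. P \<gamma>h"
  unfolding marked_measure_eq
proof (subst AE_bind[OF kernel_measurable])
  show "Measurable.pred conf_space P"
    using P by (simp add: pred_def)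
  show "AE \<gamma> in \<mu>. AE \<gamma>h in kernel \<gamma>. P \<gamma>h"
    using AE AE_space
  proof eventually_elim
    case (elim \<gamma>)
    then show ?case
      unfolding kernel_def using P by (subst AE_distr_iff[OF mark_measurable]) (auto simp: space_mu)
  qed
qed

lemma prob_marked: "prob_space (marked_measure \<mu> \<eta>)"
proof
  have "emeasure (marked_measure \<mu> \<eta>) (space (marked_measure \<mu> \<eta>)) = (\<integral>\<^sup>+\<gamma>h. 1 \<partial>marked_measure \<mu> \<eta>)" by simp
  also have "\<dots> = (\<integral>\<^sup>+\<gamma>. (\<integral>\<^sup>+\<omega>. 1 \<partial>law \<gamma>) \<partial>\<mu>)" by (rule nn_integral_marked) simp
  also have "\<dots> = 1"
    using prob_space.emeasure_space_1[OF prob_law] prob_space.emeasure_space_1[OF mu_prob] by simp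
  finally show "emeasure (marked_measure \<mu> \<eta>) (space (marked_measure \<mu> \<eta>)) = 1" .
qed

text \<open>The relation between cluster measure and marked measure through the projection. For
  fixed centres, superposing images of independent tuples is the same as marking and then
  projecting; taking images commutes with averaging over the centres.\<close>

lemma gen_cluster_measure_eq: "gen_cluster_measure \<mu> \<eta> = distr (marked_measure \<mu> \<eta>) gconf_space cluster_map"
proof -
  have "distr (\<Pi>\<^sub>M x\<in>points \<gamma>. distr (\<eta> x) gconf_space tuple_conf) gconf_space (\<lambda>\<omega>. superpose (points \<gamma>) \<omega>) =
      distr (kernel \<gamma>) gconf_space cluster_map" if "\<gamma> \<in> space \<mu>" for \<gamma>
  proof -
    have \<gamma>: "\<gamma> \<in> proper_configurations" using that by (simp add: space_mu)
    have cnt: "countable (points \<gamma>)" by (rule proper_eq_dirac_sum(1)[OF \<gamma>])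
    have tc: "tuple_conf \<in> measurable (\<eta> x) gconf_space" for x
      using measurable_tuple_conf by (simp cong: measurable_cong_sets)
    have T: "(\<lambda>\<omega>. \<lambda>x\<in>points \<gamma>. tuple_conf (\<omega> x)) \<in> measurable (law \<gamma>) (\<Pi>\<^sub>M x\<in>points \<gamma>. gconf_space)"
      by (intro measurable_restrict measurable_compose[OF component_measurable measurable_tuple_conf])
    have "distr (\<Pi>\<^sub>M x\<in>points \<gamma>. distr (\<eta> x) gconf_space tuple_conf) gconf_space (\<lambda>\<omega>. superpose (points \<gamma>) \<omega>) =
        distr (law \<gamma>) gconf_space (superpose (points \<gamma>) \<circ> (\<lambda>\<omega>. \<lambda>x\<in>points \<gamma>. tuple_conf (\<omega> x)))"
      by (subst PiM_distr[OF eta_prob tc]) (intro distr_distr measurable_superpose[OF cnt] T)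
    also have "\<dots> = distr (law \<gamma>) gconf_space (cluster_map \<circ> mark \<gamma>)"
    proof (intro distr_cong refl)
      fix \<omega> :: "'x \<Rightarrow> 'x list"
      \<comment> \<open>\<open>superpose\<close> reads only the values on the centres, so
        restricting the family changes nothing.\<close>
      have "superpose (points \<gamma>) (\<lambda>x\<in>points \<gamma>. tuple_conf (\<omega> x)) = superpose (points \<gamma>) (\<lambda>x. tuple_conf (\<omega> x))"
        by (intro measure_eqI) (auto simp: emeasure_superpose intro!: nn_integral_cong)
      then show "(superpose (points \<gamma>) \<circ> (\<lambda>\<omega>. \<lambda>x\<in>points \<gamma>. tuple_conf (\<omega> x))) \<omega> = (cluster_map \<circ> mark \<gamma>) \<omega>"
        by (simp add: cluster_map_mark)
    qed
    also have "\<dots> = distr (kernel \<gamma>) gconf_space cluster_map"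
      unfolding kernel_def by (rule distr_distr[OF measurable_cluster_map mark_measurable[OF \<gamma>], symmetric])
    finally show ?thesis .
  qed
  then have "gen_cluster_measure \<mu> \<eta> = \<mu> \<bind> (\<lambda>\<gamma>. distr (kernel \<gamma>) gconf_space cluster_map)"
    unfolding gen_cluster_measure_def by (intro bind_cong refl) (simp_all)
  also have "\<dots> = distr (\<mu> \<bind> kernel) gconf_space cluster_map"
    by (rule distr_bind[OF kernel_measurable mu_not_empty measurable_cluster_map, symmetric])
  finally show ?thesis by (simp add: marked_measure_eq)
qed

lemma sets_proper: "proper_configurations \<in> sets (gconf_space :: 'x measure measure)"
  by (rule sets_proper_configurations[OF W_open W_compact W_cover])

end

section \<open>Transformations of product measures\<close>

text \<open>A function of finitely many coordinates sees only the finite product over them, to which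
  Tonelli applies.\<close>

lemma (in product_prob_space) nn_integral_PiM_prod:
  assumes J: "finite J" "J \<subseteq> I" and g: "\<And>j. j \<in> J \<Longrightarrow> g j \<in> borel_measurable (M j)"
  shows "(\<integral>\<^sup>+\<omega>. (\<Prod>j\<in>J. g j (\<omega> j)) \<partial>PiM I M) = (\<Prod>j\<in>J. \<integral>\<^sup>+x. g j x \<partial>M j)"
proof -
  have m: "(\<lambda>\<omega>. \<Prod>j\<in>J. g j (\<omega> j)) \<in> borel_measurable (PiM J M)"
    using g by (intro borel_measurable_prod_ennreal measurable_compose[OF measurable_component_singleton]) auto
  have r: "(\<lambda>\<omega>. restrict \<omega> J) \<in> measurable (PiM I M) (PiM J M)"
    using J(2) by (rule measurable_restrict_subset)
  have "(\<Prod>j\<in>J. \<integral>\<^sup>+x. g j x \<partial>M j) = (\<integral>\<^sup>+\<omega>. (\<Prod>j\<in>J. g j (\<omega> j)) \<partial>PiM J M)"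
    using J(1) g by (rule product_nn_integral_prod[symmetric])
  also have "\<dots> = (\<integral>\<^sup>+\<omega>. (\<Prod>j\<in>J. g j (\<omega> j)) \<partial>distr (PiM I M) (PiM J M) (\<lambda>\<omega>. restrict \<omega> J))"
    using J by (simp add: distr_PiM_restrict_finite)
  also have "\<dots> = (\<integral>\<^sup>+\<omega>. (\<Prod>j\<in>J. g j (restrict \<omega> J j)) \<partial>PiM I M)"
    by (rule nn_integral_distr[OF r]) (use m in simp)
  also have "\<dots> = (\<integral>\<^sup>+\<omega>. (\<Prod>j\<in>J. g j (\<omega> j)) \<partial>PiM I M)"
    by (intro nn_integral_cong prod.cong) auto
  finally show ?thesis ..
qed

text \<open>Checked on finite cylinders, which determine measures on the infinite product.\<close>

lemma (in product_prob_space) distr_PiM_finite_density: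
  assumes J: "finite J" "J \<subseteq> I" and F: "\<And>i. i \<in> J \<Longrightarrow> F i \<in> measurable (M i) (M i)"
    and r: "\<And>i. i \<in> J \<Longrightarrow> r i \<in> borel_measurable (M i)"
    and eq: "\<And>i. i \<in> J \<Longrightarrow> distr (M i) (M i) (F i) = density (M i) (r i)"
  defines "T \<equiv> \<lambda>\<omega>. \<lambda>i\<in>I. if i \<in> J then F i (\<omega> i) else \<omega> i"
  shows "T \<in> measurable (PiM I M) (PiM I M)"
    and "distr (PiM I M) (PiM I M) T = density (PiM I M) (\<lambda>\<omega>. \<Prod>i\<in>J. r i (\<omega> i))" (is "?L = ?R")
proof -
  show T: "T \<in> measurable (PiM I M) (PiM I M)"
    unfolding T_def
  proof (rule measurable_restrict)
    fix i assume i: "i \<in> I"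
    show "(\<lambda>\<omega>. if i \<in> J then F i (\<omega> i) else \<omega> i) \<in> measurable (PiM I M) (M i)"
      using measurable_component_singleton[OF i, of M] measurable_compose[OF measurable_component_singleton[OF i, of M] F]
      by (cases "i \<in> J") auto
  qed
  have rm: "(\<lambda>\<omega>. \<Prod>i\<in>J. r i (\<omega> i)) \<in> borel_measurable (PiM I M)"
    using J(2) r by (intro borel_measurable_prod_ennreal measurable_compose[OF measurable_component_singleton]) auto
  show "?L = ?R"
  proof (rule measure_eqI_PiM_infinite)
    show "sets ?L = sets (PiM I M)" "sets ?R = sets (PiM I M)" by simp_all
    interpret L: prob_space ?L by (rule prob_space_distr[OF T])
    show "finite_measure ?L" by unfold_locales
    fix A J' assume J': "finite J'" "J' \<subseteq> I" and A: "\<And>i. i \<in> J' \<Longrightarrow> A i \<in> sets (M i)"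
    \<comment> \<open>The base of the cylinder will be enlarged by \<open>J\<close>, with trivial
      constraints on the new coordinates, so that it contains all coordinates moved or
      weighted.\<close>
    define A' where "A' i = (if i \<in> J' then A i else space (M i))" for i
    have A': "A' i \<in> sets (M i)" for i using A by (auto simp: A'_def)
    let ?K = "J \<union> J'"
    let ?E = "{\<omega> \<in> space (PiM I M). \<forall>i\<in>?K. \<omega> i \<in> A' i}"
    have K: "finite ?K" "?K \<subseteq> I" using J J' by auto
    have E_eq: "prod_emb I M J' (Pi\<^sub>E J' A) = ?E"
      using J(2) J'(2) by (auto simp: prod_emb_def space_PiM PiE_iff A'_def subset_iff extensional_def)
    have E: "?E \<in> sets (PiM I M)"
      unfolding E_eq[symmetric] using J' A by (intro sets_PiM_I) auto
    let ?B = "\<lambda>i. if i \<in> J then F i -` A' i \<inter> space (M i) else A' i"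
    have B: "?B i \<in> sets (M i)" for i
      using A' measurable_sets[OF F] by auto
    have "emeasure ?L ?E = emeasure (PiM I M) (T -` ?E \<inter> space (PiM I M))"
      by (rule emeasure_distr[OF T E])
    also have "T -` ?E \<inter> space (PiM I M) = {\<omega> \<in> space (PiM I M). \<forall>i\<in>?K. \<omega> i \<in> ?B i}"
    proof -
      have "T \<omega> \<in> ?E \<longleftrightarrow> (\<forall>i\<in>?K. \<omega> i \<in> ?B i)" if \<omega>: "\<omega> \<in> space (PiM I M)" for \<omega>
      proof -
        have "T \<omega> \<in> ?E \<longleftrightarrow> (\<forall>i\<in>?K. T \<omega> i \<in> A' i)"
          using measurable_space[OF T \<omega>] by simp
        also have "\<dots> \<longleftrightarrow> (\<forall>i\<in>?K. \<omega> i \<in> ?B i)"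
        proof (intro ball_cong refl)
          fix i assume "i \<in> ?K"
          then have "i \<in> I" "\<omega> i \<in> space (M i)" using K(2) \<omega> by (auto simp: space_PiM)
          then show "T \<omega> i \<in> A' i \<longleftrightarrow> \<omega> i \<in> ?B i" by (simp add: T_def)
        qed
        finally show ?thesis .
      qed
      then show ?thesis by blast
    qed
    also have "emeasure (PiM I M) \<dots> = (\<Prod>i\<in>?K. emeasure (M i) (?B i))"
      using K B by (intro emeasure_PiM_Collect) auto
    also have "\<dots> = (\<Prod>i\<in>?K. \<integral>\<^sup>+x. (if i \<in> J then r i x else 1) * indicator (A' i) x \<partial>M i)"
    proof (intro prod.cong refl)
      fix i
      show "emeasure (M i) (?B i) = (\<integral>\<^sup>+x. (if i \<in> J then r i x else 1) * indicator (A' i) x \<partial>M i)"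
      proof (cases "i \<in> J")
        case True
        then have "emeasure (M i) (?B i) = emeasure (distr (M i) (M i) (F i)) (A' i)"
          using A' F by (simp add: emeasure_distr)
        also have "\<dots> = (\<integral>\<^sup>+x. r i x * indicator (A' i) x \<partial>M i)"
          using True A' r by (simp add: eq emeasure_density)
        finally show ?thesis using True by simp
      qed (use A' in simp)
    qed
    also have "\<dots> = (\<integral>\<^sup>+\<omega>. (\<Prod>i\<in>?K. (if i \<in> J then r i (\<omega> i) else 1) * indicator (A' i) (\<omega> i)) \<partial>PiM I M)"
    proof (rule nn_integral_PiM_prod[OF K, symmetric])
      fix i
      show "(\<lambda>x. (if i \<in> J then r i x else 1) * indicator (A' i) x) \<in> borel_measurable (M i)"
        using r A' by (cases "i \<in> J") auto
    qed
    also have "\<dots> = (\<integral>\<^sup>+\<omega>. (\<Prod>i\<in>J. r i (\<omega> i)) * indicator ?E \<omega> \<partial>PiM I M)"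
    proof (intro nn_integral_cong)
      fix \<omega> assume \<omega>: "\<omega> \<in> space (PiM I M)"
      have "(\<Prod>i\<in>?K. if i \<in> J then r i (\<omega> i) else 1) = (\<Prod>i\<in>J. r i (\<omega> i))"
        using K by (intro prod.mono_neutral_cong_right) auto
      moreover have "(\<Prod>i\<in>?K. indicator (A' i) (\<omega> i)) = (indicator ?E \<omega> :: ennreal)"
        using K(1) \<omega> by (auto simp: indicator_def intro!: prod.neutral prod_zero)
      ultimately show "(\<Prod>i\<in>?K. (if i \<in> J then r i (\<omega> i) else 1) * indicator (A' i) (\<omega> i)) =
          (\<Prod>i\<in>J. r i (\<omega> i)) * indicator ?E \<omega>"
        by (simp add: prod.distrib)
    qed
    also have "\<dots> = emeasure ?R ?E"
      by (rule emeasure_density[OF rm E, symmetric])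
    finally show "emeasure ?L (prod_emb I M J' (Pi\<^sub>E J' A)) = emeasure ?R (prod_emb I M J' (Pi\<^sub>E J' A))"
      by (simp only: E_eq)
  qed
qed

text \<open>If almost surely only finitely many coordinates lie in the sets \<open>H i\<close> outside of which \<open>F i\<close> is
  the identity, the infinite product is exhausted by events on which only finitely many coordinates
  are moved.\<close>

lemma (in product_prob_space) nn_integral_PiM_transform:
  fixes \<rho> :: "'i \<Rightarrow> 'a \<Rightarrow> real"
  assumes I: "countable I" and F: "\<And>i. F i \<in> measurable (M i) (M i)" and H: "\<And>i. H i \<in> sets (M i)"
    and \<rho>: "\<And>i. \<rho> i \<in> borel_measurable (M i)" and \<rho>_nonneg: "\<And>i x. 0 \<le> \<rho> i x"
    and \<rho>_out: "\<And>i x. x \<notin> H i \<Longrightarrow> \<rho> i x = 1"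
    and F_out: "\<And>i x. x \<notin> H i \<Longrightarrow> F i x = x" and F_in: "\<And>i x. F i x \<in> H i \<longleftrightarrow> x \<in> H i"
    and eq: "\<And>i. distr (M i) (M i) (F i) = density (M i) (\<lambda>x. ennreal (\<rho> i x))"
    and fin: "AE \<omega> in PiM I M. finite {i \<in> I. \<omega> i \<in> H i}"
    and f: "f \<in> borel_measurable (PiM I M)"
  shows "(\<integral>\<^sup>+\<omega>. f (\<lambda>i\<in>I. F i (\<omega> i)) \<partial>PiM I M) =
    (\<integral>\<^sup>+\<omega>. f \<omega> * ennreal (\<Prod>i | i \<in> I \<and> \<rho> i (\<omega> i) \<noteq> 1. \<rho> i (\<omega> i)) \<partial>PiM I M)"
proof -
  \<comment> \<open>Initial segments of an enumeration of \<open>I\<close>: finite sets that grow to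
    \<open>I\<close>.\<close>
  define J where "J n = {i \<in> I. to_nat_on I i < n}" for n
  have J: "finite (J n)" "J n \<subseteq> I" for n
  proof -
    have "J n \<subseteq> from_nat_into I ` {..<n}"
      using I by (force simp: J_def intro: image_eqI[of _ _ "to_nat_on I _"])
    then show "finite (J n)" by (rule finite_subset) simp
    show "J n \<subseteq> I" by (auto simp: J_def)
  qed
  have J_mono: "m \<le> n \<Longrightarrow> J m \<subseteq> J n" for m n by (auto simp: J_def)
  \<comment> \<open>On \<open>E n\<close> the coordinates outside \<open>J n\<close> avoid the sets
    \<open>H i\<close>, so that the full and the truncated transformation coincide there and all
    other density factors are 1.\<close>
  define E where "E n = {\<omega> \<in> space (PiM I M). \<forall>i\<in>I - J n. \<omega> i \<in> space (M i) - H i}" for n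
  define T where "T n \<omega> = (\<lambda>i\<in>I. if i \<in> J n then F i (\<omega> i) else \<omega> i)" for n \<omega>
  define R where "R n \<omega> = (\<Prod>i\<in>J n. ennreal (\<rho> i (\<omega> i)))" for n \<omega>
  have comp: "i \<in> I \<Longrightarrow> \<omega> \<in> space (PiM I M) \<Longrightarrow> \<omega> i \<in> space (M i)" for i \<omega>
    by (auto simp: space_PiM)
  have E[measurable]: "E n \<in> sets (PiM I M)" for n
    unfolding E_def
  proof (rule sets.sets_Collect_countable_All')
    show "countable (I - J n)" using I by (rule countable_subset[rotated]) auto
    fix i assume i: "i \<in> I - J n"
    have "(\<lambda>\<omega>. \<omega> i) -` (space (M i) - H i) \<inter> space (PiM I M) \<in> sets (PiM I M)"
      using i H by (intro measurable_sets[OF measurable_component_singleton]) auto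
    then show "{\<omega> \<in> space (PiM I M). \<omega> i \<in> space (M i) - H i} \<in> sets (PiM I M)"
      by (simp add: vimage_def Int_def conj_commute)
  qed
  have E_mono: "m \<le> n \<Longrightarrow> E m \<subseteq> E n" for m n
    using J_mono[of m n] by (auto simp: E_def)
  have R[measurable]: "R n \<in> borel_measurable (PiM I M)" for n
    unfolding R_def using J(2)[of n] \<rho>
    by (intro borel_measurable_prod_ennreal measurable_compose[OF _ measurable_ennreal]
        measurable_compose[OF measurable_component_singleton]) auto
  have T: "T n \<in> measurable (PiM I M) (PiM I M)" "distr (PiM I M) (PiM I M) (T n) = density (PiM I M) (R n)" for n
    using distr_PiM_finite_density[OF J(1)[of n] J(2)[of n], where F = F and r = "\<lambda>i x. ennreal (\<rho> i x)"] F \<rho> eq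
    unfolding T_def[abs_def] R_def[abs_def] by auto
  \<comment> \<open>\<open>E n\<close> constrains only coordinates that \<open>T n\<close> leaves
    fixed, so its indicator can be carried through the transformation.\<close>
  have TE: "T n \<omega> \<in> E n \<longleftrightarrow> \<omega> \<in> E n" if "\<omega> \<in> space (PiM I M)" for n \<omega>
    using that measurable_space[OF T(1)[of n] that] J(2)[of n] by (auto simp: E_def T_def)
  have T_eq: "(\<lambda>i\<in>I. F i (\<omega> i)) = T n \<omega>" if "\<omega> \<in> E n" for n \<omega>
    using that F_out by (auto simp: E_def T_def fun_eq_iff)
  have R_eq: "ennreal (\<Prod>i | i \<in> I \<and> \<rho> i (\<omega> i) \<noteq> 1. \<rho> i (\<omega> i)) = R n \<omega>" if "\<omega> \<in> E n" for n \<omega>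
  proof -
    have "(\<Prod>i\<in>J n. \<rho> i (\<omega> i)) = (\<Prod>i | i \<in> I \<and> \<rho> i (\<omega> i) \<noteq> 1. \<rho> i (\<omega> i))"
      using J[of n] that \<rho>_out by (intro prod.mono_neutral_cong_right) (auto simp: E_def)
    then show ?thesis using \<rho>_nonneg by (simp add: R_def prod_ennreal)
  qed
  have step: "(\<integral>\<^sup>+\<omega>. f (T n \<omega>) * indicator (E n) \<omega> \<partial>PiM I M) = (\<integral>\<^sup>+\<omega>. f \<omega> * R n \<omega> * indicator (E n) \<omega> \<partial>PiM I M)" for n
  proof -
    have m: "(\<lambda>\<omega>. f \<omega> * indicator (E n) \<omega>) \<in> borel_measurable (PiM I M)" using f by measurable
    have "(\<integral>\<^sup>+\<omega>. f (T n \<omega>) * indicator (E n) \<omega> \<partial>PiM I M) = (\<integral>\<^sup>+\<omega>. f (T n \<omega>) * indicator (E n) (T n \<omega>) \<partial>PiM I M)"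
      by (intro nn_integral_cong) (simp add: indicator_def TE)
    also have "\<dots> = (\<integral>\<^sup>+\<omega>. f \<omega> * indicator (E n) \<omega> \<partial>distr (PiM I M) (PiM I M) (T n))"
      by (rule nn_integral_distr[OF T(1), symmetric]) (use m in simp)
    also have "\<dots> = (\<integral>\<^sup>+\<omega>. R n \<omega> * (f \<omega> * indicator (E n) \<omega>) \<partial>PiM I M)"
      unfolding T(2) by (rule nn_integral_density[OF R m])
    finally show ?thesis by (simp add: mult_ac)
  qed
  have AE_E: "AE \<omega> in PiM I M. \<exists>n. \<omega> \<in> E n"
    using fin AE_space
  proof eventually_elim
    case (elim \<omega>)
    \<comment> \<open>One more than the largest number of a coordinate lying in its
      \<open>H i\<close>; the inserted 0 keeps \<open>Max\<close> meaningful when there is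
      none.\<close>
    define n where "n = Suc (Max (insert 0 (to_nat_on I ` {i \<in> I. \<omega> i \<in> H i})))"
    have "i \<in> J n" if "i \<in> I" "\<omega> i \<in> H i" for i
    proof -
      have "to_nat_on I i \<le> Max (insert 0 (to_nat_on I ` {i \<in> I. \<omega> i \<in> H i}))"
        using that elim(1) by (intro Max_ge) auto
      then show ?thesis using that by (simp add: J_def n_def)
    qed
    then have "\<omega> \<in> E n" using elim(2) comp by (auto simp: E_def)
    then show ?case ..
  qed
  \<comment> \<open>The events \<open>E n\<close> increase to a set of full measure. Monotone
    convergence along them is isolated because it is applied to both sides of the formula.\<close>
  have sup: "(\<integral>\<^sup>+\<omega>. g \<omega> \<partial>PiM I M) = (SUP n. \<integral>\<^sup>+\<omega>. g' n \<omega> * indicator (E n) \<omega> \<partial>PiM I M)"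
    if g': "\<And>n. g' n \<in> borel_measurable (PiM I M)" and g: "\<And>n \<omega>. \<omega> \<in> E n \<Longrightarrow> g \<omega> = g' n \<omega>"
    for g :: "('i \<Rightarrow> 'a) \<Rightarrow> ennreal" and g'
  proof -
    let ?h = "\<lambda>n \<omega>. g' n \<omega> * indicator (E n) \<omega>"
    have h: "?h n \<omega> = g \<omega> * indicator (E n) \<omega>" for n \<omega>
      using g by (auto split: split_indicator)
    have inc: "incseq ?h"
      unfolding h using E_mono by (auto simp: incseq_def le_fun_def split: split_indicator)
    have "(\<integral>\<^sup>+\<omega>. g \<omega> \<partial>PiM I M) = (\<integral>\<^sup>+\<omega>. (SUP n. ?h n \<omega>) \<partial>PiM I M)"
    proof (rule nn_integral_cong_AE, use AE_E in eventually_elim)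
      case (elim \<omega>)
      then obtain n where n: "\<omega> \<in> E n" ..
      show "g \<omega> = (SUP n. ?h n \<omega>)"
        unfolding h using n by (intro antisym SUP_upper2[of n] SUP_least) (auto split: split_indicator)
    qed
    also have "\<dots> = (SUP n. \<integral>\<^sup>+\<omega>. ?h n \<omega> \<partial>PiM I M)"
      using inc g' by (intro nn_integral_monotone_convergence_SUP borel_measurable_times_ennreal borel_measurable_indicator E)
    finally show ?thesis .
  qed
  have "(\<integral>\<^sup>+\<omega>. f (\<lambda>i\<in>I. F i (\<omega> i)) \<partial>PiM I M) = (SUP n. \<integral>\<^sup>+\<omega>. f (T n \<omega>) * indicator (E n) \<omega> \<partial>PiM I M)"
    using measurable_compose[OF T(1) f] by (intro sup) (simp_all add: T_eq)
  also have "\<dots> = (SUP n. \<integral>\<^sup>+\<omega>. f \<omega> * R n \<omega> * indicator (E n) \<omega> \<partial>PiM I M)"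
    by (simp only: step)
  also have "\<dots> = (\<integral>\<^sup>+\<omega>. f \<omega> * ennreal (\<Prod>i | i \<in> I \<and> \<rho> i (\<omega> i) \<noteq> 1. \<rho> i (\<omega> i)) \<partial>PiM I M)"
    using f by (intro sup[symmetric]) (simp_all add: R_eq)
  finally show ?thesis .
qed

section \<open>Properness of the superposed clusters\<close>

context cluster_setting
begin

text \<open>First moment argument: the expected number of clusters that hit \<open>B\<close> is the
  sum of the hitting probabilities over the centres. It is finite by assumption, so the number
  itself is finite almost surely.\<close>

lemma AE_finite_hits:
  assumes \<gamma>: "\<gamma> \<in> proper_configurations" and B: "B \<in> sets borel"
    and fin: "(\<integral>\<^sup>+x. emeasure (\<eta> x) {ys. set ys \<inter> B \<noteq> {}} \<partial>\<gamma>) < \<infinity>"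
  shows "AE \<omega> in law \<gamma>. finite {x \<in> points \<gamma>. set (\<omega> x) \<inter> B \<noteq> {}}"
proof -
  let ?H = "{ys. set ys \<inter> B \<noteq> {}}"
  have cnt: "countable (points \<gamma>)" by (rule proper_eq_dirac_sum(1)[OF \<gamma>])
  have H: "?H \<in> sets borel" by (rule sets_list_hit[OF B])
  have ind: "(\<lambda>\<omega>. indicator ?H (\<omega> x) :: ennreal) \<in> borel_measurable (law \<gamma>)" if "x \<in> points \<gamma>" for x
    using component_measurable[OF that] H by measurable
  have "(\<integral>\<^sup>+\<omega>. (\<integral>\<^sup>+x. indicator ?H (\<omega> x) \<partial>count_space (points \<gamma>)) \<partial>law \<gamma>) =
      (\<integral>\<^sup>+x. (\<integral>\<^sup>+\<omega>. indicator ?H (\<omega> x) \<partial>law \<gamma>) \<partial>count_space (points \<gamma>))"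
    using cnt ind by (rule nn_integral_count_space_nn_integral)
  also have "\<dots> = (\<integral>\<^sup>+x. emeasure (\<eta> x) ?H \<partial>count_space (points \<gamma>))"
  proof (intro nn_integral_cong)
    fix x assume "x \<in> space (count_space (points \<gamma>))"
    then have x: "x \<in> points \<gamma>" by simp
    have "(\<integral>\<^sup>+\<omega>. indicator ?H (\<omega> x) \<partial>law \<gamma>) = (\<integral>\<^sup>+ys. indicator ?H ys \<partial>distr (law \<gamma>) (\<eta> x) (\<lambda>\<omega>. \<omega> x))"
      using x H by (intro nn_integral_distr[symmetric]) (auto intro: measurable_component_singleton borel_measurable_indicator)
    also have "\<dots> = emeasure (\<eta> x) ?H"
      using x H eta_prob by (simp add: distr_PiM_component)
    finally show "(\<integral>\<^sup>+\<omega>. indicator ?H (\<omega> x) \<partial>law \<gamma>) = emeasure (\<eta> x) ?H" .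
  qed
  also have "\<dots> = (\<integral>\<^sup>+x. emeasure (\<eta> x) ?H \<partial>\<gamma>)"
    by (rule nn_integral_proper[OF \<gamma> eta_meas[OF H], symmetric])
  finally have "(\<integral>\<^sup>+\<omega>. (\<integral>\<^sup>+x. indicator ?H (\<omega> x) \<partial>count_space (points \<gamma>)) \<partial>law \<gamma>) \<noteq> \<infinity>"
    using fin by simp
  moreover have "(\<lambda>\<omega>. \<integral>\<^sup>+x. indicator ?H (\<omega> x) \<partial>count_space (points \<gamma>)) \<in> borel_measurable (law \<gamma>)"
    using cnt ind by (rule measurable_nn_integral_count_space)
  ultimately have "AE \<omega> in law \<gamma>. (\<integral>\<^sup>+x. indicator ?H (\<omega> x) \<partial>count_space (points \<gamma>)) \<noteq> \<infinity>"
    by (intro nn_integral_PInf_AE)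
  then show ?thesis
  proof eventually_elim
    case (elim \<omega>)
    have "(\<integral>\<^sup>+x. indicator ?H (\<omega> x) \<partial>count_space (points \<gamma>)) =
        (\<integral>\<^sup>+x. indicator {x \<in> points \<gamma>. \<omega> x \<in> ?H} x \<partial>count_space (points \<gamma>))"
      by (intro nn_integral_cong) (auto split: split_indicator)
    also have "\<dots> = emeasure (count_space (points \<gamma>)) {x \<in> points \<gamma>. \<omega> x \<in> ?H}"
      by (intro nn_integral_indicator) auto
    finally show ?case
      using elim by (auto simp: emeasure_count_space split: if_splits)
  qed
qed

text \<open>Fubini on two coordinates: with the cluster at \<open>x\<close> fixed, the cluster at
  \<open>y\<close> almost surely avoids each of its finitely many points. The statement is then
  pulled back from the pair to the full product.\<close>

lemma AE_disjoint_clusters: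
  assumes x: "x \<in> points \<gamma>" "y \<in> points \<gamma>" "x \<noteq> y"
    and avoid: "\<And>z. AE ys in \<eta> y. z \<notin> set ys"
  shows "AE \<omega> in law \<gamma>. set (\<omega> x) \<inter> set (\<omega> y) = {}"
proof -
  interpret product_prob_space \<eta> "points \<gamma>" by (rule product_law)
  let ?D = "{p :: 'x list \<times> 'x list. set (fst p) \<inter> set (snd p) = {}}"
  let ?N = "{\<omega> \<in> space (\<Pi>\<^sub>M i\<in>{x, y}. \<eta> i). (\<omega> x, \<omega> y) \<notin> ?D}"
  have cx: "(\<lambda>\<omega>. \<omega> x) \<in> measurable (\<Pi>\<^sub>M i\<in>{x, y}. \<eta> i) borel" "(\<lambda>\<omega>. \<omega> y) \<in> measurable (\<Pi>\<^sub>M i\<in>{x, y}. \<eta> i) borel"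
    using measurable_component_singleton[of x "{x, y}" \<eta>] measurable_component_singleton[of y "{x, y}" \<eta>]
    by (simp_all cong: measurable_cong_sets)
  have "(\<lambda>\<omega>. (\<omega> x, \<omega> y)) -` (space (borel \<Otimes>\<^sub>M borel) - ?D) \<inter> space (\<Pi>\<^sub>M i\<in>{x, y}. \<eta> i) \<in> sets (\<Pi>\<^sub>M i\<in>{x, y}. \<eta> i)"
    using sets_disjoint_lists by (intro measurable_sets[OF measurable_Pair[OF cx]]) auto
  also have "(\<lambda>\<omega>. (\<omega> x, \<omega> y)) -` (space (borel \<Otimes>\<^sub>M borel) - ?D) \<inter> space (\<Pi>\<^sub>M i\<in>{x, y}. \<eta> i) = ?N"
    by (auto simp: space_pair_measure)
  finally have N: "?N \<in> sets (\<Pi>\<^sub>M i\<in>{x, y}. \<eta> i)" .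
  have ins: "insert y {x} = {x, y}" by auto
  have "emeasure (\<Pi>\<^sub>M i\<in>{x, y}. \<eta> i) ?N = (\<integral>\<^sup>+\<omega>. indicator ?N \<omega> \<partial>(\<Pi>\<^sub>M i\<in>insert y {x}. \<eta> i))"
    using N unfolding ins by simp
  also have "\<dots> = (\<integral>\<^sup>+\<omega>. (\<integral>\<^sup>+ys. indicator ?N (fun_upd \<omega> y ys) \<partial>\<eta> y) \<partial>(\<Pi>\<^sub>M i\<in>{x}. \<eta> i))"
  proof (rule product_nn_integral_insert)
    show "indicator ?N \<in> borel_measurable (\<Pi>\<^sub>M i\<in>insert y {x}. \<eta> i)"
      unfolding ins using N by (rule borel_measurable_indicator)
  qed (use x in auto)
  also have "\<dots> = (\<integral>\<^sup>+\<omega>. 0 \<partial>(\<Pi>\<^sub>M i\<in>{x}. \<eta> i))"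
  proof (intro nn_integral_cong)
    fix \<omega>
    have "AE ys in \<eta> y. \<forall>z\<in>set (\<omega> x). z \<notin> set ys"
      using avoid by (intro AE_finite_allI) auto
    then have "AE ys in \<eta> y. indicator ?N (fun_upd \<omega> y ys) = (0 :: ennreal)"
    proof eventually_elim
      case (elim ys)
      then show ?case using x(3) by (auto simp: indicator_def)
    qed
    then have "(\<integral>\<^sup>+ys. indicator ?N (fun_upd \<omega> y ys) \<partial>\<eta> y) = (\<integral>\<^sup>+ys. 0 \<partial>\<eta> y)"
      by (rule nn_integral_cong_AE)
    then show "(\<integral>\<^sup>+ys. indicator ?N (fun_upd \<omega> y ys) \<partial>\<eta> y) = 0" by simp
  qed
  finally have "AE \<omega> in (\<Pi>\<^sub>M i\<in>{x, y}. \<eta> i). (\<omega> x, \<omega> y) \<in> ?D"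
    using N by (intro AE_I[of _ _ ?N]) auto
  moreover have eq: "(\<Pi>\<^sub>M i\<in>{x, y}. \<eta> i) = distr (law \<gamma>) (\<Pi>\<^sub>M i\<in>{x, y}. \<eta> i) (\<lambda>\<omega>. restrict \<omega> {x, y})"
    using x by (intro distr_PiM_restrict_finite[symmetric]) auto
  ultimately have "AE \<omega> in distr (law \<gamma>) (\<Pi>\<^sub>M i\<in>{x, y}. \<eta> i) (\<lambda>\<omega>. restrict \<omega> {x, y}). (\<omega> x, \<omega> y) \<in> ?D"
    by (subst eq[symmetric])
  then have "AE \<omega> in law \<gamma>. (restrict \<omega> {x, y} x, restrict \<omega> {x, y} y) \<in> ?D"
    by (rule AE_distrD[OF measurable_restrict_subset, rotated]) (use x in auto)
  then show ?thesis by eventually_elim simp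
qed

text \<open>The superposition is one Dirac sum over pairs of a centre and a position. Distinctness
  and disjointness make its indexing injective; a compact set meets finitely many clusters, each of
  finite length.\<close>

lemma superpose_proper:
  assumes \<gamma>: "countable (points \<gamma>)"
    and fin: "\<And>n. finite {x \<in> points \<gamma>. set (\<omega> x) \<inter> exhaustion n \<noteq> {}}"
    and distinct: "\<And>x. x \<in> points \<gamma> \<Longrightarrow> distinct (\<omega> x)"
    and disjoint: "\<And>x y. x \<in> points \<gamma> \<Longrightarrow> y \<in> points \<gamma> \<Longrightarrow> x \<noteq> y \<Longrightarrow> set (\<omega> x) \<inter> set (\<omega> y) = {}"
  shows "superpose (points \<gamma>) (\<lambda>x. tuple_conf (\<omega> x)) \<in> proper_configurations"
proof -
  let ?S = "Sigma (points \<gamma>) (\<lambda>x. {..<length (\<omega> x)})"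
  have "superpose (points \<gamma>) (\<lambda>x. tuple_conf (\<omega> x)) = dirac_sum ?S (\<lambda>(x, i). \<omega> x ! i)"
    using \<gamma> by (intro superpose_dirac_sums) (auto simp: tuple_conf_def)
  also have "\<dots> \<in> proper_configurations"
  proof (rule dirac_sum_proper)
    show "countable ?S" using \<gamma> by auto
    show "inj_on (\<lambda>(x, i). \<omega> x ! i) ?S"
    proof (rule inj_onI)
      fix p q assume pq: "p \<in> ?S" "q \<in> ?S" "(case p of (x, i) \<Rightarrow> \<omega> x ! i) = (case q of (x, i) \<Rightarrow> \<omega> x ! i)"
      obtain x i y j where [simp]: "p = (x, i)" "q = (y, j)" by fastforce
      have xy: "x \<in> points \<gamma>" "i < length (\<omega> x)" "y \<in> points \<gamma>" "j < length (\<omega> y)"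
        and eq: "\<omega> x ! i = \<omega> y ! j" using pq by auto
      have "\<omega> x ! i \<in> set (\<omega> x)" "\<omega> y ! j \<in> set (\<omega> y)" using xy by auto
      then have "set (\<omega> x) \<inter> set (\<omega> y) \<noteq> {}" using eq by auto
      then have "x = y" using disjoint[of x y] xy by blast
      then show "p = q"
        using distinct[of x] xy eq by (auto simp: nth_eq_iff_index_eq)
    qed
    fix K :: "'x set" assume "compact K"
    then obtain n where n: "K \<subseteq> exhaustion n" using compact_subset_exhaustion by blast
    have "finite (Sigma {x \<in> points \<gamma>. set (\<omega> x) \<inter> exhaustion n \<noteq> {}} (\<lambda>x. {..<length (\<omega> x)}))"
      using fin by (intro finite_SigmaI) auto
    then show "finite {p \<in> ?S. (case p of (x, i) \<Rightarrow> \<omega> x ! i) \<in> K}"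
    proof (rule finite_subset[rotated], intro subsetI)
      fix p assume "p \<in> {p \<in> ?S. (case p of (x, i) \<Rightarrow> \<omega> x ! i) \<in> K}"
      then obtain x i where p: "p = (x, i)" "x \<in> points \<gamma>" "i < length (\<omega> x)" "\<omega> x ! i \<in> K" by auto
      then have "\<omega> x ! i \<in> set (\<omega> x) \<inter> exhaustion n" using n by auto
      then have "set (\<omega> x) \<inter> exhaustion n \<noteq> {}" by blast
      then show "p \<in> Sigma {x \<in> points \<gamma>. set (\<omega> x) \<inter> exhaustion n \<noteq> {}} (\<lambda>x. {..<length (\<omega> x)})"
        using p by auto
    qed
  qed
  finally show ?thesis .
qed

text \<open>There are countably many centres and countably many sets in the exhaustion, so the
  conditions of \<open>superpose_proper\<close> hold simultaneously almost surely.\<close>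

lemma AE_superpose_proper:
  assumes \<gamma>: "\<gamma> \<in> proper_configurations"
    and fin: "\<And>n. (\<integral>\<^sup>+x. emeasure (\<eta> x) {ys. set ys \<inter> exhaustion n \<noteq> {}} \<partial>\<gamma>) < \<infinity>"
    and avoid: "\<And>x z. AE ys in \<eta> x. z \<notin> set ys" and distinct: "\<And>x. AE ys in \<eta> x. distinct ys"
  shows "AE \<omega> in law \<gamma>. superpose (points \<gamma>) (\<lambda>x. tuple_conf (\<omega> x)) \<in> proper_configurations"
proof -
  have cnt: "countable (points \<gamma>)" by (rule proper_eq_dirac_sum(1)[OF \<gamma>])
  have K: "exhaustion n \<in> sets borel" for n using compact_imp_closed[OF compact_exhaustion] by simp
  have "AE \<omega> in law \<gamma>. \<forall>n. finite {x \<in> points \<gamma>. set (\<omega> x) \<inter> exhaustion n \<noteq> {}}"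
    unfolding AE_all_countable using AE_finite_hits[OF \<gamma> K fin] by simp
  moreover have "AE \<omega> in law \<gamma>. \<forall>x\<in>points \<gamma>. distinct (\<omega> x)"
    unfolding AE_ball_countable[OF cnt]
  proof
    fix x assume x: "x \<in> points \<gamma>"
    show "AE \<omega> in law \<gamma>. distinct (\<omega> x)"
      by (rule AE_PiM_component[OF eta_prob x distinct])
  qed
  moreover have "AE \<omega> in law \<gamma>. \<forall>x\<in>points \<gamma>. \<forall>y\<in>points \<gamma>. x \<noteq> y \<longrightarrow> set (\<omega> x) \<inter> set (\<omega> y) = {}"
    unfolding AE_ball_countable[OF cnt]
  proof (intro ballI)
    fix x y assume xy: "x \<in> points \<gamma>" "y \<in> points \<gamma>"
    show "AE \<omega> in law \<gamma>. x \<noteq> y \<longrightarrow> set (\<omega> x) \<inter> set (\<omega> y) = {}"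
      using AE_disjoint_clusters[OF xy _ avoid] by (cases "x = y") auto
  qed
  ultimately show ?thesis
    by eventually_elim (intro superpose_proper[OF cnt], auto)
qed

end

section \<open>Quasi-invariance\<close>

abbreviation transport :: "('a::topological_space \<Rightarrow> 'a) \<Rightarrow> 'a measure \<Rightarrow> 'a measure" where
  "transport \<phi> \<gamma> \<equiv> distr \<gamma> borel \<phi>"

lemma emeasure_transport:
  assumes "sets \<gamma> = sets borel" "\<phi> \<in> borel_measurable borel" "B \<in> sets borel"
  shows "emeasure (transport \<phi> \<gamma>) B = emeasure \<gamma> (\<phi> -` B)"
proof -
  have "space \<gamma> = UNIV" using sets_eq_imp_space_eq[OF assms(1)] by simp
  then show ?thesis using assms by (subst emeasure_distr) (auto cong: measurable_cong_sets)
qed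

lemma transport_dirac_sum:
  assumes "\<phi> \<in> borel_measurable borel"
  shows "transport \<phi> (dirac_sum I s) = dirac_sum I (\<phi> \<circ> s)"
  unfolding dirac_sum_def by (rule distr_distr[OF assms]) simp

lemma transport_in_configurations:
  "\<phi> \<in> borel_measurable borel \<Longrightarrow> \<gamma> \<in> configurations \<Longrightarrow> transport \<phi> \<gamma> \<in> configurations"
  by (erule configurationsE) (auto simp: transport_dirac_sum intro: dirac_sum_in_configurations)

text \<open>The preimage of a compact set under a homeomorphism is compact, hence contains finitely
  many points of the configuration.\<close>

lemma transport_proper:
  fixes \<phi> :: "'a::t2_space \<Rightarrow> 'a"
  assumes \<gamma>: "\<gamma> \<in> proper_configurations" and bij: "bij \<phi>"
    and \<phi>: "continuous_on UNIV \<phi>" and \<psi>: "continuous_on UNIV (inv \<phi>)"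
  shows "transport \<phi> \<gamma> \<in> proper_configurations"
proof -
  have "transport \<phi> \<gamma> = dirac_sum (points \<gamma>) \<phi>"
    using \<phi> by (subst proper_eq_dirac_sum(2)[OF \<gamma>], subst transport_dirac_sum)
      (auto simp: o_def intro: borel_measurable_continuous_onI)
  also have "\<dots> \<in> proper_configurations"
  proof (rule dirac_sum_proper[OF proper_eq_dirac_sum(1)[OF \<gamma>]])
    show "inj_on \<phi> (points \<gamma>)" using bij by (auto simp: bij_def intro: inj_on_subset)
    fix K :: "'a set" assume "compact K"
    then have "compact (inv \<phi> ` K)"
      using \<psi> by (intro compact_continuous_image) (auto intro: continuous_on_subset)
    then have "finite (points \<gamma> \<inter> inv \<phi> ` K)" by (rule finite_points_compact[OF \<gamma>])
    then show "finite {x \<in> points \<gamma>. \<phi> x \<in> K}"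
      by (rule finite_subset[rotated]) (use bij in \<open>auto simp: image_iff bij_is_inj intro!: bexI[of _ "\<phi> _"]\<close>)
  qed
  finally show ?thesis .
qed

lemma transport_measurable:
  assumes \<phi>: "\<phi> \<in> borel_measurable borel" and \<Omega>: "\<Omega> \<subseteq> configurations"
    and closed: "\<And>\<gamma>. \<gamma> \<in> \<Omega> \<Longrightarrow> transport \<phi> \<gamma> \<in> \<Omega>"
  shows "transport \<phi> \<in> measurable (evaluation_space \<Omega>) (evaluation_space \<Omega>)"
proof (rule measurable_evaluation_spaceI)
  fix B assume B: "B \<in> sets (borel :: 'a measure)"
  have "\<phi> -` B \<in> sets borel" using measurable_sets[OF \<phi> B] by simp
  then have "(\<lambda>\<gamma>. emeasure \<gamma> (\<phi> -` B)) \<in> borel_measurable (evaluation_space \<Omega>)"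
    by (rule measurable_emeasure_evaluation)
  moreover have "emeasure (transport \<phi> \<gamma>) B = emeasure \<gamma> (\<phi> -` B)" if "\<gamma> \<in> space (evaluation_space \<Omega>)" for \<gamma>
    using that \<Omega> B \<phi> by (intro emeasure_transport sets_configuration) auto
  ultimately show "(\<lambda>\<gamma>. emeasure (transport \<phi> \<gamma>) B) \<in> borel_measurable (evaluation_space \<Omega>)"
    by (subst measurable_cong)
qed (use closed in auto)

text \<open>Translates the action on configurations into an entrywise action on the independent
  tuples, where the product structure is available.\<close>

lemma transport_superpose:
  assumes \<phi>: "\<phi> \<in> borel_measurable borel"
  shows "transport \<phi> (superpose I (\<lambda>x. tuple_conf (\<omega> x))) = superpose I (\<lambda>x. tuple_conf (map \<phi> (\<omega> x)))"
proof (rule measure_eqI)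
  fix B assume "B \<in> sets (transport \<phi> (superpose I (\<lambda>x. tuple_conf (\<omega> x))))"
  then have B: "B \<in> sets borel" by simp
  then have B': "\<phi> -` B \<in> sets borel" using measurable_sets[OF \<phi> B] by simp
  have "emeasure (tuple_conf ys) (\<phi> -` B) = emeasure (tuple_conf (map \<phi> ys)) B" for ys
    using B B' by (simp add: emeasure_tuple_conf indicator_def)
  then show "emeasure (transport \<phi> (superpose I (\<lambda>x. tuple_conf (\<omega> x)))) B =
      emeasure (superpose I (\<lambda>x. tuple_conf (map \<phi> (\<omega> x)))) B"
    using B B' \<phi> by (simp add: emeasure_transport emeasure_superpose)
qed simp

lemma inverse_prod_list: "inverse (prod_list xs) = prod_list (map inverse (xs :: real list))"
  by (induction xs) auto

lemma prod_list_pos: "(\<And>x. x \<in> set xs \<Longrightarrow> 0 < x) \<Longrightarrow> 0 < prod_list (xs :: real list)"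
  by (induction xs) auto

locale smooth_clusters = manifold_with_metric A G + cluster_setting \<mu> \<eta> W
  for A :: "('x::{t2_space, second_countable_topology}, 'n::finite) chart set"
    and G :: "('x, 'n) chart \<Rightarrow> 'x \<Rightarrow> real ^ 'n ^ 'n"
    and \<mu> :: "'x measure measure" and \<eta> :: "'x \<Rightarrow> 'x list measure" and W :: "nat \<Rightarrow> 'x set" +
  fixes \<theta> :: "'x measure" and h :: "'x \<Rightarrow> 'x list \<Rightarrow> real"
  assumes theta: "locally_finite_measure \<theta>"
    and mu_class: "\<mu> \<in> moment_class 1 \<theta>"
    and eta_finite: "\<And>B. compact B \<Longrightarrow> (\<integral>\<^sup>+x. emeasure (\<eta> x) {ys. set ys \<inter> B \<noteq> {}} \<partial>\<theta>) < \<infinity>"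
    and h_meas: "\<And>x. h x \<in> borel_measurable borel" and h_nonneg: "\<And>x ys. 0 \<le> h x ys"
    and eta_density: "\<And>x. \<eta> x = density (tuple_volume vol) (\<lambda>ys. ennreal (h x ys))"
    and h_pos: "\<And>x. AE ys in tuple_volume vol. 0 < h x ys"
begin

lemma AE_eta:
  assumes "AE ys in tuple_volume vol. P ys"
  shows "AE ys in \<eta> x. P ys"
  unfolding eta_density using h_meas[of x] assms
  by (subst AE_density) (auto cong: measurable_cong_sets)

lemma eta_avoids: "AE ys in \<eta> x. z \<notin> set ys"
  by (intro AE_eta AE_tuple_volume_avoids sigma_finite_vol emeasure_vol_singleton) simp

lemma eta_distinct: "AE ys in \<eta> x. distinct ys"
  by (intro AE_eta AE_tuple_volume_distinct sigma_finite_vol emeasure_vol_singleton) simp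

text \<open>Centre configurations for which the conditional expected number of clusters hitting each
  set of the exhaustion is finite; the fibrewise arguments are carried out for these.\<close>

definition locally_finite_clusters :: "'x measure \<Rightarrow> bool" where
  "locally_finite_clusters \<gamma> \<longleftrightarrow> \<gamma> \<in> proper_configurations \<and>
     (\<forall>n. (\<integral>\<^sup>+x. emeasure (\<eta> x) {ys. set ys \<inter> exhaustion n \<noteq> {}} \<partial>\<gamma>) < \<infinity>)"

lemma exhaustion_borel: "exhaustion n \<in> sets borel"
  using compact_imp_closed[OF compact_exhaustion] by simp

text \<open>The moment condition is applied to \<open>f\<close>, the probability of hitting a
  compact set; almost sure integrability of \<open>f\<close> against the centre configuration is the
  required finiteness.\<close>

lemma AE_locally_finite_clusters: "AE \<gamma> in \<mu>. locally_finite_clusters \<gamma>"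
proof -
  have "AE \<gamma> in \<mu>. (\<integral>\<^sup>+x. emeasure (\<eta> x) {ys. set ys \<inter> exhaustion n \<noteq> {}} \<partial>\<gamma>) < \<infinity>" for n
  proof -
    let ?H = "{ys. set ys \<inter> exhaustion n \<noteq> {}}"
    define f where "f x = measure (\<eta> x) ?H" for x
    have em: "emeasure (\<eta> x) ?H = ennreal (f x)" for x
      unfolding f_def using prob_space.finite_measure[OF eta_prob] by (rule finite_measure.emeasure_eq_measure)
    have f: "f \<in> borel_measurable borel"
      unfolding f_def measure_def using eta_meas[OF sets_list_hit[OF exhaustion_borel[of n]]] by measurable
    have "sets \<theta> = sets borel" using theta by (simp add: locally_finite_measure_def)
    then have "f \<in> borel_measurable \<theta>" using f by (simp cong: measurable_cong_sets)
    moreover have "(\<integral>\<^sup>+x. ennreal (f x) \<partial>\<theta>) < \<infinity>"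
      using eta_finite[OF compact_exhaustion[of n]] by (simp add: em)
    ultimately have "integrable \<theta> f"
      by (intro integrableI_nonneg) (auto simp: f_def)
    moreover have "(\<lambda>x. \<bar>f x\<bar> powr 1) = f"
      by (simp add: fun_eq_iff f_def)
    \<comment> \<open>For moment order 1 the only exponent \<open>\<kappa>\<close> is 1.\<close>
    ultimately have "integrable \<theta> (\<lambda>x. \<bar>f x\<bar> powr \<kappa>)" if "\<kappa> \<in> {1..1}" for \<kappa>
      using that by simp
    then have "f \<in> {f. f \<in> borel_measurable borel \<and> (\<forall>\<kappa>\<in>{1..1}. integrable \<theta> (\<lambda>x. \<bar>f x\<bar> powr \<kappa>))}"
      using f by blast
    then have "AE \<gamma> in \<mu>. integrable \<gamma> f"
      using mu_class unfolding moment_class_def Let_def by blast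
    then show ?thesis
    proof eventually_elim
      case (elim \<gamma>)
      then have "(\<integral>\<^sup>+x. ennreal (norm (f x)) \<partial>\<gamma>) < \<infinity>" by (simp add: integrable_iff_bounded)
      then show ?case by (simp add: em f_def)
    qed
  qed
  then have "AE \<gamma> in \<mu>. \<forall>n. (\<integral>\<^sup>+x. emeasure (\<eta> x) {ys. set ys \<inter> exhaustion n \<noteq> {}} \<partial>\<gamma>) < \<infinity>"
    by (simp add: AE_all_countable)
  with AE_space show ?thesis
    by eventually_elim (simp add: locally_finite_clusters_def space_mu)
qed

lemma AE_marked_proper: "AE \<gamma>h in marked_measure \<mu> \<eta>. cluster_map \<gamma>h \<in> proper_configurations"
proof (rule AE_marked)
  show "{\<gamma>h \<in> proper_configurations. cluster_map \<gamma>h \<in> (proper_configurations :: 'x measure set)} \<in> sets conf_space"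
    using measurable_sets[OF measurable_cluster_map sets_proper] by (simp add: vimage_def Int_def conj_commute)
  show "AE \<gamma> in \<mu>. AE \<omega> in law \<gamma>. cluster_map (mark \<gamma> \<omega>) \<in> proper_configurations"
    using AE_locally_finite_clusters
  proof eventually_elim
    case (elim \<gamma>)
    then show ?case
      unfolding cluster_map_mark locally_finite_clusters_def
      by (intro AE_superpose_proper eta_avoids eta_distinct) auto
  qed
qed

lemma cluster_map_marked: "cluster_map \<in> measurable (marked_measure \<mu> \<eta>) gconf_space"
  using measurable_cluster_map by (simp cong: measurable_cong_sets)

lemma AE_gen_proper: "AE \<gamma> in gen_cluster_measure \<mu> \<eta>. \<gamma> \<in> proper_configurations"
  unfolding gen_cluster_measure_eq
proof (subst AE_distr_iff[OF cluster_map_marked])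
  have "proper_configurations \<inter> configurations = (proper_configurations :: 'x measure set)"
    using proper_subset_configurations by blast
  then show "{\<gamma> \<in> space gconf_space. \<gamma> \<in> (proper_configurations :: 'x measure set)} \<in> sets gconf_space"
    using sets_proper by (simp add: Int_def conj_commute)
qed (rule AE_marked_proper)

lemma sets_gen [simp, measurable_cong]: "sets (gen_cluster_measure \<mu> \<eta>) = sets gconf_space"
  by (simp add: gen_cluster_measure_eq)

lemma space_gen [simp]: "space (gen_cluster_measure \<mu> \<eta>) = configurations"
  by (simp add: gen_cluster_measure_eq)

lemma proper_in_gen: "proper_configurations \<inter> space (gen_cluster_measure \<mu> \<eta>) \<in> sets (gen_cluster_measure \<mu> \<eta>)"
  using sets_proper proper_subset_configurations[where 'a = 'x] by (simp add: Int_absorb2)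

lemma sets_cluster [simp, measurable_cong]: "sets (cluster_measure \<mu> \<eta>) = sets conf_space"
  unfolding cluster_measure_def
  by (subst sets_restrict_space_cong[OF sets_gen]) (rule sets_restrict_gconf_space[OF sets_proper])

lemma space_cluster [simp]: "space (cluster_measure \<mu> \<eta>) = proper_configurations"
  using sets_eq_imp_space_eq[OF sets_cluster] by simp

text \<open>Restriction to a set of full measure changes no integral. Computations can thus be made
  with the unrestricted law, which is a plain image under \<open>cluster_map\<close>.\<close>

lemma nn_integral_cluster:
  "(\<integral>\<^sup>+\<gamma>. f \<gamma> \<partial>cluster_measure \<mu> \<eta>) = (\<integral>\<^sup>+\<gamma>. f \<gamma> \<partial>gen_cluster_measure \<mu> \<eta>)"
  unfolding cluster_measure_def
  by (subst nn_integral_restrict_space[OF proper_in_gen], rule nn_integral_cong_AE)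
    (use AE_gen_proper in eventually_elim, simp)

lemma prob_gen: "prob_space (gen_cluster_measure \<mu> \<eta>)"
  unfolding gen_cluster_measure_eq using cluster_map_marked by (rule prob_space.prob_space_distr[OF prob_marked])

lemma prob_cluster: "prob_space (cluster_measure \<mu> \<eta>)"
proof
  have "emeasure (cluster_measure \<mu> \<eta>) (space (cluster_measure \<mu> \<eta>)) = (\<integral>\<^sup>+\<gamma>. 1 \<partial>cluster_measure \<mu> \<eta>)" by simp
  also have "\<dots> = 1"
    unfolding nn_integral_cluster using prob_space.emeasure_space_1[OF prob_gen] by simp
  finally show "emeasure (cluster_measure \<mu> \<eta>) (space (cluster_measure \<mu> \<eta>)) = 1" .
qed

end

locale moved_clusters = smooth_clusters A G \<mu> \<eta> W \<theta> h
  for A :: "('x::{t2_space, second_countable_topology}, 'n::finite) chart set" and G \<mu> \<eta> W \<theta> h +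
  fixes \<phi> :: "'x \<Rightarrow> 'x"
  assumes \<phi>_Diff0: "\<phi> \<in> Diff0 A"
begin

lemma bij_\<phi>: "bij \<phi>" and smooth_\<phi>: "smooth_map A \<phi>" and smooth_inv_\<phi>: "smooth_map A (inv \<phi>)"
  and compact_support: "compact (closure {x. \<phi> x \<noteq> x})"
  using \<phi>_Diff0 by (auto simp: Diff0_def)

lemma \<phi>_measurable [measurable]: "\<phi> \<in> borel_measurable borel" "inv \<phi> \<in> borel_measurable borel"
  using smooth_map_continuous[OF smooth_\<phi>] smooth_map_continuous[OF smooth_inv_\<phi>]
  by (auto intro: borel_measurable_continuous_onI)

abbreviation "supp \<equiv> closure {x. \<phi> x \<noteq> x}"

lemma inv_\<phi> [simp]: "inv \<phi> (\<phi> x) = x" "\<phi> (inv \<phi> x) = x"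
  using bij_\<phi> by (simp_all add: bij_is_inj bij_is_surj surj_f_inv_f)

lemma outside_supp: "x \<notin> supp \<Longrightarrow> \<phi> x = x"
  using subsetD[OF closure_subset[of "{x. \<phi> x \<noteq> x}"], of x] by auto

lemma outside_supp_inv: "x \<notin> supp \<Longrightarrow> inv \<phi> x = x"
  using outside_supp inv_\<phi>(1) by metis

text \<open>Points off the support are fixed, so by injectivity nothing enters or leaves it.\<close>

lemma \<phi>_in_supp: "\<phi> x \<in> supp \<longleftrightarrow> x \<in> supp"
proof
  show "\<phi> x \<in> supp" if "x \<in> supp"
  proof (rule ccontr)
    assume "\<phi> x \<notin> supp"
    then have "\<phi> (\<phi> x) = \<phi> x" by (rule outside_supp)
    then have "\<phi> x = x" using bij_\<phi> by (simp add: bij_is_inj inj_eq)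
    with that \<open>\<phi> x \<notin> supp\<close> show False by simp
  qed
  show "x \<in> supp" if "\<phi> x \<in> supp"
    using that outside_supp[of x] by metis
qed

abbreviation \<rho> :: "'x \<Rightarrow> 'x list \<Rightarrow> real" where
  "\<rho> x ys \<equiv> cluster_density A G h \<phi> (x, ys)"

lemma jacobian_pos: "0 < riemannian_jacobian A G \<phi> x"
  by (rule riemannian_jacobian_pos[OF bij_\<phi> smooth_\<phi> smooth_inv_\<phi>])

lemma jacobian_measurable [measurable]: "riemannian_jacobian A G \<phi> \<in> borel_measurable borel"
  by (rule riemannian_jacobian_measurable[OF smooth_\<phi>])

lemma tuple_jacobian_measurable [measurable]: "tuple_jacobian A G \<phi> \<in> borel_measurable borel"
  unfolding tuple_jacobian_def[abs_def] by measurable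

lemma tuple_jacobian_pos: "0 < tuple_jacobian A G \<phi> ys"
  unfolding tuple_jacobian_def by (rule prod_list_pos) (auto simp: jacobian_pos)

lemma cluster_density_nonneg: "0 \<le> cluster_density A G h \<phi> z"
  using h_nonneg tuple_jacobian_pos by (simp add: cluster_density_def case_prod_beta Let_def less_imp_le)

lemma \<rho>_measurable: "\<rho> x \<in> borel_measurable borel"
proof -
  note [measurable] = h_meas[of x]
  show ?thesis
    unfolding cluster_density_def Let_def split by measurable
qed

text \<open>Such a tuple equals its own preimage, so the values of \<open>h\<close> cancel, and the
  Jacobian is 1 on the open complement of the closed support.\<close>

lemma \<rho>_outside:
  assumes "set ys \<inter> supp = {}"
  shows "\<rho> x ys = 1"
proof -
  have ys: "y \<notin> supp" if "y \<in> set ys" for y using assms that by blast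
  then have "map (inv \<phi>) ys = ys"
    by (intro map_idI outside_supp_inv)
  moreover have "riemannian_jacobian A G \<phi> y = 1" if "y \<in> set ys" for y
  proof (rule riemannian_jacobian_eq_1[OF smooth_\<phi>])
    show "open (- supp)" by (intro open_Compl closed_closure)
    show "y \<in> - supp" using ys[OF that] by simp
    show "\<phi> z = z" if "z \<in> - supp" for z using that by (intro outside_supp) simp
  qed
  then have "map (riemannian_jacobian A G \<phi>) ys = map (\<lambda>_. 1) ys"
    by simp
  then have "tuple_jacobian A G \<phi> ys = 1"
    by (simp add: tuple_jacobian_def map_replicate_const)
  ultimately show ?thesis by (simp add: cluster_density_def)
qed

text \<open>\<open>distr_tuple_volume\<close> moves the volume on tuples with the product of inverse
  Jacobians, and \<open>distr_density_bij\<close> carries this over to the density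
  \<open>h x\<close>.\<close>

lemma distr_eta: "distr (\<eta> x) (\<eta> x) (map \<phi>) = density (\<eta> x) (\<lambda>ys. ennreal (\<rho> x ys))"
proof -
  let ?V = "tuple_volume vol"
  let ?w = "\<lambda>y. inverse (riemannian_jacobian A G \<phi> (inv \<phi> y))"
  let ?pw = "\<lambda>ys. prod_list (map ?w ys)"
  let ?r = "\<lambda>ys. if h x ys = 0 \<or> h x (map (inv \<phi>) ys) = 0 then 1 else h x (map (inv \<phi>) ys) / h x ys * ?pw ys"
  note [measurable] = h_meas[of x]
  have eq: "distr ?V ?V (map \<phi>) = density ?V (\<lambda>ys. ennreal (?pw ys))"
  proof -
    have "distr ?V ?V (map \<phi>) = distr ?V borel (map \<phi>)" by (rule distr_cong) simp_all
    also have "\<dots> = density ?V (\<lambda>ys. ennreal (?pw ys))"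
      using less_imp_le[OF jacobian_pos] by (intro distr_tuple_volume sigma_finite_vol
          distr_vol[OF bij_\<phi> smooth_\<phi> smooth_inv_\<phi>]) auto
    finally show ?thesis .
  qed
  have "distr (density ?V (\<lambda>ys. ennreal (h x ys))) ?V (map \<phi>) =
      density (density ?V (\<lambda>ys. ennreal (h x ys))) (\<lambda>ys. ennreal (?r ys))"
  proof (rule distr_density_bij)
    show "map (inv \<phi>) (map \<phi> ys) = ys" for ys by (simp add: o_def)
    show "0 < ?pw ys" for ys by (rule prod_list_pos) (auto simp: jacobian_pos)
  qed (use h_nonneg h_pos eq in \<open>simp_all cong: measurable_cong_sets\<close>)
  \<comment> \<open>The inverse of the product of Jacobians along the preimage tuple is the product
    of their inverses, which is the form used in \<open>cluster_density\<close>.\<close>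
  moreover have "?r ys = \<rho> x ys" for ys
    by (simp add: cluster_density_def Let_def tuple_jacobian_def inverse_prod_list o_def)
  ultimately have "distr (\<eta> x) ?V (map \<phi>) = density (\<eta> x) (\<lambda>ys. ennreal (\<rho> x ys))"
    by (simp only: eta_density[symmetric])
  moreover have "distr (\<eta> x) (\<eta> x) (map \<phi>) = distr (\<eta> x) ?V (map \<phi>)"
    by (rule distr_cong) simp_all
  ultimately show ?thesis by simp
qed

lemma marked_density_mark:
  "marked_density A G h \<phi> (mark \<gamma> \<omega>) = (\<Prod>x | x \<in> points \<gamma> \<and> \<rho> x (\<omega> x) \<noteq> 1. \<rho> x (\<omega> x))"
proof -
  have "{z. z \<in> points (mark \<gamma> \<omega>) \<and> cluster_density A G h \<phi> z \<noteq> 1} =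
      (\<lambda>x. (x, \<omega> x)) ` {x. x \<in> points \<gamma> \<and> \<rho> x (\<omega> x) \<noteq> 1}"
    by (auto simp: points_mark)
  then show ?thesis
    unfolding marked_density_def by (simp add: prod.reindex inj_on_def)
qed

lemma cluster_map_restrict: "cluster_map (mark \<gamma> (restrict \<omega> (points \<gamma>))) = cluster_map (mark \<gamma> \<omega>)"
  for \<gamma> :: "'x measure"
  unfolding cluster_map_mark
  by (intro measure_eqI) (auto simp: emeasure_superpose intro!: nn_integral_cong)

text \<open>For fixed centres this is \<open>nn_integral_PiM_transform\<close> with \<open>H\<close>
  the tuples meeting the support. Its finiteness condition holds because the compact support lies in
  some \<open>exhaustion n\<close>.\<close>

lemma nn_integral_law_transport:
  assumes \<gamma>: "locally_finite_clusters \<gamma>" and f: "f \<in> borel_measurable gconf_space"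
  shows "(\<integral>\<^sup>+\<omega>. f (transport \<phi> (cluster_map (mark \<gamma> \<omega>))) \<partial>law \<gamma>) =
    (\<integral>\<^sup>+\<omega>. f (cluster_map (mark \<gamma> \<omega>)) * ennreal (marked_density A G h \<phi> (mark \<gamma> \<omega>)) \<partial>law \<gamma>)"
proof -
  interpret product_prob_space \<eta> "points \<gamma>" by (rule product_law)
  have proper: "\<gamma> \<in> proper_configurations" using \<gamma> by (simp add: locally_finite_clusters_def)
  let ?H = "{ys. set ys \<inter> supp \<noteq> {}}"
  let ?f = "\<lambda>\<omega>. f (cluster_map (mark \<gamma> \<omega>))"
  have "transport \<phi> (cluster_map (mark \<gamma> \<omega>)) = cluster_map (mark \<gamma> (\<lambda>x\<in>points \<gamma>. map \<phi> (\<omega> x)))" for \<omega>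
    unfolding cluster_map_restrict unfolding cluster_map_mark by (simp add: transport_superpose)
  then have "(\<integral>\<^sup>+\<omega>. f (transport \<phi> (cluster_map (mark \<gamma> \<omega>))) \<partial>law \<gamma>) = (\<integral>\<^sup>+\<omega>. ?f (\<lambda>x\<in>points \<gamma>. map \<phi> (\<omega> x)) \<partial>law \<gamma>)"
    by simp
  also have "\<dots> = (\<integral>\<^sup>+\<omega>. ?f \<omega> * ennreal (\<Prod>x | x \<in> points \<gamma> \<and> \<rho> x (\<omega> x) \<noteq> 1. \<rho> x (\<omega> x)) \<partial>law \<gamma>)"
  proof (rule nn_integral_PiM_transform[where H = "\<lambda>_. ?H"])
    show "countable (points \<gamma>)" by (rule proper_eq_dirac_sum(1)[OF proper])
    show "map \<phi> \<in> measurable (\<eta> x) (\<eta> x)" for x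
      using map_measurable[OF \<phi>_measurable(1)] by (simp cong: measurable_cong_sets)
    show "?H \<in> sets (\<eta> x)" for x
      using sets_list_hit[of supp] by simp
    show "\<rho> x \<in> borel_measurable (\<eta> x)" for x
      using \<rho>_measurable by (simp cong: measurable_cong_sets)
    show "0 \<le> \<rho> x ys" for x ys by (rule cluster_density_nonneg)
    show "\<rho> x ys = 1" if "ys \<notin> ?H" for x ys using that by (intro \<rho>_outside) simp
    show "map \<phi> ys = ys" if "ys \<notin> ?H" for ys
    proof (rule map_idI)
      fix y assume "y \<in> set ys"
      then show "\<phi> y = y" using that by (intro outside_supp) blast
    qed
    show "map \<phi> ys \<in> ?H \<longleftrightarrow> ys \<in> ?H" for ys
    proof -
      have "(\<exists>y\<in>set ys. \<phi> y \<in> supp) \<longleftrightarrow> (\<exists>y\<in>set ys. y \<in> supp)" by (simp only: \<phi>_in_supp)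
      then show ?thesis by auto
    qed
    show "distr (\<eta> x) (\<eta> x) (map \<phi>) = density (\<eta> x) (\<lambda>ys. ennreal (\<rho> x ys))" for x
      by (rule distr_eta)
    show "?f \<in> borel_measurable (law \<gamma>)"
      by (rule measurable_compose[OF measurable_compose[OF mark_measurable[OF proper] measurable_cluster_map] f])
    obtain n where n: "supp \<subseteq> exhaustion n" using compact_subset_exhaustion[OF compact_support] by blast
    have "AE \<omega> in law \<gamma>. finite {x \<in> points \<gamma>. set (\<omega> x) \<inter> exhaustion n \<noteq> {}}"
      using \<gamma> by (intro AE_finite_hits proper exhaustion_borel) (simp add: locally_finite_clusters_def)
    then show "AE \<omega> in law \<gamma>. finite {x \<in> points \<gamma>. \<omega> x \<in> ?H}"
    proof eventually_elim
      case (elim \<omega>)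
      then show ?case by (rule finite_subset[rotated]) (use n in blast)
    qed
  qed
  finally show ?thesis by (simp only: marked_density_mark)
qed

lemma nn_integral_gen:
  assumes "f \<in> borel_measurable gconf_space"
  shows "(\<integral>\<^sup>+\<gamma>. f \<gamma> \<partial>gen_cluster_measure \<mu> \<eta>) = (\<integral>\<^sup>+\<gamma>. (\<integral>\<^sup>+\<omega>. f (cluster_map (mark \<gamma> \<omega>)) \<partial>law \<gamma>) \<partial>\<mu>)"
proof -
  have "(\<integral>\<^sup>+\<gamma>. f \<gamma> \<partial>gen_cluster_measure \<mu> \<eta>) = (\<integral>\<^sup>+\<gamma>h. f (cluster_map \<gamma>h) \<partial>marked_measure \<mu> \<eta>)"
    unfolding gen_cluster_measure_eq by (rule nn_integral_distr[OF cluster_map_marked]) (use assms in simp)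
  also have "\<dots> = (\<integral>\<^sup>+\<gamma>. (\<integral>\<^sup>+\<omega>. f (cluster_map (mark \<gamma> \<omega>)) \<partial>law \<gamma>) \<partial>\<mu>)"
    by (intro nn_integral_marked measurable_compose[OF measurable_cluster_map assms])
  finally show ?thesis .
qed

lemma transport_gconf: "transport \<phi> \<in> measurable gconf_space gconf_space"
  by (intro transport_measurable transport_in_configurations \<phi>_measurable) auto

lemma transport_conf: "transport \<phi> \<in> measurable conf_space conf_space"
  by (intro transport_measurable transport_proper proper_subset_configurations \<phi>_measurable bij_\<phi>
      smooth_map_continuous smooth_\<phi> smooth_inv_\<phi>)

lemma nn_integral_gen_transport:
  assumes f: "f \<in> borel_measurable gconf_space"
  shows "(\<integral>\<^sup>+\<gamma>. f (transport \<phi> \<gamma>) \<partial>gen_cluster_measure \<mu> \<eta>) =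
    (\<integral>\<^sup>+\<gamma>. (\<integral>\<^sup>+\<omega>. f (cluster_map (mark \<gamma> \<omega>)) * ennreal (marked_density A G h \<phi> (mark \<gamma> \<omega>)) \<partial>law \<gamma>) \<partial>\<mu>)"
proof -
  have "(\<integral>\<^sup>+\<gamma>. f (transport \<phi> \<gamma>) \<partial>gen_cluster_measure \<mu> \<eta>) =
      (\<integral>\<^sup>+\<gamma>. (\<integral>\<^sup>+\<omega>. f (transport \<phi> (cluster_map (mark \<gamma> \<omega>))) \<partial>law \<gamma>) \<partial>\<mu>)"
    by (rule nn_integral_gen[OF measurable_compose[OF transport_gconf f]])
  also have "\<dots> = (\<integral>\<^sup>+\<gamma>. (\<integral>\<^sup>+\<omega>. f (cluster_map (mark \<gamma> \<omega>)) * ennreal (marked_density A G h \<phi> (mark \<gamma> \<omega>)) \<partial>law \<gamma>) \<partial>\<mu>)"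
    using AE_locally_finite_clusters
    by (intro nn_integral_cong_AE, eventually_elim) (rule nn_integral_law_transport[OF _ f])
  finally show ?thesis .
qed

abbreviation "clusters \<equiv> cluster_measure \<mu> \<eta>"
abbreviation "pushed \<equiv> push_law \<phi> (cluster_measure \<mu> \<eta>)"

lemma transport_clusters: "transport \<phi> \<in> measurable clusters conf_space"
  using transport_conf by (simp cong: measurable_cong_sets)

lemma prob_pushed: "prob_space pushed"
  unfolding push_law_def by (rule prob_space.prob_space_distr[OF prob_cluster transport_clusters])

lemma sets_pushed: "sets pushed = sets clusters"
  by (simp add: push_law_def)

text \<open>Without joint measurability of \<open>h\<close> the marked density need not be measurable on the marked
  configuration space, so absolute continuity is derived separately for almost every configuration
  of cluster centres.\<close>

lemma absolutely_continuous_pushed: "absolutely_continuous clusters pushed"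
  unfolding absolutely_continuous_def
proof
  fix N assume N: "N \<in> null_sets clusters"
  then have N_conf: "N \<in> sets conf_space" and "emeasure clusters N = 0" by (auto simp: null_sets_def)
  then have N_gconf: "N \<in> sets gconf_space"
    using sets_restrict_gconf_space[OF sets_proper] sets_proper proper_subset_configurations[where 'a = 'x]
    by (metis Int_absorb2 sets_restrict_space_iff space_evaluation_space)
  have ind: "indicator N \<in> borel_measurable gconf_space"
    using N_gconf by (rule borel_measurable_indicator)
  \<comment> \<open>Measurability in the centres, through the kernel, allows a vanishing iterated
    integral to be read as vanishing for almost every centre configuration.\<close>
  have inner: "(\<lambda>\<gamma>. \<integral>\<^sup>+\<omega>. indicator N (cluster_map (mark \<gamma> \<omega>)) \<partial>law \<gamma>) \<in> borel_measurable \<mu>"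
  proof -
    have m: "(\<lambda>\<gamma>h. indicator N (cluster_map \<gamma>h) :: ennreal) \<in> borel_measurable conf_space"
      by (rule measurable_compose[OF measurable_cluster_map ind])
    have "(\<lambda>\<gamma>. \<integral>\<^sup>+\<gamma>h. indicator N (cluster_map \<gamma>h) \<partial>kernel \<gamma>) \<in> borel_measurable \<mu>"
      by (rule measurable_compose[OF kernel_measurable nn_integral_measurable_subprob_algebra[OF m]])
    moreover have "(\<integral>\<^sup>+\<gamma>h. indicator N (cluster_map \<gamma>h) \<partial>kernel \<gamma>) = (\<integral>\<^sup>+\<omega>. indicator N (cluster_map (mark \<gamma> \<omega>)) \<partial>law \<gamma>)"
      if "\<gamma> \<in> space \<mu>" for \<gamma>
      unfolding kernel_def using that m by (intro nn_integral_distr mark_measurable) (auto simp: space_mu)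
    ultimately show ?thesis by (subst measurable_cong[symmetric]) auto
  qed
  have "(\<integral>\<^sup>+\<gamma>. (\<integral>\<^sup>+\<omega>. indicator N (cluster_map (mark \<gamma> \<omega>)) \<partial>law \<gamma>) \<partial>\<mu>) = (\<integral>\<^sup>+\<gamma>. indicator N \<gamma> \<partial>clusters)"
    unfolding nn_integral_cluster by (rule nn_integral_gen[OF ind, symmetric])
  also have "\<dots> = 0" using N_conf \<open>emeasure clusters N = 0\<close> by simp
  finally have "AE \<gamma> in \<mu>. (\<integral>\<^sup>+\<omega>. indicator N (cluster_map (mark \<gamma> \<omega>)) \<partial>law \<gamma>) = 0"
    using inner by (simp add: nn_integral_0_iff_AE)
  then have "AE \<gamma> in \<mu>. (\<integral>\<^sup>+\<omega>. indicator N (cluster_map (mark \<gamma> \<omega>)) * ennreal (marked_density A G h \<phi> (mark \<gamma> \<omega>)) \<partial>law \<gamma>) = 0"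
    using AE_space
  proof eventually_elim
    case (elim \<gamma>)
    then have "(\<lambda>\<omega>. indicator N (cluster_map (mark \<gamma> \<omega>)) :: ennreal) \<in> borel_measurable (law \<gamma>)"
      by (intro measurable_compose[OF measurable_compose[OF mark_measurable measurable_cluster_map] ind])
        (simp add: space_mu)
    then have "AE \<omega> in law \<gamma>. indicator N (cluster_map (mark \<gamma> \<omega>)) = (0 :: ennreal)"
      using elim by (simp add: nn_integral_0_iff_AE)
    \<comment> \<open>The indicator vanishes almost surely, hence so does the product, whatever the
      values of \<open>marked_density\<close>.\<close>
    then have "(\<integral>\<^sup>+\<omega>. indicator N (cluster_map (mark \<gamma> \<omega>)) * ennreal (marked_density A G h \<phi> (mark \<gamma> \<omega>)) \<partial>law \<gamma>) =
        (\<integral>\<^sup>+\<omega>. 0 \<partial>law \<gamma>)"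
      by (intro nn_integral_cong_AE, eventually_elim) simp
    then show ?case by simp
  qed
  then have "(\<integral>\<^sup>+\<gamma>. (\<integral>\<^sup>+\<omega>. indicator N (cluster_map (mark \<gamma> \<omega>)) * ennreal (marked_density A G h \<phi> (mark \<gamma> \<omega>)) \<partial>law \<gamma>) \<partial>\<mu>) = (\<integral>\<^sup>+\<gamma>. 0 \<partial>\<mu>)"
    by (rule nn_integral_cong_AE)
  then have "(\<integral>\<^sup>+\<gamma>. indicator N (transport \<phi> \<gamma>) \<partial>clusters) = 0"
    unfolding nn_integral_cluster nn_integral_gen_transport[OF ind] by simp
  then have "(\<integral>\<^sup>+\<gamma>. indicator N \<gamma> \<partial>pushed) = 0"
    unfolding push_law_def using N_conf
    by (subst nn_integral_distr[OF transport_clusters]) auto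
  then have "emeasure pushed N = 0" using N_conf by (simp add: sets_pushed)
  then show "N \<in> null_sets pushed" using N_conf by (auto simp: null_sets_def sets_pushed)
qed

end

section \<open>Identification of the density\<close>

locale moved_clusters_joint = moved_clusters A G \<mu> \<eta> W \<theta> h \<phi>
  for A :: "('x::{t2_space, second_countable_topology}, 'n::finite) chart set" and G \<mu> \<eta> W \<theta> h \<phi> +
  assumes h_joint: "(\<lambda>(x, ys). h x ys) \<in> borel_measurable borel"
begin

abbreviation "R \<equiv> marked_density A G h \<phi>"

lemma cluster_density_measurable: "cluster_density A G h \<phi> \<in> borel_measurable borel"
proof -
  have h[measurable]: "(\<lambda>p. h (fst p) (snd p)) \<in> borel_measurable (borel \<Otimes>\<^sub>M borel)"
    using h_joint unfolding borel_prod by (simp add: case_prod_beta')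
  have h': "(\<lambda>p. h (fst p) (map (inv \<phi>) (snd p))) \<in> borel_measurable (borel \<Otimes>\<^sub>M borel)"
  proof -
    have "(\<lambda>p. (fst p, map (inv \<phi>) (snd p))) \<in> measurable (borel \<Otimes>\<^sub>M borel) (borel \<Otimes>\<^sub>M (borel :: 'x list measure))"
      by measurable
    from measurable_compose[OF this h] show ?thesis by simp
  qed
  note [measurable] = h'
  have "(\<lambda>p. let ys' = map (inv \<phi>) (snd p) in
      if h (fst p) (snd p) = 0 \<or> h (fst p) ys' = 0 then 1
      else h (fst p) ys' / h (fst p) (snd p) * inverse (tuple_jacobian A G \<phi> ys')) \<in> borel_measurable (borel \<Otimes>\<^sub>M borel)"
    unfolding Let_def by measurable
  then show ?thesis
    unfolding borel_prod by (simp add: cluster_density_def case_prod_beta')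
qed

lemma R_measurable: "R \<in> borel_measurable conf_space"
  unfolding marked_density_def[abs_def]
  by (rule measurable_prod_points[OF cluster_density_measurable cluster_density_nonneg])

lemma R_nonneg: "0 \<le> R \<gamma>h"
  unfolding marked_density_def by (intro prod_nonneg cluster_density_nonneg)

text \<open>With a measurable density the iterated integral over centres and tuples folds back into
  one integral against the marked measure.\<close>

lemma nn_integral_transport_marked:
  assumes f: "f \<in> borel_measurable gconf_space"
  shows "(\<integral>\<^sup>+\<gamma>. f (transport \<phi> \<gamma>) \<partial>gen_cluster_measure \<mu> \<eta>) =
    (\<integral>\<^sup>+\<gamma>h. f (cluster_map \<gamma>h) * ennreal (R \<gamma>h) \<partial>marked_measure \<mu> \<eta>)"
  unfolding nn_integral_gen_transport[OF f]
  by (intro nn_integral_marked[symmetric] borel_measurable_times_ennreal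
      measurable_compose[OF measurable_cluster_map f] measurable_compose[OF R_measurable measurable_ennreal])

text \<open>Testing with the constant function 1 shows that the density has the total mass of the
  cluster law.\<close>

lemma integrable_R: "integrable (marked_measure \<mu> \<eta>) R"
proof (rule integrableI_nonneg)
  show "R \<in> borel_measurable (marked_measure \<mu> \<eta>)"
    using R_measurable by (simp cong: measurable_cong_sets)
  have "(\<integral>\<^sup>+\<gamma>h. ennreal (R \<gamma>h) \<partial>marked_measure \<mu> \<eta>) = (\<integral>\<^sup>+\<gamma>. 1 \<partial>gen_cluster_measure \<mu> \<eta>)"
    using nn_integral_transport_marked[of "\<lambda>_. 1"] by simp
  also have "\<dots> < \<infinity>"
    using prob_space.emeasure_space_1[OF prob_gen] by simp
  finally show "(\<integral>\<^sup>+\<gamma>h. ennreal (R \<gamma>h) \<partial>marked_measure \<mu> \<eta>) < \<infinity>" .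
qed (simp add: R_nonneg)

text \<open>The identity for nonnegative functions is recast as one between measures, so that it
  applies to the signed test functions of \<open>Iq_star\<close>.\<close>

lemma distr_transport_eq:
  "distr (gen_cluster_measure \<mu> \<eta>) gconf_space (transport \<phi>) =
    distr (density (marked_measure \<mu> \<eta>) (\<lambda>\<gamma>h. ennreal (R \<gamma>h))) gconf_space cluster_map" (is "?L = ?Q")
proof (rule measure_eqI)
  fix N assume "N \<in> sets ?L"
  then have N: "N \<in> sets gconf_space" by simp
  have ind: "indicator N \<in> borel_measurable gconf_space" using N by (rule borel_measurable_indicator)
  have t: "transport \<phi> \<in> measurable (gen_cluster_measure \<mu> \<eta>) gconf_space"
    using transport_gconf by (simp cong: measurable_cong_sets)
  have q: "cluster_map \<in> measurable (density (marked_measure \<mu> \<eta>) (\<lambda>\<gamma>h. ennreal (R \<gamma>h))) gconf_space"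
    using cluster_map_marked by simp
  have Rm: "(\<lambda>\<gamma>h. ennreal (R \<gamma>h)) \<in> borel_measurable (marked_measure \<mu> \<eta>)"
    using R_measurable by (simp cong: measurable_cong_sets)
  have "emeasure ?L N = (\<integral>\<^sup>+\<gamma>. indicator N (transport \<phi> \<gamma>) \<partial>gen_cluster_measure \<mu> \<eta>)"
    using N ind by (subst nn_integral_distr[OF t, symmetric]) auto
  also have "\<dots> = (\<integral>\<^sup>+\<gamma>h. ennreal (R \<gamma>h) * indicator N (cluster_map \<gamma>h) \<partial>marked_measure \<mu> \<eta>)"
    unfolding nn_integral_transport_marked[OF ind] by (simp only: mult.commute)
  also have "\<dots> = (\<integral>\<^sup>+\<gamma>h. indicator N (cluster_map \<gamma>h) \<partial>density (marked_measure \<mu> \<eta>) (\<lambda>\<gamma>h. ennreal (R \<gamma>h)))"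
    by (rule nn_integral_density[OF Rm measurable_compose[OF cluster_map_marked ind], symmetric])
  also have "\<dots> = emeasure ?Q N"
    using N ind by (subst nn_integral_distr[OF q, symmetric]) auto
  finally show "emeasure ?L N = emeasure ?Q N" .
qed simp

text \<open>The property by which \<open>Iq_star\<close> chooses its value, isolated so that
  existence and almost sure uniqueness can be proved apart from the choice.\<close>

definition represents :: "('x measure \<Rightarrow> real) \<Rightarrow> bool" where
  "represents g \<longleftrightarrow> integrable clusters g \<and>
     (\<forall>F :: 'x measure \<Rightarrow> real. F \<in> borel_measurable clusters \<and> bounded (F ` space clusters) \<longrightarrow>
        (\<integral>\<gamma>. F \<gamma> * g \<gamma> \<partial>clusters) =
        (LINT \<gamma>h:{\<gamma>h. cluster_map \<gamma>h \<in> proper_configurations}|marked_measure \<mu> \<eta>. F (cluster_map \<gamma>h) * R \<gamma>h))"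

lemma Iq_star_eq: "Iq_star \<mu> \<eta> R = (SOME g. represents g)"
  by (simp add: Iq_star_def represents_def)

text \<open>Indicators are bounded test functions, and integrals over all measurable sets determine
  an integrable function almost everywhere.\<close>

lemma represents_unique:
  assumes "represents g" "represents g'"
  shows "AE \<gamma> in clusters. g \<gamma> = g' \<gamma>"
proof (rule density_unique_real)
  show "integrable clusters g" "integrable clusters g'" using assms by (auto simp: represents_def)
  fix N assume N: "N \<in> sets clusters"
  then have ind: "indicator N \<in> borel_measurable clusters" by (rule borel_measurable_indicator)
  have "bounded (indicat_real N ` space clusters)"
    by (rule boundedI[where B = 1]) (auto simp: indicator_def)
  then have "(\<integral>\<gamma>. indicator N \<gamma> * g'' \<gamma> \<partial>clusters) =
      (LINT \<gamma>h:{\<gamma>h. cluster_map \<gamma>h \<in> proper_configurations}|marked_measure \<mu> \<eta>. indicat_real N (cluster_map \<gamma>h) * R \<gamma>h)"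
    if "represents g''" for g''
    using ind that[unfolded represents_def, THEN conjunct2, rule_format, of "indicat_real N"] by simp
  from this[OF assms(1)] this[OF assms(2)]
  have "(\<integral>\<gamma>. indicator N \<gamma> * g \<gamma> \<partial>clusters) = (\<integral>\<gamma>. indicator N \<gamma> * g' \<gamma> \<partial>clusters)"
    by simp
  then show "(LINT \<gamma>:N|clusters. g \<gamma>) = (LINT \<gamma>:N|clusters. g' \<gamma>)"
    by (simp add: set_lebesgue_integral_def)
qed

lemma RN_deriv_finite: "AE \<gamma> in clusters. RN_deriv clusters pushed \<gamma> = ennreal (enn2real (RN_deriv clusters pushed \<gamma>))"
proof -
  interpret C: prob_space clusters by (rule prob_cluster)
  interpret D: prob_space pushed by (rule prob_pushed)
  have "AE \<gamma> in clusters. RN_deriv clusters pushed \<gamma> \<noteq> \<infinity>"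
    by (rule C.RN_deriv_finite[OF _ absolutely_continuous_pushed sets_pushed]) unfold_locales
  then show ?thesis
    by eventually_elim (simp add: less_top)
qed

text \<open>Integrating \<open>F\<close> against the Radon-Nikodym derivative is integrating
  \<open>F\<close> after the motion, and \<open>distr_transport_eq\<close> rewrites this over marked
  configurations with weight \<open>R\<close>. The derivative is thus a witness for the choice in
  \<open>Iq_star\<close>.\<close>

lemma RN_deriv_represents: "represents (\<lambda>\<gamma>. enn2real (RN_deriv clusters pushed \<gamma>))"
proof -
  interpret C: prob_space clusters by (rule prob_cluster)
  interpret D: prob_space pushed by (rule prob_pushed)
  let ?g = "\<lambda>\<gamma>. enn2real (RN_deriv clusters pushed \<gamma>)"
  have gm: "?g \<in> borel_measurable clusters" by measurable
  have "density clusters (RN_deriv clusters pushed) = pushed"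
    by (rule C.density_RN_deriv[OF absolutely_continuous_pushed sets_pushed])
  moreover have "density clusters (RN_deriv clusters pushed) = density clusters (\<lambda>\<gamma>. ennreal (?g \<gamma>))"
    using RN_deriv_finite by (intro density_cong) auto
  ultimately have dens: "density clusters (\<lambda>\<gamma>. ennreal (?g \<gamma>)) = pushed" by simp
  show ?thesis
    unfolding represents_def
  proof (intro conjI allI impI)
    show "integrable clusters ?g"
    proof (rule integrableI_nonneg[OF gm])
      have "(\<integral>\<^sup>+\<gamma>. ennreal (?g \<gamma>) \<partial>clusters) = emeasure (density clusters (\<lambda>\<gamma>. ennreal (?g \<gamma>))) (space clusters)"
        using gm by (subst emeasure_density[OF _ sets.top]) (auto intro!: nn_integral_cong)
      also have "\<dots> = 1"
        unfolding dens using D.emeasure_space_1 by (simp add: push_law_def)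
      finally show "(\<integral>\<^sup>+\<gamma>. ennreal (?g \<gamma>) \<partial>clusters) < \<infinity>" by simp
    qed simp
    fix F :: "'x measure \<Rightarrow> real"
    assume "F \<in> borel_measurable clusters \<and> bounded (F ` space clusters)"
    then have F: "F \<in> borel_measurable clusters" by simp
    then have F_conf: "F \<in> borel_measurable conf_space" by (simp cong: measurable_cong_sets)
    \<comment> \<open>\<open>F\<close> is measurable only on proper configurations and is extended
      by 0 to all of them. The indicator finally becomes the domain of integration in the defining
      equation.\<close>
    define F' where "F' \<gamma> = indicator proper_configurations \<gamma> *\<^sub>R F \<gamma>" for \<gamma>
    have F': "F' \<in> borel_measurable gconf_space"
    proof -
      have "F \<in> borel_measurable (restrict_space gconf_space proper_configurations)"
        using F_conf by (simp add: measurable_cong_sets[OF sets_restrict_gconf_space[OF sets_proper] refl])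
      then show ?thesis
        unfolding F'_def using sets_proper proper_subset_configurations[where 'a = 'x]
        by (subst (asm) borel_measurable_restrict_space_iff) (auto simp: Int_absorb2)
    qed
    have t: "transport \<phi> \<in> measurable (gen_cluster_measure \<mu> \<eta>) gconf_space"
      using transport_gconf by (simp cong: measurable_cong_sets)
    have tF': "(\<lambda>\<gamma>. F' (transport \<phi> \<gamma>)) \<in> borel_measurable (gen_cluster_measure \<mu> \<eta>)"
      by (rule measurable_compose[OF t F'])
    have Rm: "R \<in> borel_measurable (marked_measure \<mu> \<eta>)"
      using R_measurable by (simp cong: measurable_cong_sets)
    have "(\<integral>\<gamma>. F \<gamma> * ?g \<gamma> \<partial>clusters) = (\<integral>\<gamma>. ?g \<gamma> *\<^sub>R F \<gamma> \<partial>clusters)"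
      by (simp add: mult.commute)
    also have "\<dots> = (\<integral>\<gamma>. F \<gamma> \<partial>pushed)"
      using integral_density[OF F gm] unfolding dens by simp
    also have "\<dots> = (\<integral>\<gamma>. F (transport \<phi> \<gamma>) \<partial>clusters)"
      unfolding push_law_def by (rule integral_distr[OF transport_clusters F_conf])
    also have "\<dots> = (\<integral>\<gamma>. indicator proper_configurations \<gamma> *\<^sub>R F (transport \<phi> \<gamma>) \<partial>gen_cluster_measure \<mu> \<eta>)"
      unfolding cluster_measure_def by (rule integral_restrict_space[OF proper_in_gen])
    also have "\<dots> = (\<integral>\<gamma>. F' (transport \<phi> \<gamma>) \<partial>gen_cluster_measure \<mu> \<eta>)"
    proof (rule integral_cong_AE)
      show "AE \<gamma> in gen_cluster_measure \<mu> \<eta>.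
          indicator proper_configurations \<gamma> *\<^sub>R F (transport \<phi> \<gamma>) = F' (transport \<phi> \<gamma>)"
        using AE_gen_proper
      proof eventually_elim
        case (elim \<gamma>)
        then have "transport \<phi> \<gamma> \<in> proper_configurations"
          using measurable_space[OF transport_conf, of \<gamma>] by simp
        with elim show ?case by (simp add: F'_def)
      qed
      have "(\<lambda>\<gamma>. F (transport \<phi> \<gamma>)) \<in> borel_measurable clusters"
        by (rule measurable_compose[OF transport_clusters F_conf])
      then show "(\<lambda>\<gamma>. indicator proper_configurations \<gamma> *\<^sub>R F (transport \<phi> \<gamma>)) \<in> borel_measurable (gen_cluster_measure \<mu> \<eta>)"
        unfolding cluster_measure_def by (subst (asm) borel_measurable_restrict_space_iff[OF proper_in_gen])
    qed (rule tF')
    also have "\<dots> = (\<integral>\<gamma>. F' \<gamma> \<partial>distr (gen_cluster_measure \<mu> \<eta>) gconf_space (transport \<phi>))"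
      by (rule integral_distr[OF t F', symmetric])
    also have "\<dots> = (\<integral>\<gamma>h. F' (cluster_map \<gamma>h) \<partial>density (marked_measure \<mu> \<eta>) (\<lambda>\<gamma>h. ennreal (R \<gamma>h)))"
      unfolding distr_transport_eq using cluster_map_marked F' by (intro integral_distr) auto
    also have "\<dots> = (\<integral>\<gamma>h. R \<gamma>h *\<^sub>R F' (cluster_map \<gamma>h) \<partial>marked_measure \<mu> \<eta>)"
      by (rule integral_density[OF measurable_compose[OF cluster_map_marked F'] Rm]) (simp add: R_nonneg)
    also have "\<dots> = (LINT \<gamma>h:{\<gamma>h. cluster_map \<gamma>h \<in> proper_configurations}|marked_measure \<mu> \<eta>. F (cluster_map \<gamma>h) * R \<gamma>h)"
      unfolding set_lebesgue_integral_def
      by (intro Bochner_Integration.integral_cong) (auto simp: F'_def indicator_def)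
    finally show "(\<integral>\<gamma>. F \<gamma> * ?g \<gamma> \<partial>clusters) =
        (LINT \<gamma>h:{\<gamma>h. cluster_map \<gamma>h \<in> proper_configurations}|marked_measure \<mu> \<eta>. F (cluster_map \<gamma>h) * R \<gamma>h)" .
  qed
qed

lemma represents_Iq_star: "represents (Iq_star \<mu> \<eta> R)"
  unfolding Iq_star_eq by (rule someI[of represents, OF RN_deriv_represents])

text \<open>By almost sure uniqueness, whichever function the choice picks agrees with the
  Radon-Nikodym derivative.\<close>

lemma RN_deriv_Iq_star: "AE \<gamma> in clusters. RN_deriv clusters pushed \<gamma> = ennreal (Iq_star \<mu> \<eta> R \<gamma>)"
  using RN_deriv_finite represents_unique[OF RN_deriv_represents represents_Iq_star]
  by eventually_elim simp

end

text \<open>The first conjunct justifies restricting the law to proper configurations in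
  \<open>cluster_measure\<close>. Both \<open>RN_deriv\<close> and \<open>Iq_star\<close> are
  determined only up to null sets, hence an identity almost everywhere. Assumption (ii) supplies
  \<open>h x\<close> for each \<open>x\<close> separately; the density clause asks for joint
  measurability so that \<open>marked_density\<close> is measurable on marked
  configurations.\<close>

theorem theorem4p5:
  fixes A :: "('x::{t2_space, second_countable_topology}, 'n::finite) chart set"
    and G :: "('x, 'n) chart \<Rightarrow> 'x \<Rightarrow> real ^ 'n ^ 'n"
    and \<mu> :: "'x measure measure"
    and \<eta> :: "'x \<Rightarrow> 'x list measure"
    and \<theta> :: "'x measure"
    and h :: "'x \<Rightarrow> 'x list \<Rightarrow> real"
  assumes manifold: "riemannian_manifold A G"
    and mu_sets: "sets \<mu> = sets conf_space" and mu_prob: "prob_space \<mu>"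
    and eta_sets: "\<And>x. sets (\<eta> x) = sets borel" and eta_prob: "\<And>x. prob_space (\<eta> x)"
    and eta_meas: "\<And>B. B \<in> sets borel \<Longrightarrow> (\<lambda>x. emeasure (\<eta> x) B) \<in> borel_measurable borel"
    and theta: "locally_finite_measure \<theta>"
    and mu_class: "\<mu> \<in> moment_class 1 \<theta>"
    and eta_finite: "\<And>B. compact B \<Longrightarrow>
          (\<integral>\<^sup>+x. emeasure (\<eta> x) {ys. set ys \<inter> B \<noteq> {}} \<partial>\<theta>) < \<infinity>"
    and h_meas: "\<And>x. h x \<in> borel_measurable borel" and h_nonneg: "\<And>x ys. 0 \<le> h x ys"
    and h_density: "\<And>x. \<eta> x = density (tuple_volume (riemannian_volume A G)) (\<lambda>ys. ennreal (h x ys))"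
    and h_pos: "\<And>x. AE ys in tuple_volume (riemannian_volume A G). 0 < h x ys"
  shows "(AE \<gamma> in gen_cluster_measure \<mu> \<eta>. \<gamma> \<in> proper_configurations) \<and>
    (\<forall>\<phi>\<in>Diff0 A.
       absolutely_continuous (cluster_measure \<mu> \<eta>) (push_law \<phi> (cluster_measure \<mu> \<eta>)) \<and>
       ((\<lambda>(x, ys). h x ys) \<in> borel_measurable borel \<longrightarrow>
          integrable (marked_measure \<mu> \<eta>) (marked_density A G h \<phi>) \<and>
          integrable (cluster_measure \<mu> \<eta>) (Iq_star \<mu> \<eta> (marked_density A G h \<phi>)) \<and>
          (AE \<gamma> in cluster_measure \<mu> \<eta>.
             RN_deriv (cluster_measure \<mu> \<eta>) (push_law \<phi> (cluster_measure \<mu> \<eta>)) \<gamma> =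
             ennreal (Iq_star \<mu> \<eta> (marked_density A G h \<phi>) \<gamma>))))"
proof -
  interpret M: manifold_with_metric A G by (rule manifold_with_metric.intro[OF manifold])
  obtain W :: "nat \<Rightarrow> 'x set" where W: "\<And>n. open (W n)" "\<And>n. compact (closure (W n))" "(\<Union>n. W n) = UNIV"
    using M.relatively_compact_cover by blast
  interpret smooth_clusters A G \<mu> \<eta> W \<theta> h
    by (intro smooth_clusters.intro smooth_clusters_axioms.intro cluster_setting.intro)
      (fact M.manifold_with_metric_axioms W mu_sets mu_prob eta_sets eta_prob eta_meas theta mu_class eta_finite
        h_meas h_nonneg h_density[unfolded M.riemannian_volume_eq_vol] h_pos[unfolded M.riemannian_volume_eq_vol])+
  show ?thesis
  proof (intro conjI ballI impI)
    show "AE \<gamma> in gen_cluster_measure \<mu> \<eta>. \<gamma> \<in> proper_configurations"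
      by (rule AE_gen_proper)
    fix \<phi> assume \<phi>: "\<phi> \<in> Diff0 A"
    then interpret moved_clusters A G \<mu> \<eta> W \<theta> h \<phi> by unfold_locales
    show "absolutely_continuous (cluster_measure \<mu> \<eta>) (push_law \<phi> (cluster_measure \<mu> \<eta>))"
      by (rule absolutely_continuous_pushed)
    assume "(\<lambda>(x, ys). h x ys) \<in> borel_measurable borel"
    then interpret moved_clusters_joint A G \<mu> \<eta> W \<theta> h \<phi> by unfold_locales
    show "integrable (marked_measure \<mu> \<eta>) (marked_density A G h \<phi>)"
      by (rule integrable_R)
    show "integrable (cluster_measure \<mu> \<eta>) (Iq_star \<mu> \<eta> (marked_density A G h \<phi>))"
      using represents_Iq_star by (simp add: represents_def)
    show "AE \<gamma> in cluster_measure \<mu> \<eta>.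
        RN_deriv (cluster_measure \<mu> \<eta>) (push_law \<phi> (cluster_measure \<mu> \<eta>)) \<gamma> =
        ennreal (Iq_star \<mu> \<eta> (marked_density A G h \<phi>) \<gamma>)"
      by (rule RN_deriv_Iq_star)
  qed
qed

end
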